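(* Let $\mathcal{Y}$ be a Polish space, $H$ a probability measure on $\mathcal{Y}$, let $\theta,q,\alpha$ be positive real numbers, and let $g:\mathcal{Y}\to\mathbb{R}$ be measurable with $\int_{\mathcal{Y}}\log[1+|g(y)|]\,\theta H(dy)<\infty$. Let $\mu_{\theta,\theta-q}$ be a Beta-Gamma process with parameters $(\theta H,\theta-q)$, $P_\theta$ a Dirichlet process with shape $\theta H$, and $\mu_\theta$ a Gamma process with shape $\theta H$. Below, "$=$" between random variables means equality in distribution and products of the variables $T_a$, $U_{b,c}$ are products of independent variables. Suppose $0<\alpha<q$. (a) If $\mu_{\theta,\theta-q}(g)=T_\alpha$, then $P_\theta(g)=U_{\alpha,q-\alpha}$ and $\mu_\theta(g)=T_\theta U_{\alpha,q-\alpha}$. (b) This is the case (i.e. $\mu_{\theta,\theta-q}(g)=T_\alpha$, and hence the conclusions of (a) hold) if the distribution of $g(Y)$, $Y\sim H$, is such that for some fixed integer $n\ge 1$, $$T_\theta U_{\alpha,q-\alpha}+\sum_{j=1}^{n(\mathbf{p})}G_{j,n}\,g(Y_j^* )=T_{\theta+n}U_{\alpha,q-\alpha},$$ where on the left-hand side $T_\theta U_{\alpha,q-\alpha}$ and $\sum_{j=1}^{n(\mathbf{p})}G_{j,n}g(Y_j^* )$ are independent. When $n=1$ this condition reads $T_\theta U_{\alpha,q-\alpha}+T_1g(Y_1)=T_{\theta+1}U_{\alpha,q-\alpha}$, with $Y_1\sim H$ and $T_1$ independent of each other and of $T_\theta U_{\alpha,q-\alpha}$.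
   Context: $T_a$ denotes a Gamma random variable with shape $a$ and scale $1$, and $U_{b,c}$ a Beta$(b,c)$ random variable. For a measure $\mu$, $\mu(g)=\int_{\mathcal{Y}} g\,d\mu$ and $T=\mu(\mathcal{Y})$. The Gamma process with shape $\theta H$ is the random measure with law $\mathcal{G}(d\mu|\theta H)$ determined by $E[e^{-\mu(f)}]=\exp(-\int\log[1+f]\,\theta\,dH)$ for bounded measurable $f\ge 0$; the Dirichlet process with shape $\theta H$ is $\mu/T$ for such $\mu$. A Beta-Gamma process with parameters $(\theta H,d)$, $d$ real with $\theta-d>0$, is a random measure with law $\frac{\Gamma(\theta)}{\Gamma(\theta-d)}T^{-d}\mathcal{G}(d\mu|\theta H)$. $\mathbf{Y}=(Y_1,\dots,Y_n)$ has the Blackwell–MacQueen distribution $\frac{\Gamma(\theta)}{\Gamma(\theta+n)}\theta H(dY_1)\prod_{i=2}^n(\theta H+\sum_{j=1}^{i-1}\delta_{Y_j})(dY_i)$; $Y_1^*,\dots,Y_{n(\mathbf{p})}^*$ are its distinct values, $\mathbf{p}=\{C_1,\dots,C_{n(\mathbf{p})}\}$ is the partition of $\{1,\dots,n\}$ with $C_j=\{i:Y_i=Y_j^*\}$, $e_{j,n}=|C_j|$, and, conditionally on $\mathbf{p}$, the $G_{j,n}$ are independent Gamma variables with shape $e_{j,n}$ and scale $1$, independent of $(Y_j^* )_j$. *)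

theory Defs
  imports "HOL-Probability.Probability"
begin

section \<open>Gamma and Beta variables\<close>

definition gamma_law :: "real \<Rightarrow> real measure" where
  "gamma_law a = density lborel
     (\<lambda>x. ennreal (if 0 < x then x powr (a - 1) * exp (- x) / Gamma a else 0))"

definition beta_law :: "real \<Rightarrow> real \<Rightarrow> real measure" where
  "beta_law b c = density lborel
     (\<lambda>x. ennreal (if 0 < x \<and> x < 1
       then x powr (b - 1) * (1 - x) powr (c - 1) / Beta b c else 0))"

text \<open>The law of a product of two independent real variables. For the law of a sum of independent
  variables the library already has \<^const>\<open>convolution\<close>.\<close>

definition indep_times :: "real measure \<Rightarrow> real measure \<Rightarrow> real measure" where
  "indep_times M N = distr (M \<Otimes>\<^sub>M N) borel (\<lambda>(x, y). x * y)"

section \<open>Random measures\<close>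

text \<open>The space of finite measures, with the \<open>\<sigma>\<close>-algebra generated by the evaluations
  \<open>\<mu> \<mapsto> \<mu>(A)\<close>; compare \<^const>\<open>subprob_algebra\<close>.\<close>

definition finite_measure_algebra :: "'a measure \<Rightarrow> 'a measure measure" where
  "finite_measure_algebra K =
    (SUP A \<in> sets K. vimage_algebra {M. finite_measure M \<and> sets M = sets K} (\<lambda>M. emeasure M A) borel)"

lemma space_finite_measure_algebra:
  "space (finite_measure_algebra K) = {M. finite_measure M \<and> sets M = sets K}"
  by (auto simp add: finite_measure_algebra_def space_Sup_eq_UN)

lemma measurable_emeasure_finite_measure_algebra:
  "A \<in> sets K \<Longrightarrow> (\<lambda>M. emeasure M A) \<in> borel_measurable (finite_measure_algebra K)"
  by (auto intro!: measurable_Sup1 measurable_vimage_algebra1 simp: finite_measure_algebra_def)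

definition random_measure :: "'w measure \<Rightarrow> ('w \<Rightarrow> 'y::topological_space measure) \<Rightarrow> bool" where
  "random_measure M \<mu> \<longleftrightarrow> prob_space M \<and> \<mu> \<in> M \<rightarrow>\<^sub>M finite_measure_algebra borel"

abbreviation random_measure_law ::
    "'w measure \<Rightarrow> ('w \<Rightarrow> 'y::topological_space measure) \<Rightarrow> 'y measure measure" where
  "random_measure_law M \<mu> \<equiv> distr M (finite_measure_algebra borel) \<mu>"

text \<open>\<open>G\<close> is the law \<open>\<G>(d\<mu>|\<theta>H)\<close>. The Laplace functional determines it, so the witness \<open>G\<close> in the
  definitions of the Dirichlet and Beta-Gamma processes below is unique.\<close>

definition is_gamma_process_law ::
    "real \<Rightarrow> 'y::topological_space measure \<Rightarrow> 'y measure measure \<Rightarrow> bool" where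
  "is_gamma_process_law \<theta> H G \<longleftrightarrow>
     prob_space G \<and> sets G = sets (finite_measure_algebra borel) \<and>
     (\<forall>f::'y \<Rightarrow> real. f \<in> borel_measurable borel \<and> (\<forall>y. 0 \<le> f y) \<and> bounded (range f) \<longrightarrow>
        (\<integral>\<mu>. exp (- (\<integral>y. f y \<partial>\<mu>)) \<partial>G) = exp (- (\<theta> * (\<integral>y. ln (1 + f y) \<partial>H))))"

definition gamma_process ::
    "real \<Rightarrow> 'y::topological_space measure \<Rightarrow> 'w measure \<Rightarrow> ('w \<Rightarrow> 'y measure) \<Rightarrow> bool" where
  "gamma_process \<theta> H M \<mu> \<longleftrightarrow>
     random_measure M \<mu> \<and> is_gamma_process_law \<theta> H (random_measure_law M \<mu>)"

text \<open>In the next two definitions the value chosen at \<open>T = 0\<close> is immaterial: \<open>T\<close> has a Gamma law.\<close>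

definition dirichlet_process ::
    "real \<Rightarrow> 'y::topological_space measure \<Rightarrow> 'w measure \<Rightarrow> ('w \<Rightarrow> 'y measure) \<Rightarrow> bool" where
  "dirichlet_process \<theta> H M P \<longleftrightarrow>
     random_measure M P \<and>
     (\<exists>G. is_gamma_process_law \<theta> H G \<and>
        random_measure_law M P =
          random_measure_law G (\<lambda>\<mu>. scale_measure (inverse (emeasure \<mu> UNIV)) \<mu>))"

definition beta_gamma_process ::
    "real \<Rightarrow> 'y::topological_space measure \<Rightarrow> real \<Rightarrow> 'w measure \<Rightarrow> ('w \<Rightarrow> 'y measure) \<Rightarrow> bool" where
  "beta_gamma_process \<theta> H d M \<mu> \<longleftrightarrow>
     0 < \<theta> - d \<and> random_measure M \<mu> \<and>
     (\<exists>G. is_gamma_process_law \<theta> H G \<and>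
        random_measure_law M \<mu> =
          density G (\<lambda>\<mu>. ennreal (Gamma \<theta> / Gamma (\<theta> - d) * measure \<mu> UNIV powr (- d))))"

text \<open>\<open>\<mu>(g)\<close> as a law on the reals. The Bochner integral is \<open>0\<close> where \<open>g\<close> is not \<open>\<mu>\<close>-integrable; if
  \<open>log(1 + \<bar>g\<bar>)\<close> is \<open>H\<close>-integrable this is a null event for the three processes above.\<close>

definition linear_functional_law ::
    "'w measure \<Rightarrow> ('w \<Rightarrow> 'y measure) \<Rightarrow> ('y \<Rightarrow> real) \<Rightarrow> real measure" where
  "linear_functional_law M \<mu> g = distr M borel (\<lambda>w. \<integral>y. g y \<partial>(\<mu> w))"

section \<open>Blackwell--MacQueen samples\<close>

text \<open>The iterated integral
  \<open>\<integral> F(y\<^sub>1,\<dots>,y\<^sub>n) \<theta>H(dy\<^sub>1) \<Prod>\<^sub>i\<^sub>=\<^sub>2\<^sup>n (\<theta>H + \<Sum>\<^sub>j\<^sub><\<^sub>i \<delta>\<^sub>y\<^sub>j)(dy\<^sub>i)\<close>,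
  innermost variable last; points of the \<open>n\<close>-fold product are extensional functions on \<open>{1..n}\<close>.\<close>

primrec urn_integral ::
    "real \<Rightarrow> 'y measure \<Rightarrow> nat \<Rightarrow> ((nat \<Rightarrow> 'y) \<Rightarrow> ennreal) \<Rightarrow> ennreal" where
  "urn_integral \<theta> H 0 F = F (\<lambda>_. undefined)"
| "urn_integral \<theta> H (Suc n) F = urn_integral \<theta> H n (\<lambda>y.
     ennreal \<theta> * (\<integral>\<^sup>+z. F (y(Suc n := z)) \<partial>H) + (\<Sum>j\<in>{1..n}. F (y(Suc n := y j))))"

definition blackwell_macqueen ::
    "real \<Rightarrow> 'y::topological_space measure \<Rightarrow> nat \<Rightarrow> 'w measure \<Rightarrow> (nat \<Rightarrow> 'w \<Rightarrow> 'y) \<Rightarrow> bool" where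
  "blackwell_macqueen \<theta> H n N Y \<longleftrightarrow>
     prob_space N \<and> (\<forall>i\<in>{1..n}. Y i \<in> borel_measurable N) \<and>
     (\<forall>A\<in>sets (\<Pi>\<^sub>M i\<in>{1..n}. borel).
        emeasure (distr N (\<Pi>\<^sub>M i\<in>{1..n}. borel) (\<lambda>w. \<lambda>i\<in>{1..n}. Y i w)) A =
        ennreal (Gamma \<theta> / Gamma (\<theta> + real n)) * urn_integral \<theta> H n (indicator A))"

text \<open>The partition of \<open>{1..n}\<close> induced by ties. Instead of enumerating its blocks as
  \<open>C\<^sub>1,\<dots>,C\<^sub>n\<^sub>(\<^sub>p\<^sub>)\<close>, the distinct values and the weights are indexed by the blocks themselves.\<close>

definition tie_partition :: "nat \<Rightarrow> (nat \<Rightarrow> 'w \<Rightarrow> 'y) \<Rightarrow> 'w \<Rightarrow> nat set set" where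
  "tie_partition n Y w = (\<lambda>k. {i\<in>{1..n}. Y i w = Y k w}) ` {1..n}"

definition block_value :: "(nat \<Rightarrow> 'w \<Rightarrow> 'y) \<Rightarrow> nat set \<Rightarrow> 'w \<Rightarrow> 'y" where
  "block_value Y C w = Y (Min C) w"

text \<open>Conditionally on \<open>p = \<pi>\<close> (for every \<open>\<pi>\<close> of positive probability), the weights \<open>G C\<close> of the
  blocks \<open>C \<in> \<pi>\<close> are independent Gamma variables with shape \<open>card C\<close>, and they are independent of the
  distinct values. Both independence statements are expressed by the joint law being a product; the
  library's \<open>indep_var\<close> does not apply to families with different value types.\<close>

definition gamma_block_weights ::
    "nat \<Rightarrow> 'w measure \<Rightarrow> (nat \<Rightarrow> 'w \<Rightarrow> 'y::topological_space) \<Rightarrow> (nat set \<Rightarrow> 'w \<Rightarrow> real) \<Rightarrow> bool" where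
  "gamma_block_weights n N Y G \<longleftrightarrow>
     (\<forall>C. G C \<in> borel_measurable N) \<and>
     (\<forall>\<pi>. 0 < measure N {w\<in>space N. tie_partition n Y w = \<pi>} \<longrightarrow>
       (let N\<pi> = uniform_measure N {w\<in>space N. tie_partition n Y w = \<pi>};
            V = (\<lambda>w. \<lambda>C\<in>\<pi>. block_value Y C w)
        in distr N\<pi> ((\<Pi>\<^sub>M C\<in>\<pi>. borel) \<Otimes>\<^sub>M (\<Pi>\<^sub>M C\<in>\<pi>. borel)) (\<lambda>w. (\<lambda>C\<in>\<pi>. G C w, V w)) =
           (\<Pi>\<^sub>M C\<in>\<pi>. gamma_law (real (card C))) \<Otimes>\<^sub>M distr N\<pi> (\<Pi>\<^sub>M C\<in>\<pi>. borel) V))"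

definition weighted_block_sum ::
    "nat \<Rightarrow> (nat \<Rightarrow> 'w \<Rightarrow> 'y) \<Rightarrow> (nat set \<Rightarrow> 'w \<Rightarrow> real) \<Rightarrow> ('y \<Rightarrow> real) \<Rightarrow> 'w \<Rightarrow> real" where
  "weighted_block_sum n Y G g w = (\<Sum>C\<in>tie_partition n Y w. G C w * g (block_value Y C w))"

end

(*
Write T = mu(Y). A Gamma process tilted by exp(-s T) is a rescaled Gamma process, so T is
Gamma(theta) distributed and independent of P(g) = mu(g)/T; hence under the law tilted by
T^(a - theta) the functional mu(g) is a product T_a P(g) of independent factors. Part (a) follows
because moments cancel the Gamma factor and determine laws on [0, 1].

For (b), differentiating the Laplace functional n times shows that the tilt by T^n adds
independent Gamma weighted atoms at a Blackwell-MacQueen sample, so mu_theta(g) = T_theta P(g)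
satisfies X = B (X + S), where B is Beta(theta, n) and S is the sum over the blocks. By hypothesis
T_theta U satisfies the same equation, and a maximum principle for characteristic functions shows
that its solution is unique.
*)

theory Submission
  imports Defs
begin

text \<open>All three laws reduce to one unknown, the law \<nu> of P(g): the Gamma functional is
  T_\<theta> \<nu> and the Beta-Gamma functional is T_q \<nu>, so everything amounts to \<nu> =
  Beta(\<alpha>, q - \<alpha>). The bridge to T_\<alpha> is T_q U = T_\<alpha> for U with this Beta
  law.

  The factor B in (b) comes from T_\<theta> = B T_(\<theta>+n) with independent factors: multiplied
  by B, both the tilting identity T_\<theta> \<nu> + S = T_(\<theta>+n) \<nu> and the hypothesis
  become fixed point equations with the same B and S. As g may change sign and \<mu>(g) may have no
  moments, uniqueness is argued with characteristic functions.

  The Laplace functional speaks of bounded nonnegative f, whereas g is signed and unbounded. Random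
  measures are therefore first identified as laws on the space of measures, and this equality is
  then pushed forward to \<mu>(g). The log condition makes g almost surely integrable, so that the
  Bochner integral is additive when atoms are added.\<close>

section \<open>Measures determined by a multiplicative class\<close>

text \<open>Expanding one factor 1 - f leaves a term with an additional f, which is absorbed into
  \<open>g\<close>; hence \<open>g\<close> is arbitrary in the induction. The weight
  \<open>J\<close> is a separate factor because it later carries the indicators of sets already
  treated.\<close>

lemma integral_bernstein_eq:
  fixes F :: "('a \<Rightarrow> real) set"
  assumes fin: "finite_measure M" "finite_measure N"
    and meas: "\<And>f. f \<in> F \<Longrightarrow> f \<in> borel_measurable M" "\<And>f. f \<in> F \<Longrightarrow> f \<in> borel_measurable N"
    and bd: "\<And>f x. f \<in> F \<Longrightarrow> 0 \<le> f x \<and> f x \<le> 1"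
    and mult: "\<And>f g. f \<in> F \<Longrightarrow> g \<in> F \<Longrightarrow> (\<lambda>x. f x * g x) \<in> F"
    and J: "J \<in> borel_measurable M" "J \<in> borel_measurable N" "\<And>x. 0 \<le> J x \<and> J x \<le> 1"
    and eq: "\<And>g. g \<in> F \<Longrightarrow> (\<integral>x. J x * g x \<partial>M) = (\<integral>x. J x * g x \<partial>N)"
    and f: "f \<in> F" and g: "g \<in> F"
  shows "(\<integral>x. J x * (f x ^ k * (1 - f x) ^ j * g x) \<partial>M) = (\<integral>x. J x * (f x ^ k * (1 - f x) ^ j * g x) \<partial>N)"
  using g
proof (induction j arbitrary: g)
  case 0
  have "(\<lambda>x. f x ^ k * g x) \<in> F"
  proof (induction k)
    case (Suc k)
    from mult[OF f this] show ?case by (simp add: mult_ac)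
  qed (use 0 in simp)
  from eq[OF this] show ?case by simp
next
  case (Suc j)
  have int: "integrable L (\<lambda>x. J x * (f x ^ k * (1 - f x) ^ j * h x))"
    if "finite_measure L" "f \<in> borel_measurable L" "h \<in> borel_measurable L" "J \<in> borel_measurable L" "h \<in> F" for L h
  proof -
    interpret finite_measure L by fact
    note [measurable] = that(2-4)
    have "\<bar>J x * (f x ^ k * (1 - f x) ^ j * h x)\<bar> \<le> 1" for x
    proof -
      have "0 \<le> 1 - f x" "1 - f x \<le> 1" using bd[OF f, of x] by auto
      then show ?thesis using bd[OF f, of x] bd[OF that(5), of x] J(3)[of x]
        by (auto simp: abs_mult intro!: mult_le_one power_le_one)
    qed
    then show ?thesis by (intro integrable_const_bound[where B=1]) auto
  qed
  have fg: "(\<lambda>x. f x * g x) \<in> F" using mult[OF f Suc.prems] .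
  have split: "J x * (f x ^ k * (1 - f x) ^ Suc j * g x)
      = J x * (f x ^ k * (1 - f x) ^ j * g x) - J x * (f x ^ k * (1 - f x) ^ j * (f x * g x))" for x
    by (simp add: algebra_simps)
  show ?case
    unfolding split
    by (subst (1 2) Bochner_Integration.integral_diff)
       (use int fin meas f Suc.prems fg J Suc.IH[OF Suc.prems] Suc.IH[OF fg] in auto)
qed

text \<open>Bernstein polynomials turn equality of the integrals of powers into equality for continuous
  functions of \<open>f\<close>; a monotone limit then gives indicators.\<close>

lemma integral_superlevel_eq:
  fixes F :: "('a \<Rightarrow> real) set"
  assumes fin: "finite_measure M" "finite_measure N"
    and meas: "\<And>f. f \<in> F \<Longrightarrow> f \<in> borel_measurable M" "\<And>f. f \<in> F \<Longrightarrow> f \<in> borel_measurable N"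
    and bd: "\<And>f x. f \<in> F \<Longrightarrow> 0 \<le> f x \<and> f x \<le> 1"
    and mult: "\<And>f g. f \<in> F \<Longrightarrow> g \<in> F \<Longrightarrow> (\<lambda>x. f x * g x) \<in> F"
    and J: "J \<in> borel_measurable M" "J \<in> borel_measurable N" "\<And>x. 0 \<le> J x \<and> J x \<le> 1"
    and eq: "\<And>g. g \<in> F \<Longrightarrow> (\<integral>x. J x * g x \<partial>M) = (\<integral>x. J x * g x \<partial>N)"
    and f: "f \<in> F" and g: "g \<in> F"
  shows "(\<integral>x. J x * indicator {x. a < f x} x * g x \<partial>M) = (\<integral>x. J x * indicator {x. a < f x} x * g x \<partial>N)"
proof -
  note [measurable] = meas J(1,2)
  interpret M: finite_measure M by fact
  interpret N: finite_measure N by fact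
  have bern: "(\<integral>x. J x * (f x ^ k * (1 - f x) ^ j * g x) \<partial>M) = (\<integral>x. J x * (f x ^ k * (1 - f x) ^ j * g x) \<partial>N)" for k j
    by (rule integral_bernstein_eq[where F=F and J=J and M=M and N=N]) (fact fin meas bd mult J eq f g)+
  have Jg: "\<bar>J x * g x\<bar> \<le> 1" for x
    using J(3)[of x] bd[OF g, of x] by (auto simp: abs_mult intro!: mult_le_one)
  have cont: "(\<integral>x. J x * c (f x) * g x \<partial>M) = (\<integral>x. J x * c (f x) * g x \<partial>N)"
    if c: "continuous_on {0..1} c" "\<And>x. 0 \<le> c x \<and> c x \<le> 1" and [measurable]: "c \<in> borel_measurable borel"
    for c :: "real \<Rightarrow> real"
  proof -
    define P where "P n x = (\<Sum>k\<le>n. c (k / n) * Bernstein n k x)" for n x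
    have [measurable]: "P n \<in> borel_measurable borel" for n
      unfolding P_def Bernstein_def by measurable
    have Peq: "(\<integral>x. J x * P n (f x) * g x \<partial>M) = (\<integral>x. J x * P n (f x) * g x \<partial>N)" for n
    proof -
      have *: "J x * P n (f x) * g x = (\<Sum>k\<le>n. c (k / n) * (n choose k) *
          (J x * (f x ^ k * (1 - f x) ^ (n - k) * g x)))" for x
        by (simp add: P_def Bernstein_def sum_distrib_left sum_distrib_right mult_ac)
      have int: "integrable L (\<lambda>x. J x * (f x ^ k * (1 - f x) ^ j * g x))"
        if "finite_measure L" "f \<in> borel_measurable L" "g \<in> borel_measurable L" "J \<in> borel_measurable L" for L k j
      proof -
        interpret finite_measure L by fact
        note [measurable] = that(2-4)
        have "\<bar>J x * (f x ^ k * (1 - f x) ^ j * g x)\<bar> \<le> 1" for x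
        proof -
          have "0 \<le> 1 - f x" "1 - f x \<le> 1" using bd[OF f, of x] by auto
          then show ?thesis using bd[OF f, of x] bd[OF g, of x] J(3)[of x]
            by (auto simp: abs_mult intro!: mult_le_one power_le_one)
        qed
        then show ?thesis by (intro integrable_const_bound[where B=1]) auto
      qed
      show ?thesis
        unfolding *
        by (subst (1 2) Bochner_Integration.integral_sum)
           (auto intro!: sum.cong integrable_mult_right int simp: fin meas f g J bern)
    qed
    have P01: "0 \<le> P n x \<and> P n x \<le> 1" if "0 \<le> x" "x \<le> 1" for n x
    proof -
      have "P n x \<le> (\<Sum>k\<le>n. 1 * Bernstein n k x)"
        unfolding P_def by (intro sum_mono mult_right_mono) (use c(2) that in \<open>auto simp: Bernstein_nonneg\<close>)
      moreover have "0 \<le> P n x"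
        unfolding P_def by (intro sum_nonneg mult_nonneg_nonneg) (use c(2) that in \<open>auto simp: Bernstein_nonneg\<close>)
      ultimately show ?thesis by simp
    qed
    have Plim: "(\<lambda>n. P n x) \<longlonglongrightarrow> c x" if "0 \<le> x" "x \<le> 1" for x
    proof (rule LIMSEQ_I)
      fix e :: real assume "0 < e"
      from Bernstein_Weierstrass[OF c(1) this] obtain K where
        "\<forall>n x. K \<le> n \<and> x \<in> {0..1} \<longrightarrow> \<bar>c x - P n x\<bar> < e" unfolding P_def by blast
      then have "\<forall>n\<ge>K. norm (P n x - c x) < e" using that by (auto simp: abs_minus_commute)
      then show "\<exists>K. \<forall>n\<ge>K. norm (P n x - c x) < e" by blast
    qed
    have lim: "(\<lambda>n. \<integral>x. J x * P n (f x) * g x \<partial>L) \<longlonglongrightarrow> (\<integral>x. J x * c (f x) * g x \<partial>L)"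
      if "finite_measure L" and [measurable]: "f \<in> borel_measurable L" "g \<in> borel_measurable L" "J \<in> borel_measurable L" for L
    proof (rule integral_dominated_convergence[where w="\<lambda>_. 1"])
      interpret finite_measure L by fact
      show "integrable L (\<lambda>_. 1::real)" by simp
      show "AE x in L. norm (J x * P n (f x) * g x) \<le> 1" for n
      proof (rule AE_I2)
        fix x
        have "\<bar>J x * g x\<bar> * \<bar>P n (f x)\<bar> \<le> 1"
          using Jg[of x] P01[of "f x" n] bd[OF f, of x] by (intro mult_le_one) auto
        then show "norm (J x * P n (f x) * g x) \<le> 1" by (simp add: abs_mult mult_ac)
      qed
      show "AE x in L. (\<lambda>n. J x * P n (f x) * g x) \<longlonglongrightarrow> J x * c (f x) * g x"
        by (intro AE_I2 tendsto_intros Plim) (use bd[OF f] in auto)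
    qed measurable
    show ?thesis
      by (rule LIMSEQ_unique[OF lim[OF fin(1) meas(1)[OF f] meas(1)[OF g] J(1)]
            lim[OF fin(2) meas(2)[OF f] meas(2)[OF g] J(2), folded Peq]])
  qed
  \<comment> \<open>For n > 0 a ramp that vanishes up to \<open>a\<close> and equals 1 from
    \<open>a + 1/n\<close> on; its pointwise limit is the indicator of the open half-line above
    \<open>a\<close>.\<close>
  define c where "c n x = min 1 (max 0 (real n * (x - a)))" for n x
  have clim: "(\<lambda>n. c n x) \<longlonglongrightarrow> indicator {x. a < x} x" for x
  proof (cases "a < x")
    case True
    obtain K :: nat where K: "1 / (x - a) < K" using reals_Archimedean2 by blast
    have "c n x = 1" if "K \<le> n" for n
    proof -
      have "1 / (x - a) < real n" using K that by (meson less_le_trans of_nat_le_iff)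
      then have "1 < real n * (x - a)" using True by (simp add: field_simps)
      then show ?thesis by (simp add: c_def)
    qed
    then show ?thesis using True
      by (intro tendsto_eventually) (auto simp: eventually_sequentially)
  next
    case False
    then have "c n x = 0" for n by (simp add: c_def mult_nonneg_nonpos)
    then show ?thesis using False by simp
  qed
  have lim: "(\<lambda>n. \<integral>x. J x * c n (f x) * g x \<partial>L) \<longlonglongrightarrow> (\<integral>x. J x * indicator {x. a < f x} x * g x \<partial>L)"
    if "finite_measure L" and [measurable]: "f \<in> borel_measurable L" "g \<in> borel_measurable L" "J \<in> borel_measurable L" for L
  proof (rule integral_dominated_convergence[where w="\<lambda>_. 1"])
    interpret finite_measure L by fact
    show "integrable L (\<lambda>_. 1::real)" by simp
    show "AE x in L. norm (J x * c n (f x) * g x) \<le> 1" for n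
    proof (rule AE_I2)
      fix x
      have "\<bar>J x * g x\<bar> * \<bar>c n (f x)\<bar> \<le> 1"
        using Jg[of x] by (intro mult_le_one) (auto simp: c_def)
      then show "norm (J x * c n (f x) * g x) \<le> 1" by (simp add: abs_mult mult_ac)
    qed
    have ind: "indicator {x. a < f x} x = (indicator {x. a < x} (f x) :: real)" for x
      by (simp add: indicator_def)
    show "AE x in L. (\<lambda>n. J x * c n (f x) * g x) \<longlonglongrightarrow> J x * indicator {x. a < f x} x * g x"
      unfolding ind by (intro AE_I2 tendsto_intros clim)
  qed (auto simp: c_def)
  have ceq: "(\<integral>x. J x * c n (f x) * g x \<partial>M) = (\<integral>x. J x * c n (f x) * g x \<partial>N)" for n
    by (rule cont) (auto simp: c_def intro!: continuous_intros)
  show ?thesis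
      by (rule LIMSEQ_unique[OF lim[OF fin(1) meas(1)[OF f] meas(1)[OF g] J(1)]
            lim[OF fin(2) meas(2)[OF f] meas(2)[OF g] J(2), folded ceq]])
qed

text \<open>A functional monotone class theorem. \<open>integral_superlevel_eq\<close> inserts the
  indicator of one superlevel set while the remaining integrand stays in the class; repeating this
  gives equality on all finite intersections of superlevel sets, which form an intersection stable
  generator.\<close>

theorem measure_eqI_multiplicative_class:
  fixes F :: "('a \<Rightarrow> real) set"
  assumes fin: "finite_measure M" "finite_measure N"
    and sets: "sets M = sigma_sets \<Omega> {{x \<in> \<Omega>. a < f x} | a f. f \<in> F}" "sets N = sets M"
    and bd: "\<And>f x. f \<in> F \<Longrightarrow> 0 \<le> f x \<and> f x \<le> 1"
    and one: "(\<lambda>_. 1) \<in> F"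
    and mult: "\<And>f g. f \<in> F \<Longrightarrow> g \<in> F \<Longrightarrow> (\<lambda>x. f x * g x) \<in> F"
    and eq: "\<And>f. f \<in> F \<Longrightarrow> (\<integral>x. f x \<partial>M) = (\<integral>x. f x \<partial>N)"
  shows "M = N"
proof -
  interpret M: finite_measure M by fact
  interpret N: finite_measure N by fact
  let ?G = "{{x \<in> \<Omega>. a < f x} | a f. f \<in> F}"
  have G: "?G \<subseteq> Pow \<Omega>" by auto
  have space: "space M = \<Omega>" "space N = \<Omega>"
  proof -
    have "\<Omega> \<in> sets M" unfolding sets(1) by (rule sigma_sets_top)
    moreover have "A \<subseteq> \<Omega>" if "A \<in> sets M" for A
      using that sigma_sets_into_sp[OF G] unfolding sets(1) by auto
    ultimately show "space M = \<Omega>" by (meson sets.sets_into_space sets.top subset_antisym)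
    with sets(2) show "space N = \<Omega>" using sets_eq_imp_space_eq by metis
  qed
  have meas: "f \<in> borel_measurable M" if "f \<in> F" for f
    unfolding borel_measurable_iff_greater using that
    by (auto simp: space sets(1) intro!: sigma_sets.Basic)
  then have measN: "f \<in> borel_measurable N" if "f \<in> F" for f
    using that by (simp add: measurable_cong_sets[OF sets(2) refl])
  \<comment> \<open>Finite intersections of superlevel sets are coded by lists of pairs:
    intersecting becomes appending, and induction on the list imposes one condition at a
    time.\<close>
  define S where "S xs = {x \<in> \<Omega>. \<forall>(f, a) \<in> set xs. a < f x}" for xs :: "(('a \<Rightarrow> real) \<times> real) list"
  define E where "E = S ` {xs. fst ` set xs \<subseteq> F}"
  have SM: "S xs \<in> sets M" if "fst ` set xs \<subseteq> F" for xs
    using that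
  proof (induction xs)
    case Nil then show ?case by (simp add: S_def space[symmetric])
  next
    case (Cons p xs)
    have "S (p # xs) = {x \<in> space M. snd p < fst p x} \<inter> S xs" by (auto simp: S_def space)
    moreover have "{x \<in> space M. snd p < fst p x} \<in> sets M"
      using meas[of "fst p"] Cons by (auto simp: borel_measurable_iff_greater)
    ultimately show ?case using Cons by auto
  qed
  have Sint: "(\<integral>x. indicator (S xs) x * g x \<partial>M) = (\<integral>x. indicator (S xs) x * g x \<partial>N)"
    if "fst ` set xs \<subseteq> F" "g \<in> F" for xs g
    using that
  proof (induction xs arbitrary: g)
    case Nil
    have "(\<integral>x. indicator (S []) x * g x \<partial>L) = (\<integral>x. g x \<partial>L)" if "space L = \<Omega>" for L
      by (intro Bochner_Integration.integral_cong) (auto simp: S_def that)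
    then show ?case using eq[OF Nil(2)] space by simp
  next
    case (Cons p xs)
    have ind: "indicator (S (p # xs)) x * g x = indicator (S xs) x * indicator {x. snd p < fst p x} x * g x" for x
      by (auto simp: S_def indicator_def)
    have F: "fst ` set xs \<subseteq> F" "fst p \<in> F" using Cons.prems by auto
    have J: "indicator (S xs) \<in> borel_measurable M" "indicator (S xs) \<in> borel_measurable N"
      "\<And>x. 0 \<le> (indicator (S xs) x :: real) \<and> indicator (S xs) x \<le> (1 :: real)"
      using SM[OF F(1)] SM[OF F(1), folded sets(2)] by auto
    show ?case unfolding ind
      by (rule integral_superlevel_eq[where F=F and J="indicator (S xs)"])
         (fact fin meas measN bd mult J Cons.IH[OF F(1)] F(2) Cons.prems(2))+
  qed
  show ?thesis
  proof (rule measure_eqI_generator_eq[where E=E and \<Omega>=\<Omega> and A="\<lambda>_. \<Omega>"])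
    show "Int_stable E"
    proof (rule Int_stableI)
      fix a b assume "a \<in> E" "b \<in> E"
      then obtain xs ys where "a = S xs" "b = S ys" "fst ` set xs \<subseteq> F" "fst ` set ys \<subseteq> F"
        by (auto simp: E_def)
      moreover have "S xs \<inter> S ys = S (xs @ ys)" by (auto simp: S_def)
      ultimately show "a \<inter> b \<in> E" by (auto simp: E_def image_Un)
    qed
    show "E \<subseteq> Pow \<Omega>" by (auto simp: E_def S_def)
    have "?G \<subseteq> E"
    proof safe
      fix a f assume "f \<in> F"
      then show "{x \<in> \<Omega>. a < f x} \<in> E"
        unfolding E_def by (intro image_eqI[where x="[(f, a)]"]) (auto simp: S_def)
    qed
    moreover have "E \<subseteq> sets M" using SM by (auto simp: E_def)
    moreover have "sigma_sets \<Omega> E \<subseteq> sets M"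
      using sets.sigma_sets_subset[OF \<open>E \<subseteq> sets M\<close>] by (simp add: space)
    ultimately show "sets M = sigma_sets \<Omega> E" using sigma_sets_mono'[of ?G E \<Omega>] sets(1) by blast
    then show "sets N = sigma_sets \<Omega> E" using sets by simp
    show "range (\<lambda>_::nat. \<Omega>) \<subseteq> E" by (auto simp: E_def S_def intro!: image_eqI[where x="[]"])
    show "emeasure M \<Omega> \<noteq> \<infinity>" for i :: nat by simp
    fix X assume "X \<in> E"
    then obtain xs where xs: "X = S xs" "fst ` set xs \<subseteq> F" by (auto simp: E_def)
    then show "emeasure M X = emeasure N X"
      using Sint[OF xs(2) one] SM[OF xs(2)] sets(2)
      by (simp add: M.emeasure_eq_measure N.emeasure_eq_measure)
  qed auto
qed

section \<open>Real laws determined by moments or Laplace transforms\<close>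

lemma measure_eqI_moments:
  fixes M N :: "real measure"
  assumes fin: "finite_measure M" "finite_measure N"
    and sets: "sets M = sets borel" "sets N = sets borel"
    and supp: "AE x in M. 0 \<le> x \<and> x \<le> 1" "AE x in N. 0 \<le> x \<and> x \<le> 1"
    and eq: "\<And>k. (\<integral>x. x ^ k \<partial>M) = (\<integral>x. x ^ k \<partial>N)"
  shows "M = N"
proof -
  interpret M: finite_measure M by fact
  interpret N: finite_measure N by fact
  note [measurable_cong] = sets
  \<comment> \<open>The powers of the clipped variable lie in [0, 1] everywhere, as
    \<open>integral_superlevel_eq\<close> demands, and agree with the powers of x almost
    everywhere.\<close>
  define c where "c x = min 1 (max 0 x)" for x :: real
  have [measurable]: "c \<in> borel_measurable borel" unfolding c_def by measurable
  have c: "AE x in M. c x = x" "AE x in N. c x = x"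
    using supp by (auto simp: c_def)
  have ceq: "(\<integral>x. c x ^ k \<partial>M) = (\<integral>x. c x ^ k \<partial>N)" for k
  proof -
    have "(\<integral>x. c x ^ k \<partial>M) = (\<integral>x. x ^ k \<partial>M)" by (rule integral_cong_AE) (use c in auto)
    moreover have "(\<integral>x. c x ^ k \<partial>N) = (\<integral>x. x ^ k \<partial>N)" by (rule integral_cong_AE) (use c in auto)
    ultimately show ?thesis using eq by simp
  qed
  have clip: "measure M {x. a < c x} = measure N {x. a < c x}" for a
  proof -
    have "(\<integral>x. 1 * indicator {x. a < c x ^ 1} x * c x ^ 0 \<partial>M) = (\<integral>x. 1 * indicator {x. a < c x ^ 1} x * c x ^ 0 \<partial>N)"
    proof (rule integral_superlevel_eq[where F="range (\<lambda>k x. c x ^ k)"])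
      show "(\<lambda>x. f x * g x) \<in> range (\<lambda>k x. c x ^ k)"
        if "f \<in> range (\<lambda>k x. c x ^ k)" "g \<in> range (\<lambda>k x. c x ^ k)" for f g
        using that by (auto simp: power_add[symmetric] image_iff)
      show "0 \<le> f x \<and> f x \<le> 1" if "f \<in> range (\<lambda>k x. c x ^ k)" for f x
        using that by (auto simp: c_def power_le_one)
      show "(\<integral>x. 1 * g x \<partial>M) = (\<integral>x. 1 * g x \<partial>N)" if "g \<in> range (\<lambda>k x. c x ^ k)" for g
        using that ceq by auto
      show "(\<lambda>x. c x ^ 1) \<in> range (\<lambda>k x. c x ^ k)" "(\<lambda>x. c x ^ 0) \<in> range (\<lambda>k x. c x ^ k)"
        by (rule rangeI)+
    qed (use fin in auto)
    then show ?thesis using sets by (simp add: sets_eq_imp_space_eq[OF sets(1)] sets_eq_imp_space_eq[OF sets(2)])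
  qed
  have "emeasure M {a<..} = emeasure N {a<..}" for a
  proof -
    have "emeasure M {a<..} = emeasure M {x. a < c x}"
      by (rule emeasure_eq_AE) (use c in auto)
    also have "\<dots> = emeasure N {x. a < c x}"
      by (simp add: M.emeasure_eq_measure N.emeasure_eq_measure clip)
    also have "\<dots> = emeasure N {a<..}"
      by (rule emeasure_eq_AE) (use c in auto)
    finally show ?thesis .
  qed
  then show ?thesis
    by (intro measure_eqI_lessThan sets) (auto simp: M.emeasure_finite top.not_eq_extremum less_top[symmetric])
qed

text \<open>The values at integers \<open>s\<close> are the moments of the image under x -> exp(-x),
  which lives on [0, 1]; the map -ln brings the equality of the images back.\<close>

lemma measure_eqI_laplace:
  fixes M N :: "real measure"
  assumes fin: "finite_measure M" "finite_measure N"
    and sets: "sets M = sets borel" "sets N = sets borel"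
    and supp: "AE x in M. 0 \<le> x" "AE x in N. 0 \<le> x"
    and eq: "\<And>s. 0 \<le> s \<Longrightarrow> (\<integral>x. exp (- (s * x)) \<partial>M) = (\<integral>x. exp (- (s * x)) \<partial>N)"
  shows "M = N"
proof -
  note [measurable_cong] = sets
  let ?e = "\<lambda>x::real. exp (- x)" and ?l = "\<lambda>x::real. - ln x"
  have "distr M borel ?e = distr N borel ?e"
  proof (rule measure_eqI_moments)
    fix k
    have "exp (- (real k * x)) = exp (- x) ^ k" for x by (simp add: exp_of_nat_mult[symmetric])
    then show "(\<integral>x. x ^ k \<partial>distr M borel ?e) = (\<integral>x. x ^ k \<partial>distr N borel ?e)"
      using eq[of "real k"] by (simp add: integral_distr)
  qed (use fin supp in \<open>auto simp: AE_distr_iff intro: finite_measure.finite_measure_distr\<close>)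
  then have "distr (distr M borel ?e) borel ?l = distr (distr N borel ?e) borel ?l" by simp
  moreover have "distr (distr L borel ?e) borel ?l = L" if "sets L = sets borel" for L :: "real measure"
    using that by (subst distr_distr) (auto simp: comp_def distr_id2 cong: measurable_cong_sets)
  ultimately show ?thesis using sets by metis
qed

section \<open>Gamma and Beta laws\<close>

definition gamma_density :: "real \<Rightarrow> real \<Rightarrow> real" where
  "gamma_density a x = (if 0 < x then x powr (a - 1) * exp (- x) / Gamma a else 0)"

definition beta_density :: "real \<Rightarrow> real \<Rightarrow> real \<Rightarrow> real" where
  "beta_density b c x = (if 0 < x \<and> x < 1 then x powr (b - 1) * (1 - x) powr (c - 1) / Beta b c else 0)"

lemma gamma_law_eq: "gamma_law a = density lborel (\<lambda>x. ennreal (gamma_density a x))"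
  by (simp add: gamma_law_def gamma_density_def)

lemma beta_law_eq: "beta_law b c = density lborel (\<lambda>x. ennreal (beta_density b c x))"
  by (simp add: beta_law_def beta_density_def)

lemma borel_measurable_gamma_density [measurable]: "gamma_density a \<in> borel_measurable borel"
  unfolding gamma_density_def by measurable

lemma borel_measurable_beta_density [measurable]: "beta_density b c \<in> borel_measurable borel"
  unfolding beta_density_def by measurable

lemma gamma_density_nonneg: "0 < a \<Longrightarrow> 0 \<le> gamma_density a x"
  by (simp add: gamma_density_def Gamma_real_pos less_imp_le)

lemma sets_gamma_law [simp, measurable_cong]: "sets (gamma_law a) = sets borel"
  by (simp add: gamma_law_def)

lemma space_gamma_law [simp]: "space (gamma_law a) = UNIV"
  by (simp add: gamma_law_def)

lemma sets_beta_law [simp, measurable_cong]: "sets (beta_law b c) = sets borel"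
  by (simp add: beta_law_def)

lemma space_beta_law [simp]: "space (beta_law b c) = UNIV"
  by (simp add: beta_law_def)

lemma sets_indep_times [simp, measurable_cong]: "sets (indep_times M N) = sets borel"
  by (simp add: indep_times_def)

lemma space_indep_times [simp]: "space (indep_times M N) = UNIV"
  by (simp add: indep_times_def)

lemma nn_integral_gamma_law:
  "f \<in> borel_measurable borel \<Longrightarrow>
    (\<integral>\<^sup>+x. f x \<partial>gamma_law a) = (\<integral>\<^sup>+x. ennreal (gamma_density a x) * f x \<partial>lborel)"
  unfolding gamma_law_eq by (rule nn_integral_density) auto

lemma nn_integral_beta_law:
  "f \<in> borel_measurable borel \<Longrightarrow>
    (\<integral>\<^sup>+x. f x \<partial>beta_law b c) = (\<integral>\<^sup>+x. ennreal (beta_density b c x) * f x \<partial>lborel)"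
  unfolding beta_law_eq by (rule nn_integral_density) auto

lemma nn_integral_gamma_density:
  assumes "0 < a"
  shows "(\<integral>\<^sup>+x. ennreal (gamma_density a x) \<partial>lborel) = 1"
proof -
  have g: "0 < Gamma a" using assms by (rule Gamma_real_pos)
  have "gamma_density a x = indicator {0..} x * x powr (a - 1) / exp x / Gamma a" for x
    by (auto simp: gamma_density_def indicator_def exp_minus field_simps)
  then have "(\<integral>\<^sup>+x. ennreal (gamma_density a x) \<partial>lborel)
      = (\<integral>\<^sup>+x. ennreal (indicator {0..} x * x powr (a - 1) / exp x) * ennreal (1 / Gamma a) \<partial>lborel)"
    using g by (auto intro!: nn_integral_cong simp: ennreal_mult'[symmetric] ennreal_mult''[symmetric])
  also have "\<dots> = ennreal (Gamma a) * ennreal (1 / Gamma a)"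
    by (subst nn_integral_multc) (auto simp: Gamma_conv_nn_integral_real[OF assms])
  also have "\<dots> = 1" using g by (simp add: ennreal_mult'[symmetric])
  finally show ?thesis .
qed

lemma prob_space_gamma_law: "0 < a \<Longrightarrow> prob_space (gamma_law a)"
  by (rule prob_spaceI) (simp add: gamma_law_eq emeasure_density nn_integral_gamma_density)

lemma prob_space_beta_law:
  assumes "0 < b" "0 < c"
  shows "prob_space (beta_law b c)"
proof (rule prob_spaceI)
  have B: "0 < Beta b c" using assms by (simp add: Beta_def Gamma_real_pos)
  have "beta_density b c x = indicator {0..1} x * (x powr (b - 1) * (1 - x) powr (c - 1)) / Beta b c" for x
    by (cases "x = 0 \<or> x = 1") (auto simp: beta_density_def indicator_def)
  then have "emeasure (beta_law b c) (space (beta_law b c)) =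
      (\<integral>\<^sup>+x. ennreal (indicator {0..1} x * (x powr (b - 1) * (1 - x) powr (c - 1))) * ennreal (1 / Beta b c) \<partial>lborel)"
    using B unfolding beta_law_eq
    by (subst emeasure_density) (auto intro!: nn_integral_cong simp: ennreal_mult''[symmetric])
  also have "\<dots> = ennreal (Beta b c) * ennreal (1 / Beta b c)"
    by (subst nn_integral_multc)
       (auto simp: nn_integral_has_integral_lebesgue[OF _ has_integral_Beta_real[OF assms]])
  also have "\<dots> = 1" using B by (simp add: ennreal_mult'[symmetric])
  finally show "emeasure (beta_law b c) (space (beta_law b c)) = 1" .
qed

lemma AE_gamma_law: "AE x in gamma_law a. 0 < x"
  unfolding gamma_law_eq by (subst AE_density) (auto simp: gamma_density_def)

lemma AE_beta_law: "AE x in beta_law b c. 0 < x \<and> x < 1"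
  unfolding beta_law_eq by (subst AE_density) (auto simp: beta_density_def)

lemma nn_integral_exp_gamma_law:
  assumes a: "0 < a" and s: "0 \<le> s"
  shows "(\<integral>\<^sup>+x. ennreal (exp (- (s * x))) \<partial>gamma_law a) = ennreal ((1 + s) powr (- a))"
proof -
  \<comment> \<open>Pointwise form of the substitution of x / (1 + s) for x, under which exp(-(1 +
    s) x) becomes exp(-x).\<close>
  have *: "gamma_density a (x / (1 + s)) * exp (- (s * (x / (1 + s)))) / (1 + s)
      = (1 + s) powr (- a) * gamma_density a x" for x
  proof (cases "0 < x")
    case True
    have "exp (- (x / (1 + s))) * exp (- (s * (x / (1 + s)))) = exp (- x)"
      using s by (simp add: exp_add[symmetric] divide_simps) (simp add: algebra_simps)
    note e = this
    have p: "(x / (1 + s)) powr (a - 1) / (1 + s) = (1 + s) powr (- a) * x powr (a - 1)"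
    proof -
      have "(1 + s) powr a = (1 + s) powr (a - 1) * (1 + s)"
        using s by (simp add: powr_diff)
      then show ?thesis using True s by (simp add: powr_divide powr_minus divide_simps)
    qed
    have "gamma_density a (x / (1 + s)) * exp (- (s * (x / (1 + s)))) / (1 + s)
        = ((x / (1 + s)) powr (a - 1) / (1 + s)) * (exp (- (x / (1 + s))) * exp (- (s * (x / (1 + s))))) / Gamma a"
      using True s by (simp add: gamma_density_def mult_ac)
    also have "\<dots> = (1 + s) powr (- a) * gamma_density a x"
      unfolding e p using True by (simp add: gamma_density_def)
    finally show ?thesis .
  qed (use s in \<open>simp add: gamma_density_def zero_less_divide_iff\<close>)
  have "(\<integral>\<^sup>+x. ennreal (exp (- (s * x))) \<partial>gamma_law a)
      = (\<integral>\<^sup>+x. ennreal (gamma_density a x * exp (- (s * x))) \<partial>lborel)"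
    using a by (subst nn_integral_gamma_law) (auto simp: ennreal_mult'' gamma_density_nonneg)
  also have "\<dots> = ennreal \<bar>1 / (1 + s)\<bar> *
      (\<integral>\<^sup>+x. ennreal (gamma_density a (0 + 1 / (1 + s) * x) * exp (- (s * (0 + 1 / (1 + s) * x)))) \<partial>lborel)"
    using s by (intro nn_integral_real_affine) auto
  also have "\<dots> = (\<integral>\<^sup>+x. ennreal ((1 + s) powr (- a)) * ennreal (gamma_density a x) \<partial>lborel)"
    using s by (subst nn_integral_cmult[symmetric])
      (auto intro!: nn_integral_cong simp: ennreal_mult'[symmetric] *[symmetric])
  also have "\<dots> = ennreal ((1 + s) powr (- a))"
    by (subst nn_integral_cmult) (auto simp: nn_integral_gamma_density[OF a])
  finally show ?thesis .
qed

lemma nn_integral_power_gamma_law: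
  assumes a: "0 < a"
  shows "(\<integral>\<^sup>+x. ennreal (x ^ k) \<partial>gamma_law a) = ennreal (Gamma (a + k) / Gamma a)"
proof -
  have pos: "0 < Gamma a" "0 < Gamma (a + k)" using a by (auto intro!: Gamma_real_pos)
  have *: "gamma_density a x * x ^ k = Gamma (a + k) / Gamma a * gamma_density (a + k) x" for x
  proof (cases "0 < x")
    case True
    then have "x powr (a - 1) * x ^ k = x powr (a + k - 1)"
      by (simp add: powr_realpow[symmetric] powr_add[symmetric] algebra_simps)
    then show ?thesis using True pos by (simp add: gamma_density_def)
  qed (simp add: gamma_density_def)
  have "(\<integral>\<^sup>+x. ennreal (x ^ k) \<partial>gamma_law a) = (\<integral>\<^sup>+x. ennreal (gamma_density a x * x ^ k) \<partial>lborel)"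
    using a by (subst nn_integral_gamma_law)
      (auto simp: ennreal_mult' gamma_density_nonneg)
  also have "\<dots> = (\<integral>\<^sup>+x. ennreal (Gamma (a + k) / Gamma a) * ennreal (gamma_density (a + k) x) \<partial>lborel)"
    using pos unfolding * by (intro nn_integral_cong ennreal_mult') simp
  also have "\<dots> = ennreal (Gamma (a + k) / Gamma a)"
    using a by (subst nn_integral_cmult) (auto simp: nn_integral_gamma_density)
  finally show ?thesis .
qed

section \<open>Independent products and the Beta-Gamma algebra\<close>

lemma nn_integral_indep_times:
  assumes "finite_measure M" "finite_measure N"
    and [measurable_cong]: "sets M = sets borel" "sets N = sets borel"
    and [measurable]: "f \<in> borel_measurable borel"
  shows "(\<integral>\<^sup>+z. f z \<partial>indep_times M N) = (\<integral>\<^sup>+x. \<integral>\<^sup>+y. f (x * y) \<partial>N \<partial>M)"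
proof -
  interpret M: finite_measure M by fact
  interpret N: finite_measure N by fact
  interpret pair_sigma_finite M N ..
  show ?thesis
    unfolding indep_times_def
    by (simp add: nn_integral_distr N.nn_integral_fst[symmetric])
qed

lemma prob_space_indep_times:
  assumes "prob_space M" "prob_space N"
    and [measurable_cong]: "sets M = sets borel" "sets N = sets borel"
  shows "prob_space (indep_times M N)"
proof -
  interpret M: prob_space M by fact
  interpret N: prob_space N by fact
  interpret pair_prob_space M N ..
  show ?thesis unfolding indep_times_def by (rule prob_space_distr) simp
qed

text \<open>The change of variables behind the independence of sum and ratio: for independent T_b =
  x and T_c = v, the sum x + v is Gamma(b + c), the ratio x / (x + v) is Beta(b, c), and 1 / (x + v)
  is the Jacobian factor.\<close>

lemma gamma_beta_density:
  assumes b: "0 < b" and c: "0 < c" and "0 < x + v"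
  shows "gamma_density (b + c) (x + v) * beta_density b c (x / (x + v)) / (x + v)
    = gamma_density b x * gamma_density c v"
proof (cases "0 < x \<and> 0 < v")
  case True
  then have x: "0 < x" and v: "0 < v" by auto
  have pos: "0 < Gamma (b + c)" "0 < Gamma b" "0 < Gamma c" using b c by (auto intro!: Gamma_real_pos)
  have 1: "1 - x / (x + v) = v / (x + v)" using x v by (simp add: field_simps)
  have "(x + v) powr (b + c - 1) = (x + v) powr ((b - 1) + (c - 1) + 1)" by (simp add: algebra_simps)
  also have "\<dots> = (x + v) powr (b - 1) * (x + v) powr (c - 1) * (x + v)"
    using x v by (simp only: powr_add) simp
  finally have 2: "(x + v) powr (b + c - 1) = (x + v) powr (b - 1) * (x + v) powr (c - 1) * (x + v)" .
  have 3: "x / (x + v) < 1" "0 < x / (x + v)" using x v by auto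
  have 4: "(x + v) powr (b - 1) \<noteq> 0" "(x + v) powr (c - 1) \<noteq> 0" using x v by auto
  show ?thesis
    using x v pos 3 4
    by (simp add: gamma_density_def beta_density_def 1 2 powr_divide Beta_def exp_add[symmetric] exp_diff)
       (simp add: field_simps exp_minus exp_add)
next
  case False
  then show ?thesis using assms(3)
    by (auto simp: gamma_density_def beta_density_def zero_less_divide_iff)
qed

text \<open>The density of the product at x is an integral over the value t of the first factor.
  With t = x + v, \<open>gamma_beta_density\<close> splits the integrand, and the factor in v
  integrates to 1.\<close>

theorem indep_times_gamma_beta:
  assumes b: "0 < b" and c: "0 < c"
  shows "indep_times (gamma_law (b + c)) (beta_law b c) = gamma_law b"
proof (rule measure_eqI)
  fix A assume "A \<in> sets (indep_times (gamma_law (b + c)) (beta_law b c))"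
  then have A [measurable]: "A \<in> sets borel" by simp
  let ?h = "indicator A :: real \<Rightarrow> ennreal"
  let ?g = "\<lambda>x t. ennreal (gamma_density (b + c) t * beta_density b c (x / t) / t) * ?h x"
  have bc: "0 < b + c" using b c by simp
  interpret G: prob_space "gamma_law (b + c)" by (rule prob_space_gamma_law[OF bc])
  have B: "finite_measure (beta_law b c)"
    using prob_space_beta_law[OF b c] by (rule prob_space.finite_measure)
  have inner: "ennreal (gamma_density (b + c) t) * (\<integral>\<^sup>+u. ?h (t * u) \<partial>beta_law b c)
      = (\<integral>\<^sup>+x. ?g x t \<partial>lborel)" for t
  proof (cases "0 < t")
    case True
    have "(\<integral>\<^sup>+u. ?h (t * u) \<partial>beta_law b c) = (\<integral>\<^sup>+u. ennreal (beta_density b c u) * ?h (t * u) \<partial>lborel)"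
      by (subst nn_integral_beta_law) auto
    also have "\<dots> = ennreal \<bar>1 / t\<bar> *
        (\<integral>\<^sup>+x. ennreal (beta_density b c (0 + 1 / t * x)) * ?h (t * (0 + 1 / t * x)) \<partial>lborel)"
      using True by (intro nn_integral_real_affine) auto
    also have "\<dots> = ennreal (1 / t) * (\<integral>\<^sup>+x. ennreal (beta_density b c (x / t)) * ?h x \<partial>lborel)"
      using True by simp
    finally have "ennreal (gamma_density (b + c) t) * (\<integral>\<^sup>+u. ?h (t * u) \<partial>beta_law b c)
      = (ennreal (gamma_density (b + c) t) * ennreal (1 / t)) * (\<integral>\<^sup>+x. ennreal (beta_density b c (x / t)) * ?h x \<partial>lborel)"
      by (simp only: mult.assoc)
    also have "\<dots> = (\<integral>\<^sup>+x. (ennreal (gamma_density (b + c) t) * ennreal (1 / t)) * (ennreal (beta_density b c (x / t)) * ?h x) \<partial>lborel)"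
      by (rule nn_integral_cmult[symmetric]) measurable
    also have "\<dots> = (\<integral>\<^sup>+x. ?g x t \<partial>lborel)"
    proof (rule nn_integral_cong)
      fix x
      have "ennreal (gamma_density (b + c) t * beta_density b c (x / t) / t)
          = ennreal (gamma_density (b + c) t * (1 / t) * beta_density b c (x / t))" by simp
      also have "\<dots> = ennreal (gamma_density (b + c) t) * ennreal (1 / t) * ennreal (beta_density b c (x / t))"
        using True bc b c by (simp only: ennreal_mult' gamma_density_nonneg mult_nonneg_nonneg
          divide_nonneg_nonneg zero_le_one less_imp_le)
      finally show "ennreal (gamma_density (b + c) t) * ennreal (1 / t) * (ennreal (beta_density b c (x / t)) * ?h x) = ?g x t"
        by (simp only: mult.assoc)
    qed
    finally show ?thesis .
  qed (simp add: gamma_density_def)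
  have "emeasure (indep_times (gamma_law (b + c)) (beta_law b c)) A
      = (\<integral>\<^sup>+t. \<integral>\<^sup>+u. ?h (t * u) \<partial>beta_law b c \<partial>gamma_law (b + c))"
    using B by (subst nn_integral_indep_times[symmetric]) (auto intro: G.finite_measure_axioms)
  also have "\<dots> = (\<integral>\<^sup>+t. ennreal (gamma_density (b + c) t) * (\<integral>\<^sup>+u. ?h (t * u) \<partial>beta_law b c) \<partial>lborel)"
    using B finite_measure.sigma_finite_measure[OF B]
    by (intro nn_integral_gamma_law) (auto intro!: sigma_finite_measure.borel_measurable_nn_integral)
  also have "\<dots> = (\<integral>\<^sup>+t. \<integral>\<^sup>+x. ?g x t \<partial>lborel \<partial>lborel)"
    by (simp only: inner)
  also have "\<dots> = (\<integral>\<^sup>+x. \<integral>\<^sup>+t. ?g x t \<partial>lborel \<partial>lborel)"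
    by (rule lborel_pair.Fubini') measurable
  also have "\<dots> = (\<integral>\<^sup>+x. ennreal (gamma_density b x) * ?h x \<partial>lborel)"
  proof (rule nn_integral_cong)
    fix x :: real
    have pt: "gamma_density (b + c) (x + v) * beta_density b c (x / (x + v)) / (x + v)
        = gamma_density b x * gamma_density c v" for v
    proof (cases "0 < x + v")
      case True then show ?thesis by (rule gamma_beta_density[OF b c])
    qed (auto simp: gamma_density_def)
    have "(\<integral>\<^sup>+t. ?g x t \<partial>lborel) = (\<integral>\<^sup>+t. ennreal (gamma_density (b + c) t * beta_density b c (x / t) / t) \<partial>lborel) * ?h x"
      by (rule nn_integral_multc) measurable
    also have "(\<integral>\<^sup>+t. ennreal (gamma_density (b + c) t * beta_density b c (x / t) / t) \<partial>lborel)
        = (\<integral>\<^sup>+v. ennreal (gamma_density b x) * ennreal (gamma_density c v) \<partial>lborel)"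
      using b c by (subst nn_integral_real_affine[where c=1 and t=x])
        (auto simp: pt ennreal_mult' gamma_density_nonneg)
    also have "\<dots> = ennreal (gamma_density b x)"
      using c by (subst nn_integral_cmult) (auto simp: nn_integral_gamma_density)
    finally show "(\<integral>\<^sup>+t. ?g x t \<partial>lborel) = ennreal (gamma_density b x) * ?h x" .
  qed
  also have "\<dots> = emeasure (gamma_law b) A"
    by (simp add: gamma_law_eq emeasure_density)
  finally show "emeasure (indep_times (gamma_law (b + c)) (beta_law b c)) A = emeasure (gamma_law b) A" .
qed simp

text \<open>Associativity combined with B T_(b+c) = T_b. With b = \<theta> and c = n this lowers the
  shape \<theta> + n back to \<theta> and so closes the fixed point equation.\<close>

lemma indep_times_gamma_split:
  assumes b: "0 < b" and c: "0 < c" and \<nu>: "prob_space \<nu>" and [measurable_cong]: "sets \<nu> = sets borel"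
  shows "indep_times (beta_law b c) (indep_times (gamma_law (b + c)) \<nu>) = indep_times (gamma_law b) \<nu>"
proof (rule measure_eqI)
  fix A assume "A \<in> sets (indep_times (beta_law b c) (indep_times (gamma_law (b + c)) \<nu>))"
  then have [measurable]: "A \<in> sets borel" by simp
  interpret N: prob_space \<nu> by fact
  interpret G: prob_space "gamma_law (b + c)" by (rule prob_space_gamma_law) (use b c in simp)
  interpret Gb: prob_space "gamma_law b" by (rule prob_space_gamma_law[OF b])
  interpret B: prob_space "beta_law b c" by (rule prob_space_beta_law[OF b c])
  interpret GN: prob_space "indep_times (gamma_law (b + c)) \<nu>"
    by (rule prob_space_indep_times) (auto intro: N.prob_space_axioms G.prob_space_axioms simp: assms)
  interpret BG: pair_sigma_finite "beta_law b c" "gamma_law (b + c)" ..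
  let ?h = "indicator A :: real \<Rightarrow> ennreal"
  note fin = N.finite_measure_axioms G.finite_measure_axioms Gb.finite_measure_axioms
    B.finite_measure_axioms GN.finite_measure_axioms
  have "emeasure (indep_times (beta_law b c) (indep_times (gamma_law (b + c)) \<nu>)) A
      = (\<integral>\<^sup>+z. ?h z \<partial>indep_times (beta_law b c) (indep_times (gamma_law (b + c)) \<nu>))" by simp
  also have "\<dots> = (\<integral>\<^sup>+u. \<integral>\<^sup>+t. \<integral>\<^sup>+y. ?h (u * (t * y)) \<partial>\<nu> \<partial>gamma_law (b + c) \<partial>beta_law b c)"
    by (simp add: nn_integral_indep_times fin assms del: nn_integral_indicator)
  also have "\<dots> = (\<integral>\<^sup>+t. \<integral>\<^sup>+u. \<integral>\<^sup>+y. ?h (u * (t * y)) \<partial>\<nu> \<partial>beta_law b c \<partial>gamma_law (b + c))"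
    by (rule BG.Fubini'[symmetric]) measurable
  also have "\<dots> = (\<integral>\<^sup>+t. \<integral>\<^sup>+u. \<integral>\<^sup>+y. ?h ((t * u) * y) \<partial>\<nu> \<partial>beta_law b c \<partial>gamma_law (b + c))"
    by (simp add: mult_ac)
  also have "\<dots> = (\<integral>\<^sup>+x. \<integral>\<^sup>+y. ?h (x * y) \<partial>\<nu> \<partial>indep_times (gamma_law (b + c)) (beta_law b c))"
    by (subst nn_integral_indep_times) (auto simp: fin)
  also have "\<dots> = (\<integral>\<^sup>+z. ?h z \<partial>indep_times (gamma_law b) \<nu>)"
    by (simp add: indep_times_gamma_beta[OF b c] nn_integral_indep_times fin assms del: nn_integral_indicator)
  also have "\<dots> = emeasure (indep_times (gamma_law b) \<nu>) A" by simp
  finally show "emeasure (indep_times (beta_law b c) (indep_times (gamma_law (b + c)) \<nu>)) A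
    = emeasure (indep_times (gamma_law b) \<nu>) A" .
qed simp

text \<open>The moments of the Gamma factor cancel, and the Beta law is determined by its moments.\<close>

lemma indep_times_gamma_cancel:
  assumes a: "0 < a" and b: "0 < b" and c: "0 < c"
    and \<nu>: "prob_space \<nu>" and sets [measurable_cong]: "sets \<nu> = sets borel"
    and eq: "indep_times (gamma_law a) \<nu> = indep_times (gamma_law a) (beta_law b c)"
  shows "\<nu> = beta_law b c"
proof -
  interpret N: prob_space \<nu> by fact
  interpret G: prob_space "gamma_law a" by (rule prob_space_gamma_law[OF a])
  interpret B: prob_space "beta_law b c" by (rule prob_space_beta_law[OF b c])
  note fin = N.finite_measure_axioms G.finite_measure_axioms B.finite_measure_axioms
  have nn: "(\<integral>\<^sup>+x. \<integral>\<^sup>+y. f (x * y) \<partial>\<nu> \<partial>gamma_law a) = (\<integral>\<^sup>+x. \<integral>\<^sup>+y. f (x * y) \<partial>beta_law b c \<partial>gamma_law a)"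
    if [measurable]: "f \<in> borel_measurable borel" for f :: "real \<Rightarrow> ennreal"
    by (simp add: nn_integral_indep_times[symmetric] fin sets eq)
  have [simp]: "space \<nu> = UNIV" using sets_eq_imp_space_eq[OF sets] by simp
  \<comment> \<open>Nothing is known in advance about the support of \<open>\<nu>\<close>. The Gamma
    factor is positive, so the product has the sign of the second factor.\<close>
  have pos: "AE y in \<nu>. 0 < y"
  proof -
    have "emeasure \<nu> {..0} = (\<integral>\<^sup>+x. emeasure \<nu> {..0} \<partial>gamma_law a)"
      by (simp add: G.emeasure_space_1[simplified])
    also have "\<dots> = (\<integral>\<^sup>+x. \<integral>\<^sup>+y. indicator {..0} (x * y) \<partial>\<nu> \<partial>gamma_law a)"
    proof (rule nn_integral_cong_AE, use AE_gamma_law[of a] in eventually_elim)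
      fix x :: real assume "0 < x"
      then have "indicator {..0} (x * y) = (indicator {..0} y :: ennreal)" for y
        by (auto simp: indicator_def mult_le_0_iff)
      then show "emeasure \<nu> {..0} = (\<integral>\<^sup>+y. indicator {..0} (x * y) \<partial>\<nu>)" by (simp add: sets)
    qed
    also have "\<dots> = (\<integral>\<^sup>+x. \<integral>\<^sup>+y. indicator {..0} (x * y) \<partial>beta_law b c \<partial>gamma_law a)"
      by (rule nn) simp
    also have "\<dots> = (\<integral>\<^sup>+x. 0 \<partial>gamma_law a)"
    proof (rule nn_integral_cong_AE, use AE_gamma_law[of a] in eventually_elim)
      fix x :: real assume x: "0 < x"
      have "(\<integral>\<^sup>+y. indicator {..0} (x * y) \<partial>beta_law b c) = (\<integral>\<^sup>+y. 0 \<partial>beta_law b c)"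
        by (rule nn_integral_cong_AE, use AE_beta_law[of b c] in eventually_elim)
           (use x in \<open>auto simp: indicator_def mult_le_0_iff\<close>)
      then show "(\<integral>\<^sup>+y. indicator {..0} (x * y) \<partial>beta_law b c) = 0" by simp
    qed
    finally have "emeasure \<nu> {..0} = 0" by simp
    then show ?thesis by (subst AE_iff_measurable[where N="{..0}"]) (auto simp: sets)
  qed
  \<comment> \<open>Nonnegative integrals are compared, so that the cancellation does not presuppose
    finite moments of \<open>\<nu>\<close>.\<close>
  have mom: "(\<integral>\<^sup>+y. ennreal (y ^ k) \<partial>\<nu>) = (\<integral>\<^sup>+y. ennreal (y ^ k) \<partial>beta_law b c)" for k
  proof -
    let ?m = "ennreal (Gamma (a + k) / Gamma a)"
    have "0 < Gamma a" "0 < Gamma (a + k)" using a by (auto intro!: Gamma_real_pos)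
    then have m: "?m \<noteq> 0" "?m \<noteq> \<infinity>" by auto
    have *: "(\<integral>\<^sup>+x. \<integral>\<^sup>+y. ennreal ((x * y) ^ k) \<partial>L \<partial>gamma_law a) = ?m * (\<integral>\<^sup>+y. ennreal (y ^ k) \<partial>L)"
      if [measurable_cong]: "sets L = sets borel" for L
    proof -
      have "(\<integral>\<^sup>+x. \<integral>\<^sup>+y. ennreal ((x * y) ^ k) \<partial>L \<partial>gamma_law a)
          = (\<integral>\<^sup>+x. ennreal (x ^ k) * (\<integral>\<^sup>+y. ennreal (y ^ k) \<partial>L) \<partial>gamma_law a)"
      proof (rule nn_integral_cong_AE, use AE_gamma_law[of a] in eventually_elim)
        fix x :: real assume "0 < x"
        then have "(\<integral>\<^sup>+y. ennreal ((x * y) ^ k) \<partial>L) = (\<integral>\<^sup>+y. ennreal (x ^ k) * ennreal (y ^ k) \<partial>L)"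
          by (auto intro!: nn_integral_cong simp: power_mult_distrib ennreal_mult')
        then show "(\<integral>\<^sup>+y. ennreal ((x * y) ^ k) \<partial>L) = ennreal (x ^ k) * (\<integral>\<^sup>+y. ennreal (y ^ k) \<partial>L)"
          by (simp add: nn_integral_cmult)
      qed
      then show ?thesis by (simp add: nn_integral_multc nn_integral_power_gamma_law[OF a])
    qed
    have "?m * (\<integral>\<^sup>+y. ennreal (y ^ k) \<partial>\<nu>) = ?m * (\<integral>\<^sup>+y. ennreal (y ^ k) \<partial>beta_law b c)"
      using nn[of "\<lambda>z. ennreal (z ^ k)"] *[OF sets] *[of "beta_law b c"] by simp
    then show ?thesis using m by (simp add: ennreal_mult_cancel_left)
  qed
  have mom': "(\<integral>y. y ^ k \<partial>\<nu>) = (\<integral>y. y ^ k \<partial>beta_law b c)" for k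
  proof -
    have "(\<integral>y. y ^ k \<partial>\<nu>) = enn2real (\<integral>\<^sup>+y. ennreal (y ^ k) \<partial>\<nu>)"
      by (rule integral_eq_nn_integral) (use pos in auto)
    also have "\<dots> = (\<integral>y. y ^ k \<partial>beta_law b c)" unfolding mom
      by (rule integral_eq_nn_integral[symmetric]) (use AE_beta_law[of b c] in auto)
    finally show ?thesis .
  qed
  \<comment> \<open>Every moment of \<open>\<nu>\<close> bounds the mass beyond 1. These moments are
    those of the Beta law, which tend to 0 because a Beta variable is almost surely below 1; hence
    \<open>\<nu>\<close> lives on (0, 1].\<close>
  have beta0: "(\<lambda>k. \<integral>y. y ^ k \<partial>beta_law b c) \<longlonglongrightarrow> (\<integral>y. 0 \<partial>beta_law b c)"
  proof (rule integral_dominated_convergence[where w="\<lambda>_. 1"])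
    show "AE y in beta_law b c. (\<lambda>k. y ^ k) \<longlonglongrightarrow> 0"
      using AE_beta_law[of b c] by eventually_elim (auto intro!: LIMSEQ_power_zero)
    show "AE y in beta_law b c. norm (y ^ k) \<le> 1" for k
      using AE_beta_law[of b c] by eventually_elim (auto intro!: power_le_one simp: power_abs)
  qed auto
  have "emeasure \<nu> {1<..} \<le> ennreal (\<integral>y. y ^ k \<partial>beta_law b c)" for k
  proof -
    have "emeasure \<nu> {1<..} = (\<integral>\<^sup>+y. indicator {1<..} y \<partial>\<nu>)" by (simp add: sets)
    also have "\<dots> \<le> (\<integral>\<^sup>+y. ennreal (y ^ k) \<partial>\<nu>)"
      by (intro nn_integral_mono) (auto simp: indicator_def one_le_power)
    also have "\<dots> = (\<integral>\<^sup>+y. ennreal (y ^ k) \<partial>beta_law b c)" by (rule mom)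
    also have "\<dots> = ennreal (\<integral>y. y ^ k \<partial>beta_law b c)"
    proof (rule nn_integral_eq_integral)
      have "AE y in beta_law b c. norm (y ^ k) \<le> 1"
        using AE_beta_law[of b c] by eventually_elim (auto intro!: power_le_one simp: power_abs)
      then show "integrable (beta_law b c) (\<lambda>y. y ^ k)"
        by (intro B.integrable_const_bound[where B=1]) auto
    qed (use AE_beta_law[of b c] in auto)
    finally show ?thesis .
  qed
  then have "emeasure \<nu> {1<..} \<le> ennreal (\<integral>y. 0 \<partial>beta_law b c)"
    by (intro tendsto_lowerbound[OF tendsto_ennrealI[OF beta0]]) auto
  then have "AE y in \<nu>. y \<le> 1"
    by (subst AE_iff_measurable[where N="{1<..}"]) (auto simp: sets)
  with pos have supp: "AE y in \<nu>. 0 \<le> y \<and> y \<le> 1" by eventually_elim auto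
  show ?thesis
    by (rule measure_eqI_moments) (use supp mom' AE_beta_law[of b c] in \<open>auto simp: fin sets\<close>)
qed

section \<open>Characteristic functions and the fixed point equation\<close>

lemma char_convolution:
  assumes "prob_space M" "prob_space N"
    and [measurable_cong]: "sets M = sets borel" "sets N = sets borel"
  shows "char (M \<star> N) t = char M t * char N t"
proof -
  interpret M: prob_space M by fact
  interpret N: prob_space N by fact
  interpret pair_prob_space M N ..
  have int: "integrable (M \<Otimes>\<^sub>M N) (\<lambda>(x, y). iexp (t * (x + y)))"
    by (rule P.integrable_const_bound[where B=1]) auto
  have "char (M \<star> N) t = (\<integral>z. (case z of (x, y) \<Rightarrow> iexp (t * (x + y))) \<partial>(M \<Otimes>\<^sub>M N))"
    unfolding char_def convolution_def by (simp add: integral_distr split_beta)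
  also have "\<dots> = (\<integral>x. \<integral>y. iexp (t * (x + y)) \<partial>N \<partial>M)"
    using integral_fst'[OF int] by simp
  also have "\<dots> = (\<integral>x. iexp (t * x) * char N t \<partial>M)"
    unfolding char_def by (simp add: distrib_left exp_add)
  also have "\<dots> = char M t * char N t"
    unfolding char_def by simp
  finally show ?thesis .
qed

lemma char_indep_times:
  assumes "prob_space M" "prob_space N"
    and [measurable_cong]: "sets M = sets borel" "sets N = sets borel"
  shows "char (indep_times M N) t = (\<integral>x. char N (t * x) \<partial>M)"
proof -
  interpret M: prob_space M by fact
  interpret N: prob_space N by fact
  interpret pair_prob_space M N ..
  have int: "integrable (M \<Otimes>\<^sub>M N) (\<lambda>(x, y). iexp (t * (x * y)))"
    by (rule P.integrable_const_bound[where B=1]) auto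
  have "char (indep_times M N) t = (\<integral>z. (case z of (x, y) \<Rightarrow> iexp (t * (x * y))) \<partial>(M \<Otimes>\<^sub>M N))"
    unfolding char_def indep_times_def by (simp add: integral_distr split_beta)
  also have "\<dots> = (\<integral>x. \<integral>y. iexp (t * (x * y)) \<partial>N \<partial>M)"
    using integral_fst'[OF int] by simp
  also have "\<dots> = (\<integral>x. char N (t * x) \<partial>M)"
    unfolding char_def by (simp add: mult_ac)
  finally show ?thesis .
qed

text \<open>The difference \<open>h\<close> of two solutions' characteristic functions satisfies
  \<open>\<bar>h t\<bar> \<le> E \<bar>h (t B)\<bar>\<close>. A point of \<open>[-t, t]\<close> closest to \<open>0\<close> where \<open>\<bar>h\<bar>\<close> is maximal can only be
  \<open>0\<close>, because \<open>B < 1\<close> almost surely, and \<open>h 0 = 0\<close>.\<close>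

theorem scaled_convolution_fixed_point_unique:
  assumes R: "real_distribution R1" "real_distribution R2" and K: "real_distribution K"
    and B: "prob_space B" and setsB [measurable_cong]: "sets B = sets borel" and AEB: "AE b in B. 0 < b \<and> b < 1"
    and fix1: "indep_times B (R1 \<star> K) = R1" and fix2: "indep_times B (R2 \<star> K) = R2"
  shows "R1 = R2"
proof (rule Levy_uniqueness[OF R])
  interpret B: prob_space B by fact
  interpret R1: real_distribution R1 by fact
  interpret R2: real_distribution R2 by fact
  interpret K: real_distribution K by fact
  have char_eq: "char R t = (\<integral>b. char R (t * b) * char K (t * b) \<partial>B)"
    if "real_distribution R" "indep_times B (R \<star> K) = R" for R t
  proof -
    interpret R: real_distribution R by fact
    interpret RK: pair_prob_space R K ..
    have "prob_space (R \<star> K)" unfolding convolution_def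
      by (rule RK.prob_space_distr) simp
    then have "char R t = (\<integral>b. char (R \<star> K) (t * b) \<partial>B)"
      using char_indep_times[OF B, of "R \<star> K" t] that(2) setsB by simp
    also have "\<dots> = (\<integral>b. char R (t * b) * char K (t * b) \<partial>B)"
      by (subst char_convolution) (auto intro: R.prob_space_axioms K.prob_space_axioms)
    finally show ?thesis .
  qed
  define h where "h t = char R1 t - char R2 t" for t
  have [measurable]: "char R1 \<in> borel_measurable borel" "char R2 \<in> borel_measurable borel" "char K \<in> borel_measurable borel"
    by (auto intro!: borel_measurable_continuous_onI continuous_at_imp_continuous_on
        R1.isCont_char R2.isCont_char K.isCont_char)
  have h_cont: "continuous_on S (\<lambda>t. norm (h t))" for S
    unfolding h_def by (intro continuous_intros continuous_at_imp_continuous_on ballI R1.isCont_char R2.isCont_char)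
  have [measurable]: "h \<in> borel_measurable borel" unfolding h_def by measurable
  have h_bound: "norm (h t) \<le> 2" for t
    unfolding h_def using norm_triangle_ineq4[of "char R1 t" "char R2 t"]
      R1.cmod_char_le_1[of t] R2.cmod_char_le_1[of t] by linarith
  have int: "integrable B (\<lambda>b. norm (h (t * b)))" for t
    by (rule B.integrable_const_bound[where B=2]) (auto simp: h_bound)
  have h_le: "norm (h t) \<le> (\<integral>b. norm (h (t * b)) \<partial>B)" for t
  proof -
    have i: "integrable B (\<lambda>b. char R (t * b) * char K (t * b))"
      if "real_distribution R" and [measurable]: "char R \<in> borel_measurable borel" for R
    proof -
      interpret R: real_distribution R by fact
      show ?thesis
        by (rule B.integrable_const_bound[where B=1])
           (auto simp: norm_mult intro!: mult_le_one R.cmod_char_le_1 K.cmod_char_le_1)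
    qed
    have "h t = (\<integral>b. char R1 (t * b) * char K (t * b) \<partial>B) - (\<integral>b. char R2 (t * b) * char K (t * b) \<partial>B)"
      unfolding h_def using char_eq[OF R(1) fix1, of t] char_eq[OF R(2) fix2, of t] by simp
    also have "\<dots> = (\<integral>b. h (t * b) * char K (t * b) \<partial>B)"
      unfolding h_def using i R by (subst Bochner_Integration.integral_diff[symmetric]) (auto simp: left_diff_distrib)
    finally have "norm (h t) \<le> (\<integral>b. norm (h (t * b) * char K (t * b)) \<partial>B)" by simp
    \<comment> \<open>The common summand \<open>K\<close> disappears here, since its characteristic
      function is bounded by 1 in modulus.\<close>
    also have "\<dots> \<le> (\<integral>b. norm (h (t * b)) \<partial>B)"
    proof (rule integral_mono')
      show "norm (h (t * b) * char K (t * b)) \<le> norm (h (t * b))" for b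
        using mult_left_mono[OF K.cmod_char_le_1[of "t * b"], of "norm (h (t * b))"] by (simp add: norm_mult)
    qed (auto simp: int)
    finally show ?thesis .
  qed
  have "h t = 0" for t
  proof -
    let ?C = "{- \<bar>t\<bar> .. \<bar>t\<bar>}"
    obtain s0 where s0: "s0 \<in> ?C" "\<And>s. s \<in> ?C \<Longrightarrow> norm (h s) \<le> norm (h s0)"
      using continuous_attains_sup[OF _ _ h_cont, of ?C] by auto
    define Z where "Z = {s \<in> ?C. norm (h s) = norm (h s0)}"
    have "closed Z" unfolding Z_def
      by (intro continuous_closed_preimage_constant[of ?C "\<lambda>s. norm (h s)"] h_cont) auto
    then have "compact Z"
      unfolding compact_eq_bounded_closed
      by (intro conjI bounded_subset[OF bounded_closed_interval[of "- \<bar>t\<bar>" "\<bar>t\<bar>"]]) (auto simp: Z_def)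
    moreover have "s0 \<in> Z" using s0 by (auto simp: Z_def)
    ultimately obtain s where s: "s \<in> Z" "\<And>r. r \<in> Z \<Longrightarrow> \<bar>s\<bar> \<le> \<bar>r\<bar>"
      using continuous_attains_inf[of Z "\<lambda>s. \<bar>s\<bar>"] continuous_on_rabs[OF continuous_on_id] by fastforce
    have "s = 0"
    proof (rule ccontr)
      assume "s \<noteq> 0"
      have "AE b in B. norm (h (s * b)) < norm (h s0)"
        using AEB
      proof eventually_elim
        fix b :: real assume b: "0 < b \<and> b < 1"
        have less: "\<bar>s * b\<bar> < \<bar>s\<bar>" using b \<open>s \<noteq> 0\<close> by (simp add: abs_mult)
        then have "s * b \<notin> Z" using s(2)[of "s * b"] by auto
        moreover have "s * b \<in> ?C" using less s(1) by (auto simp: Z_def)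
        ultimately show "norm (h (s * b)) < norm (h s0)"
          using s0(2)[of "s * b"] by (auto simp: Z_def)
      qed
      then have "(\<integral>b. norm (h (s * b)) \<partial>B) < (\<integral>b. norm (h s0) \<partial>B)"
        by (intro B.integral_less_AE_space int) (auto simp: B.emeasure_space_1)
      with h_le[of s] s(1) show False by (simp add: Z_def B.prob_space)
    qed
    moreover have "h 0 = 0" by (simp add: h_def R1.char_zero R2.char_zero)
    ultimately have "norm (h s0) = 0" using s(1) by (auto simp: Z_def)
    moreover have "t \<in> ?C" by auto
    ultimately show ?thesis using s0(2)[of t] by simp
  qed
  then show "char R1 = char R2" by (auto simp: h_def)
qed

section \<open>Laplace functionals of random measures\<close>

lemma measurable_finite_measure_algebra:
  assumes "\<And>w. w \<in> space M \<Longrightarrow> finite_measure (f w)" "\<And>w. w \<in> space M \<Longrightarrow> sets (f w) = sets K"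
    and "\<And>A. A \<in> sets K \<Longrightarrow> (\<lambda>w. emeasure (f w) A) \<in> borel_measurable M"
  shows "f \<in> M \<rightarrow>\<^sub>M finite_measure_algebra K"
  using assms unfolding finite_measure_algebra_def
  by (auto intro!: measurable_Sup2 measurable_vimage_algebra2)

lemma measurable_nn_integral_finite_measure_algebra:
  assumes f: "f \<in> borel_measurable K"
  shows "(\<lambda>\<mu>. \<integral>\<^sup>+y. f y \<partial>\<mu>) \<in> borel_measurable (finite_measure_algebra K)"
  using f
proof induct
  case (cong f g)
  have "(\<integral>\<^sup>+y. f y \<partial>\<mu>) = (\<integral>\<^sup>+y. g y \<partial>\<mu>)" if "\<mu> \<in> space (finite_measure_algebra K)" for \<mu>
    using that cong(3) by (intro nn_integral_cong)
      (auto simp: space_finite_measure_algebra dest: sets_eq_imp_space_eq)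
  then show ?case using cong(4) by (simp cong: measurable_cong)
next
  case (set A)
  have "(\<integral>\<^sup>+y. indicator A y \<partial>\<mu>) = emeasure \<mu> A" if "\<mu> \<in> space (finite_measure_algebra K)" for \<mu>
    using that set by (auto simp: space_finite_measure_algebra)
  then show ?case using measurable_emeasure_finite_measure_algebra[OF set] by (simp cong: measurable_cong)
next
  case (mult u c)
  have "(\<integral>\<^sup>+y. c * u y \<partial>\<mu>) = c * (\<integral>\<^sup>+y. u y \<partial>\<mu>)" if "\<mu> \<in> space (finite_measure_algebra K)" for \<mu>
    using that mult(2) by (intro nn_integral_cmult)
      (auto simp: space_finite_measure_algebra cong: measurable_cong_sets)
  then show ?case using mult by (simp cong: measurable_cong)
next
  case (add u v)
  have "(\<integral>\<^sup>+y. v y + u y \<partial>\<mu>) = (\<integral>\<^sup>+y. v y \<partial>\<mu>) + (\<integral>\<^sup>+y. u y \<partial>\<mu>)"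
    if "\<mu> \<in> space (finite_measure_algebra K)" for \<mu>
    using that add(1,4) by (intro nn_integral_add)
      (auto simp: space_finite_measure_algebra cong: measurable_cong_sets)
  then show ?case using add by (simp cong: measurable_cong)
next
  case (seq U)
  have "(\<integral>\<^sup>+y. (SUP i. U i) y \<partial>\<mu>) = (SUP i. \<integral>\<^sup>+y. U i y \<partial>\<mu>)"
    if "\<mu> \<in> space (finite_measure_algebra K)" for \<mu>
    using that seq(1,4) unfolding SUP_apply by (intro nn_integral_monotone_convergence_SUP)
      (auto simp: space_finite_measure_algebra cong: measurable_cong_sets)
  then show ?case using seq by (simp cong: measurable_cong)
qed

lemma measurable_integral_finite_measure_algebra:
  fixes f :: "'a \<Rightarrow> real"
  assumes [measurable]: "f \<in> borel_measurable K"
  shows "(\<lambda>\<mu>. \<integral>y. f y \<partial>\<mu>) \<in> borel_measurable (finite_measure_algebra K)"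
proof -
  note [measurable] = measurable_nn_integral_finite_measure_algebra
  \<comment> \<open>The default value 0 of the Bochner integral is made explicit; what remains is
    built from nonnegative integrals, whose measurability in \<open>\<mu>\<close> is known.\<close>
  have "(\<integral>y. f y \<partial>\<mu>) = (if (\<integral>\<^sup>+y. ennreal (norm (f y)) \<partial>\<mu>) < \<infinity>
      then enn2real (\<integral>\<^sup>+y. ennreal (f y) \<partial>\<mu>) - enn2real (\<integral>\<^sup>+y. ennreal (- f y) \<partial>\<mu>) else 0)"
    if "\<mu> \<in> space (finite_measure_algebra K)" for \<mu>
  proof -
    have "f \<in> borel_measurable \<mu>"
      using that assms by (auto simp: space_finite_measure_algebra cong: measurable_cong_sets)
    then show ?thesis
      by (auto simp: integrable_iff_bounded real_lebesgue_integral_def not_integrable_integral_eq)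
  qed
  then show ?thesis by (simp cong: measurable_cong)
qed

lemma finite_measure_scale_measure:
  assumes "finite_measure M" "r \<noteq> \<infinity>"
  shows "finite_measure (scale_measure r M)"
proof (rule finite_measureI)
  interpret finite_measure M by fact
  show "emeasure (scale_measure r M) (space (scale_measure r M)) \<noteq> \<infinity>"
    using assms(2) by (simp add: ennreal_mult_eq_top_iff)
qed

lemma integral_scale_measure:
  fixes f :: "'a \<Rightarrow> real"
  assumes "0 \<le> r" "f \<in> borel_measurable M"
  shows "(\<integral>y. f y \<partial>scale_measure (ennreal r) M) = r * (\<integral>y. f y \<partial>M)"
proof -
  have "scale_measure (ennreal r) M = density M (\<lambda>_. ennreal r)"
    by (rule measure_eqI) (auto simp: emeasure_density_const)
  then show ?thesis using assms by (simp add: integral_density)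
qed

lemma integrable_bounded_nonneg:
  fixes f :: "'a \<Rightarrow> real"
  assumes "finite_measure M" "f \<in> borel_measurable M" "bounded (range f)"
  shows "integrable M f"
proof -
  interpret finite_measure M by fact
  obtain B where "\<And>y. \<bar>f y\<bar> \<le> B" using assms(3) by (auto simp: bounded_iff)
  then show ?thesis using assms(2) by (intro integrable_const_bound[where B=B]) auto
qed

text \<open>The functionals exp(-\<mu>(f)) form a multiplicative class, because exponents add and
  the sum of bounded functions is bounded. They generate the sigma-algebra, because for f the
  indicator of A the value of -ln is \<mu>(A).\<close>

theorem finite_measure_algebra_laplace_unique:
  fixes G1 G2 :: "'a measure measure"
  assumes fin: "finite_measure G1" "finite_measure G2"
    and sets: "sets G1 = sets (finite_measure_algebra K)" "sets G2 = sets (finite_measure_algebra K)"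
    and eq: "\<And>f::'a \<Rightarrow> real. f \<in> borel_measurable K \<Longrightarrow> (\<And>y. 0 \<le> f y) \<Longrightarrow> bounded (range f) \<Longrightarrow>
        (\<integral>\<mu>. exp (- (\<integral>y. f y \<partial>\<mu>)) \<partial>G1) = (\<integral>\<mu>. exp (- (\<integral>y. f y \<partial>\<mu>)) \<partial>G2)"
  shows "G1 = G2"
proof -
  define \<Omega> where "\<Omega> = space (finite_measure_algebra K)"
  have \<Omega>: "\<mu> \<in> \<Omega> \<longleftrightarrow> finite_measure \<mu> \<and> sets \<mu> = sets K" for \<mu>
    by (auto simp: \<Omega>_def space_finite_measure_algebra)
  have space: "space G1 = \<Omega>" "space G2 = \<Omega>"
    using sets_eq_imp_space_eq[OF sets(1)] sets_eq_imp_space_eq[OF sets(2)] by (auto simp: \<Omega>_def)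
  \<comment> \<open>The value 1 outside \<open>\<Omega>\<close> keeps the bounds and the closure
    under products valid for every argument and makes \<open>L (\<lambda>_. 0)\<close> the constant
    1.\<close>
  define L where "L f \<mu> = (if \<mu> \<in> \<Omega> then exp (- (\<integral>y. f y \<partial>\<mu>)) else 1)" for f :: "'a \<Rightarrow> real" and \<mu>
  define F where "F = L ` {f. f \<in> borel_measurable K \<and> (\<forall>y. 0 \<le> f y) \<and> bounded (range f)}"
  have Lmeas: "L f \<in> borel_measurable (finite_measure_algebra K)" if "f \<in> borel_measurable K" for f
  proof -
    note [measurable] = measurable_integral_finite_measure_algebra[OF that]
    have "(\<lambda>\<mu>. exp (- (\<integral>y. f y \<partial>\<mu>))) \<in> borel_measurable (finite_measure_algebra K)" by measurable
    then show ?thesis by (simp add: L_def \<Omega>_def cong: measurable_cong)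
  qed
  let ?S = "{{x \<in> \<Omega>. a < f x} | a f. f \<in> F}"
  have gen: "sets (finite_measure_algebra K) = sigma_sets \<Omega> ?S"
  proof
    have "?S \<subseteq> sets (finite_measure_algebra K)"
      using Lmeas by (auto simp: F_def \<Omega>_def borel_measurable_iff_greater)
    then show "sigma_sets \<Omega> ?S \<subseteq> sets (finite_measure_algebra K)"
      unfolding \<Omega>_def by (rule sets.sigma_sets_subset)
    have S: "?S \<subseteq> Pow \<Omega>" by auto
    have "(\<lambda>\<mu>. \<mu>) \<in> sigma \<Omega> ?S \<rightarrow>\<^sub>M finite_measure_algebra K"
    proof (rule measurable_finite_measure_algebra)
      fix A assume A: "A \<in> sets K"
      have "bounded (range (indicator A :: 'a \<Rightarrow> real))"
        by (auto simp: bounded_iff indicator_def intro!: exI[of _ 1])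
      then have "L (indicator A) \<in> F" unfolding F_def using A by auto
      then have [measurable]: "L (indicator A) \<in> borel_measurable (sigma \<Omega> ?S)"
        unfolding borel_measurable_iff_greater using S by (auto intro!: sigma_sets.Basic)
      have "emeasure \<mu> A = ennreal (- ln (L (indicator A) \<mu>))" if "\<mu> \<in> space (sigma \<Omega> ?S)" for \<mu>
      proof -
        have "\<mu> \<in> \<Omega>" using that S by (simp add: space_measure_of)
        then interpret finite_measure \<mu> by (simp add: \<Omega>)
        show ?thesis using \<open>\<mu> \<in> \<Omega>\<close> A by (simp add: L_def \<Omega> emeasure_eq_measure)
      qed
      then show "(\<lambda>\<mu>. emeasure \<mu> A) \<in> borel_measurable (sigma \<Omega> ?S)"
        by (simp cong: measurable_cong)
    qed (use S in \<open>auto simp: \<Omega> space_measure_of\<close>)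
    from measurable_sets[OF this] show "sets (finite_measure_algebra K) \<subseteq> sigma_sets \<Omega> ?S"
      using S sets.sets_into_space[of _ "finite_measure_algebra K"]
      by (fastforce simp: \<Omega>_def[symmetric] Int_absorb2)
  qed
  show ?thesis
  proof (rule measure_eqI_multiplicative_class[where F=F and \<Omega>=\<Omega>])
    show "sets G1 = sigma_sets \<Omega> ?S" using sets(1) gen by simp
    show "sets G2 = sets G1" using sets by simp
    show "0 \<le> f x \<and> f x \<le> 1" if "f \<in> F" for f x
      using that by (auto simp: F_def L_def intro!: integral_nonneg_AE)
    have "L (\<lambda>_. 0) = (\<lambda>_. 1)" by (auto simp: L_def)
    moreover have "L (\<lambda>_. 0) \<in> F" unfolding F_def by (rule imageI) auto
    ultimately show "(\<lambda>_. 1) \<in> F" by simp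
    show "(\<lambda>x. f x * g x) \<in> F" if f: "f \<in> F" and g: "g \<in> F" for f g
    proof -
      obtain u v where uv: "f = L u" "u \<in> borel_measurable K" "\<And>y. 0 \<le> u y" "bounded (range u)"
          "g = L v" "v \<in> borel_measurable K" "\<And>y. 0 \<le> v y" "bounded (range v)"
        using f g by (auto simp: F_def)
      have "(\<lambda>x. f x * g x) = L (\<lambda>y. u y + v y)"
      proof
        fix \<mu>
        show "f \<mu> * g \<mu> = L (\<lambda>y. u y + v y) \<mu>"
        proof (cases "\<mu> \<in> \<Omega>")
          case True
          then have "integrable \<mu> u" "integrable \<mu> v"
            using uv by (auto intro!: integrable_bounded_nonneg simp: \<Omega> cong: measurable_cong_sets)
          then show ?thesis using True by (simp add: L_def uv exp_add[symmetric])
        qed (simp add: L_def uv)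
      qed
      moreover have "bounded (range (\<lambda>y. u y + v y))"
        using bounded_plus_comp[OF uv(4) uv(8)] by simp
      ultimately show ?thesis unfolding F_def using uv by (auto intro!: imageI)
    qed
    show "(\<integral>x. f x \<partial>G1) = (\<integral>x. f x \<partial>G2)" if f: "f \<in> F" for f
    proof -
      obtain u where u: "f = L u" "u \<in> borel_measurable K" "\<forall>y. 0 \<le> u y" "bounded (range u)"
        using f unfolding F_def by blast
      have "(\<integral>x. f x \<partial>G) = (\<integral>\<mu>. exp (- (\<integral>y. u y \<partial>\<mu>)) \<partial>G)" if "space G = \<Omega>" for G
        by (rule Bochner_Integration.integral_cong) (auto simp: u L_def that)
      with space eq[OF u(2) _ u(4)] u(3) show ?thesis by metis
    qed
  qed (use fin in auto)
qed

section \<open>The Gamma process law: total mass, tilting and normalisation\<close>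

text \<open>The laws of the three processes are this law itself, an image of it and a law with a
  density with respect to it. The analysis therefore takes place on \<open>G\<close>, with the
  random measure as sample point.\<close>

locale gamma_process_law =
  fixes \<theta> :: real and H :: "'y::topological_space measure" and G :: "'y measure measure"
  assumes prob_H: "prob_space H" and sets_H: "sets H = sets borel" and \<theta>_pos: "0 < \<theta>"
    and law: "is_gamma_process_law \<theta> H G"
begin

sublocale H: prob_space H by (rule prob_H)
sublocale G: prob_space G using law by (simp add: is_gamma_process_law_def)

lemma sets_G [measurable_cong]: "sets G = sets (finite_measure_algebra borel)"
  using law by (simp add: is_gamma_process_law_def)

lemma space_G: "\<mu> \<in> space G \<longleftrightarrow> finite_measure \<mu> \<and> sets \<mu> = sets borel"
  using sets_eq_imp_space_eq[OF sets_G] by (simp add: space_finite_measure_algebra)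

lemma space_point: "\<mu> \<in> space G \<Longrightarrow> space \<mu> = UNIV"
  by (auto simp: space_G dest: sets_eq_imp_space_eq)

lemma measurable_point: "\<mu> \<in> space G \<Longrightarrow> f \<in> borel_measurable borel \<Longrightarrow> f \<in> borel_measurable \<mu>"
  by (simp add: space_G cong: measurable_cong_sets)

lemma integrable_point:
  "\<mu> \<in> space G \<Longrightarrow> f \<in> borel_measurable borel \<Longrightarrow> bounded (range f) \<Longrightarrow> integrable \<mu> (f :: 'y \<Rightarrow> real)"
  by (rule integrable_bounded_nonneg) (auto simp: measurable_point, auto simp: space_G)

lemma laplace:
  assumes "f \<in> borel_measurable borel" "\<And>y. 0 \<le> f y" "bounded (range f)"
  shows "(\<integral>\<mu>. exp (- (\<integral>y. f y \<partial>\<mu>)) \<partial>G) = exp (- (\<theta> * (\<integral>y. ln (1 + f y) \<partial>H)))"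
  using law assms by (simp add: is_gamma_process_law_def)

lemma measurable_integral [measurable]:
  "f \<in> borel_measurable borel \<Longrightarrow> (\<lambda>\<mu>. \<integral>y. f y \<partial>\<mu> :: real) \<in> borel_measurable G"
  using measurable_integral_finite_measure_algebra[of f borel] by (simp cong: measurable_cong_sets[OF sets_G])

lemma measurable_nn_integral [measurable]:
  "f \<in> borel_measurable borel \<Longrightarrow> (\<lambda>\<mu>. \<integral>\<^sup>+y. f y \<partial>\<mu>) \<in> borel_measurable G"
  using measurable_nn_integral_finite_measure_algebra[of f borel] by (simp cong: measurable_cong_sets[OF sets_G])

lemma measurable_emeasure [measurable]: "A \<in> sets borel \<Longrightarrow> (\<lambda>\<mu>. emeasure \<mu> A) \<in> borel_measurable G"
  using measurable_emeasure_finite_measure_algebra[of A borel] unfolding measurable_cong_sets[OF sets_G refl] .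

lemma measurable_measure [measurable]: "A \<in> sets borel \<Longrightarrow> (\<lambda>\<mu>. measure \<mu> A) \<in> borel_measurable G"
  unfolding measure_def by (intro borel_measurable_enn2real measurable_emeasure)

text \<open>The constant function s in the Laplace functional gives (1 + s)^(-\<theta>), which is
  the Laplace transform of the Gamma law.\<close>

lemma total_mass_law: "distr G borel (\<lambda>\<mu>. measure \<mu> UNIV) = gamma_law \<theta>"
proof (rule measure_eqI_laplace)
  interpret L: prob_space "gamma_law \<theta>" by (rule prob_space_gamma_law[OF \<theta>_pos])
  show "finite_measure (gamma_law \<theta>)" by (rule L.finite_measure)
  show "finite_measure (distr G borel (\<lambda>\<mu>. measure \<mu> UNIV))"
    by (rule G.finite_measure_distr) simp
  show "AE x in gamma_law \<theta>. 0 \<le> x" using AE_gamma_law[of \<theta>] by eventually_elim simp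
  show "AE x in distr G borel (\<lambda>\<mu>. measure \<mu> UNIV). 0 \<le> x" by (simp add: AE_distr_iff)
  fix s :: real assume s: "0 \<le> s"
  have "(\<integral>x. exp (- (s * x)) \<partial>distr G borel (\<lambda>\<mu>. measure \<mu> UNIV)) = (\<integral>\<mu>. exp (- (s * measure \<mu> UNIV)) \<partial>G)"
    by (simp add: integral_distr)
  also have "\<dots> = (\<integral>\<mu>. exp (- (\<integral>y. s \<partial>\<mu>)) \<partial>G)"
    by (rule Bochner_Integration.integral_cong) (auto simp: space_point mult.commute)
  also have "\<dots> = (1 + s) powr (- \<theta>)"
    using s by (subst laplace) (auto simp: powr_def H.prob_space)
  also have "\<dots> = (\<integral>x. exp (- (s * x)) \<partial>gamma_law \<theta>)"
    using s by (subst integral_eq_nn_integral) (auto simp: nn_integral_exp_gamma_law[OF \<theta>_pos])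
  finally show "(\<integral>x. exp (- (s * x)) \<partial>distr G borel (\<lambda>\<mu>. measure \<mu> UNIV)) = (\<integral>x. exp (- (s * x)) \<partial>gamma_law \<theta>)" .
qed simp_all

lemma integrable_ln_bounded:
  fixes f :: "'y \<Rightarrow> real"
  assumes [measurable]: "f \<in> borel_measurable borel" and f: "\<And>y. 0 \<le> f y" "bounded (range f)"
  shows "integrable H (\<lambda>y. ln (1 + f y))"
proof -
  note [measurable_cong] = sets_H
  obtain B where B: "\<And>y. \<bar>f y\<bar> \<le> B" using f(2) by (auto simp: bounded_iff)
  have "\<bar>ln (1 + f y)\<bar> \<le> B" for y
    using ln_add_one_self_le_self[OF f(1), of y] B[of y] f(1)[of y] by simp
  then show ?thesis by (intro H.integrable_const_bound[where B=B]) auto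
qed

text \<open>It rests on 1 + f + s = (1 + s) (1 + f / (1 + s)): the logarithm splits into a constant,
  cancelled by the normalisation (1 + s)^\<theta>, and the Laplace exponent of f / (1 + s), that is,
  of the rescaled measure.\<close>

lemma tilt_eq_scale:
  assumes s: "0 \<le> s"
  shows "density G (\<lambda>\<mu>. ennreal ((1 + s) powr \<theta> * exp (- (s * measure \<mu> UNIV))))
    = distr G (finite_measure_algebra borel) (scale_measure (ennreal (1 / (1 + s))))"
    (is "?L = ?R")
proof (rule finite_measure_algebra_laplace_unique)
  have [measurable]: "scale_measure (ennreal (1 / (1 + s))) \<in> G \<rightarrow>\<^sub>M finite_measure_algebra borel"
    by (rule measurable_finite_measure_algebra)
       (auto simp: space_G intro!: finite_measure_scale_measure)
  show "finite_measure ?R" by (rule G.finite_measure_distr) simp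
  show "finite_measure ?L"
  proof (rule finite_measureI)
    have "emeasure ?L (space ?L) = (\<integral>\<^sup>+\<mu>. ennreal ((1 + s) powr \<theta> * exp (- (s * measure \<mu> UNIV))) \<partial>G)"
      by (simp add: emeasure_density cong: nn_integral_cong)
    also have "\<dots> \<le> (\<integral>\<^sup>+\<mu>. ennreal ((1 + s) powr \<theta>) \<partial>G)"
      using s by (intro nn_integral_mono ennreal_leI) (auto intro!: mult_left_le)
    also have "\<dots> < \<infinity>" by (simp add: G.emeasure_space_1)
    finally show "emeasure ?L (space ?L) \<noteq> \<infinity>" by simp
  qed
  fix f :: "'y \<Rightarrow> real"
  assume f [measurable]: "f \<in> borel_measurable borel" and f0: "\<And>y. 0 \<le> f y" and fb: "bounded (range f)"
  have bs: "bounded (range (\<lambda>y. f y + s))" using bounded_plus_comp[OF fb, of "\<lambda>_. s"] by simp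
  have bd: "bounded (range (\<lambda>y. 1 / (1 + s) * f y))"
    using bounded_scaling[OF fb, of "1 / (1 + s)"] by (simp add: image_image)
  have pt: "exp (- (\<integral>y. f y + s \<partial>\<mu>)) = exp (- (s * measure \<mu> UNIV)) * exp (- (\<integral>y. f y \<partial>\<mu>))"
    if "\<mu> \<in> space G" for \<mu>
  proof -
    interpret \<mu>: finite_measure \<mu> using that by (simp add: space_G)
    show ?thesis
      using integrable_point[OF that f fb] by (simp add: space_point[OF that] exp_add[symmetric] mult.commute)
  qed
  have ln_eq: "ln (1 + (f y + s)) = ln (1 + 1 / (1 + s) * f y) + ln (1 + s)" for y
  proof -
    have "1 + (f y + s) = (1 + 1 / (1 + s) * f y) * (1 + s)" using s by (simp add: field_simps)
    moreover have "0 < 1 + 1 / (1 + s) * f y" using s f0[of y] by (simp add: add_pos_nonneg)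
    ultimately show ?thesis using s by (simp add: ln_mult)
  qed
  have int: "integrable H (\<lambda>y. ln (1 + 1 / (1 + s) * f y))"
    by (rule integrable_ln_bounded) (use s f0 bd in auto)
  have "(\<integral>\<mu>. exp (- (\<integral>y. f y \<partial>\<mu>)) \<partial>?L)
      = (\<integral>\<mu>. (1 + s) powr \<theta> * exp (- (s * measure \<mu> UNIV)) * exp (- (\<integral>y. f y \<partial>\<mu>)) \<partial>G)"
    using s by (subst integral_density) auto
  also have "\<dots> = (\<integral>\<mu>. (1 + s) powr \<theta> * exp (- (\<integral>y. f y + s \<partial>\<mu>)) \<partial>G)"
    by (rule Bochner_Integration.integral_cong) (simp_all add: pt)
  also have "\<dots> = (1 + s) powr \<theta> * exp (- (\<theta> * (\<integral>y. ln (1 + (f y + s)) \<partial>H)))"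
    using s f0 bs by (simp add: laplace)
  also have "(\<integral>y. ln (1 + (f y + s)) \<partial>H) = (\<integral>y. ln (1 + 1 / (1 + s) * f y) \<partial>H) + ln (1 + s)"
    unfolding ln_eq by (subst Bochner_Integration.integral_add[OF int]) (auto simp: H.prob_space)
  also have "(1 + s) powr \<theta> * exp (- (\<theta> * ((\<integral>y. ln (1 + 1 / (1 + s) * f y) \<partial>H) + ln (1 + s))))
      = exp (- (\<theta> * (\<integral>y. ln (1 + 1 / (1 + s) * f y) \<partial>H)))"
    using s by (simp add: powr_def distrib_left exp_add[symmetric])
  also have "\<dots> = (\<integral>\<mu>. exp (- (\<integral>y. 1 / (1 + s) * f y \<partial>\<mu>)) \<partial>G)"
    by (rule laplace[symmetric]) (use s f0 bd in auto)
  also have "\<dots> = (\<integral>\<mu>. exp (- (\<integral>y. f y \<partial>\<mu>)) \<partial>?R)"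
    using s measurable_integral_finite_measure_algebra[OF f]
    by (subst integral_distr)
       (auto intro!: Bochner_Integration.integral_cong simp: integral_scale_measure measurable_point)
  finally show "(\<integral>\<mu>. exp (- (\<integral>y. f y \<partial>\<mu>)) \<partial>?L) = (\<integral>\<mu>. exp (- (\<integral>y. f y \<partial>\<mu>)) \<partial>?R)" .
qed (auto simp: sets_G)

definition normalise :: "'y measure \<Rightarrow> 'y measure" where
  "normalise \<mu> = scale_measure (inverse (emeasure \<mu> UNIV)) \<mu>"

lemma measurable_normalise: "normalise \<in> G \<rightarrow>\<^sub>M finite_measure_algebra borel"
proof (rule measurable_finite_measure_algebra)
  fix \<mu> assume \<mu>: "\<mu> \<in> space G"
  then interpret finite_measure \<mu> by (simp add: space_G)
  show "sets (normalise \<mu>) = sets borel" using \<mu> by (simp add: space_G normalise_def)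
  show "finite_measure (normalise \<mu>)"
  proof (rule finite_measureI)
    \<comment> \<open>The null measure is scaled by the factor \<infinity>, but \<infinity> times 0
      is 0, so the result is again finite.\<close>
    have "inverse (emeasure \<mu> UNIV) * emeasure \<mu> UNIV \<noteq> \<infinity>"
      using emeasure_finite[of UNIV]
      by (cases "emeasure \<mu> UNIV = 0") (auto simp: ennreal_mult_eq_top_iff ennreal_inverse_eq_top_iff)
    then show "emeasure (normalise \<mu>) (space (normalise \<mu>)) \<noteq> \<infinity>"
      using space_point[OF \<mu>] by (simp add: normalise_def space_scale_measure)
  qed
qed (simp add: normalise_def)

lemma normalise_scale:
  assumes "\<mu> \<in> space G" "0 < r"
  shows "normalise (scale_measure (ennreal r) \<mu>) = normalise \<mu>"
proof (rule measure_eqI)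
  interpret finite_measure \<mu> using assms by (simp add: space_G)
  fix A
  show "emeasure (normalise (scale_measure (ennreal r) \<mu>)) A = emeasure (normalise \<mu>) A"
  proof (cases "emeasure \<mu> UNIV = 0")
    case True
    then have "emeasure \<mu> A = 0" by (metis emeasure_mono[of A UNIV \<mu>] le_zero_eq
      assms(1) emeasure_notin_sets space_point sets.top top_greatest)
    then show ?thesis by (simp add: normalise_def)
  next
    case False
    have "inverse (ennreal r * emeasure \<mu> UNIV) * (ennreal r * emeasure \<mu> A) = inverse (emeasure \<mu> UNIV) * emeasure \<mu> A"
      using False assms(2) by (simp add: emeasure_eq_measure ennreal_mult'[symmetric] inverse_ennreal
        zero_less_measure_iff less_le)
    then show ?thesis by (simp add: normalise_def mult.assoc)
  qed
qed (simp add: normalise_def)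

text \<open>This covers non-integrable \<open>g\<close> as well: multiplication by a positive
  constant preserves non-integrability, and both integrals then take the default value 0. At total
  mass 0 every integral vanishes.\<close>

lemma integral_eq_mass_times_normalise:
  fixes g :: "'y \<Rightarrow> real"
  assumes \<mu>: "\<mu> \<in> space G" and g: "g \<in> borel_measurable borel"
  shows "(\<integral>y. g y \<partial>\<mu>) = measure \<mu> UNIV * (\<integral>y. g y \<partial>normalise \<mu>)"
proof (cases "measure \<mu> UNIV = 0")
  interpret finite_measure \<mu> using \<mu> by (simp add: space_G)
  case True
  then have "emeasure \<mu> (space \<mu>) = 0" by (simp add: emeasure_eq_measure space_point[OF \<mu>])
  then have "AE y in \<mu>. False" by (subst AE_iff_measurable[OF _ refl]) auto
  then have "(\<integral>y. g y \<partial>\<mu>) = (\<integral>y. 0 \<partial>\<mu>)" 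
    by (intro integral_cong_AE) (auto simp: measurable_point[OF \<mu> g])
  then show ?thesis using True by simp
next
  interpret finite_measure \<mu> using \<mu> by (simp add: space_G)
  case False
  then have pos: "0 < measure \<mu> UNIV" by (simp add: less_le)
  then have "normalise \<mu> = scale_measure (ennreal (1 / measure \<mu> UNIV)) \<mu>"
    by (simp add: normalise_def emeasure_eq_measure inverse_ennreal inverse_eq_divide)
  then show ?thesis using pos by (simp add: integral_scale_measure measurable_point[OF \<mu> g])
qed

end

section \<open>Independence of mass and normalisation, power tilts, integrability\<close>

context gamma_process_law
begin

text \<open>Tilting does not affect scale invariant functionals, so the joint Laplace transform of the
  total mass and \<open>\<mu>(g)/T\<close> factorises.\<close>

lemma mass_normalise_law:
  fixes g :: "'y \<Rightarrow> real"
  assumes g [measurable]: "g \<in> borel_measurable borel"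
  defines "X \<equiv> \<lambda>\<mu>. \<integral>y. g y \<partial>normalise \<mu>"
  shows "distr G (borel \<Otimes>\<^sub>M borel) (\<lambda>\<mu>. (measure \<mu> UNIV, X \<mu>)) = gamma_law \<theta> \<Otimes>\<^sub>M distr G borel X"
proof (rule pair_measure_eqI[symmetric])
  interpret L: prob_space "gamma_law \<theta>" by (rule prob_space_gamma_law[OF \<theta>_pos])
  have X [measurable]: "X \<in> borel_measurable G"
    unfolding X_def
    by (rule measurable_compose[OF measurable_normalise measurable_integral_finite_measure_algebra[OF g]])
  then interpret X: prob_space "distr G borel X" by (rule G.prob_space_distr)
  show "sigma_finite_measure (gamma_law \<theta>)" ..
  show "sigma_finite_measure (distr G borel X)" ..
  show "sets (gamma_law \<theta> \<Otimes>\<^sub>M distr G borel X) = sets (distr G (borel \<Otimes>\<^sub>M borel) (\<lambda>\<mu>. (measure \<mu> UNIV, X \<mu>)))"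
    by (simp cong: sets_pair_measure_cong)
  fix A B assume "A \<in> sets (gamma_law \<theta>)" "B \<in> sets (distr G borel X)"
  then have A [measurable]: "A \<in> sets borel" and B [measurable]: "B \<in> sets borel" by auto
  let ?B = "X -` B \<inter> space G"
  have B' [measurable]: "?B \<in> sets G" by (rule measurable_sets[OF X B])
  \<comment> \<open>The law restricted to the event that \<open>X\<close> lies in \<open>B\<close>.
    The product formula for all rectangles with this side says that the total mass under
    \<open>?GB\<close> has law \<open>measure G ?B\<close> times Gamma(\<theta>), which is checked
    by Laplace transforms.\<close>
  let ?GB = "density G (\<lambda>\<mu>. ennreal (indicator ?B \<mu>))"
  have GB: "emeasure ?GB C = emeasure G (?B \<inter> C)" if "C \<in> sets G" for C
  proof -
    have "emeasure ?GB C = (\<integral>\<^sup>+\<mu>. ennreal (indicator ?B \<mu>) * indicator C \<mu> \<partial>G)"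
      by (rule emeasure_density) (use that in auto)
    also have "\<dots> = (\<integral>\<^sup>+\<mu>. indicator (?B \<inter> C) \<mu> \<partial>G)"
      by (rule nn_integral_cong) (simp split: split_indicator)
    finally have "emeasure ?GB C = (\<integral>\<^sup>+\<mu>. indicator (?B \<inter> C) \<mu> \<partial>G)" .
    then show ?thesis using that by simp
  qed
  have finGB: "finite_measure ?GB"
    by (rule finite_measureI) (use GB[of "space G"] in simp)
  have "distr ?GB borel (\<lambda>\<mu>. measure \<mu> UNIV) = scale_measure (ennreal (measure G ?B)) (gamma_law \<theta>)"
  proof (rule measure_eqI_laplace)
    show "finite_measure (distr ?GB borel (\<lambda>\<mu>. measure \<mu> UNIV))"
      by (rule finite_measure.finite_measure_distr[OF finGB]) simp
    show "finite_measure (scale_measure (ennreal (measure G ?B)) (gamma_law \<theta>))"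
      by (rule finite_measure_scale_measure) (auto simp: L.finite_measure)
    show "AE x in distr ?GB borel (\<lambda>\<mu>. measure \<mu> UNIV). 0 \<le> x" by (simp add: AE_distr_iff)
    have "AE x in gamma_law \<theta>. 0 \<le> x" using AE_gamma_law[of \<theta>] by eventually_elim simp
    then have "emeasure (gamma_law \<theta>) {..<0} = 0"
      by (subst (asm) AE_iff_measurable[where N="{..<0}"]) auto
    then show "AE x in scale_measure (ennreal (measure G ?B)) (gamma_law \<theta>). 0 \<le> x"
      by (subst AE_iff_measurable[where N="{..<0}"]) (auto simp: space_scale_measure)
    fix s :: real assume s: "0 \<le> s"
    \<comment> \<open>The left side is the tilted probability of \<open>?B\<close>. The tilt is a
      rescaling, and membership in \<open>?B\<close> does not change under rescaling, so this
      probability is \<open>measure G ?B\<close> for every s.\<close>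
    have "(1 + s) powr \<theta> * (\<integral>\<mu>. exp (- (s * measure \<mu> UNIV)) * indicator ?B \<mu> \<partial>G)
        = (\<integral>\<mu>. indicator ?B \<mu> \<partial>density G (\<lambda>\<mu>. ennreal ((1 + s) powr \<theta> * exp (- (s * measure \<mu> UNIV)))))"
      by (subst integral_density) (auto simp: mult.assoc)
    also have "\<dots> = (\<integral>\<mu>. (indicator ?B \<mu> :: real) \<partial>distr G (finite_measure_algebra borel) (scale_measure (ennreal (1 / (1 + s)))))"
      by (simp only: tilt_eq_scale[OF s])
    also have "\<dots> = (\<integral>\<mu>. (indicator ?B (scale_measure (ennreal (1 / (1 + s))) \<mu>) :: real) \<partial>G)"
    proof (rule integral_distr)
      show "scale_measure (ennreal (1 / (1 + s))) \<in> G \<rightarrow>\<^sub>M finite_measure_algebra borel"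
        by (rule measurable_finite_measure_algebra)
           (auto simp: space_G intro!: finite_measure_scale_measure)
      show "(indicator ?B :: _ \<Rightarrow> real) \<in> borel_measurable (finite_measure_algebra borel)"
        using B' sets_G by auto
    qed
    also have "\<dots> = (\<integral>\<mu>. indicator ?B \<mu> \<partial>G)"
    proof (rule Bochner_Integration.integral_cong)
      fix \<mu> assume \<mu>: "\<mu> \<in> space G"
      then have "scale_measure (ennreal (1 / (1 + s))) \<mu> \<in> space G"
        by (auto simp: space_G intro!: finite_measure_scale_measure)
      moreover have "X (scale_measure (ennreal (1 / (1 + s))) \<mu>) = X \<mu>"
        using s by (simp add: X_def normalise_scale[OF \<mu>])
      ultimately show "(indicator ?B (scale_measure (ennreal (1 / (1 + s))) \<mu>) :: real) = indicator ?B \<mu>"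
        using \<mu> by (simp add: indicator_def)
    qed simp
    also have "\<dots> = measure G ?B" by simp
    finally have "(1 + s) powr \<theta> * (\<integral>\<mu>. exp (- (s * measure \<mu> UNIV)) * indicator ?B \<mu> \<partial>G) = measure G ?B"
      by simp
    then have "(\<integral>\<mu>. exp (- (s * measure \<mu> UNIV)) * indicator ?B \<mu> \<partial>G) = (1 + s) powr (- \<theta>) * measure G ?B"
      using s by (simp add: powr_minus field_simps)
    moreover have "(\<integral>x. exp (- (s * x)) \<partial>gamma_law \<theta>) = (1 + s) powr (- \<theta>)"
      using s by (subst integral_eq_nn_integral) (auto simp: nn_integral_exp_gamma_law[OF \<theta>_pos])
    ultimately show "(\<integral>x. exp (- (s * x)) \<partial>distr ?GB borel (\<lambda>\<mu>. measure \<mu> UNIV))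
        = (\<integral>x. exp (- (s * x)) \<partial>scale_measure (ennreal (measure G ?B)) (gamma_law \<theta>))"
      by (simp add: integral_distr integral_density integral_scale_measure mult.commute)
  qed simp_all
  then have "emeasure (distr ?GB borel (\<lambda>\<mu>. measure \<mu> UNIV)) A = ennreal (measure G ?B) * emeasure (gamma_law \<theta>) A"
    by simp
  moreover have "emeasure (distr ?GB borel (\<lambda>\<mu>. measure \<mu> UNIV)) A
      = emeasure (distr G (borel \<Otimes>\<^sub>M borel) (\<lambda>\<mu>. (measure \<mu> UNIV, X \<mu>))) (A \<times> B)"
  proof -
    have "((\<lambda>\<mu>. (measure \<mu> UNIV, X \<mu>)) -` (A \<times> B) \<inter> space G)
        = ?B \<inter> ((\<lambda>\<mu>. measure \<mu> UNIV) -` A \<inter> space G)" by auto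
    then show ?thesis by (simp add: emeasure_distr GB)
  qed
  ultimately show "emeasure (gamma_law \<theta>) A * emeasure (distr G borel X) B
      = emeasure (distr G (borel \<Otimes>\<^sub>M borel) (\<lambda>\<mu>. (measure \<mu> UNIV, X \<mu>))) (A \<times> B)"
    by (simp add: emeasure_distr G.emeasure_eq_measure mult.commute)
qed

text \<open>The density is a function of the total mass alone. By independence it leaves the law of
  \<open>X\<close> untouched and only turns the Gamma(\<theta>) density of the mass into the
  Gamma(a) density. It is applied with a = q for the Beta-Gamma process, a = \<theta> for the Gamma
  process and a = \<theta> + n for the tilt by the n-th power.\<close>

lemma power_tilt_law:
  fixes g :: "'y \<Rightarrow> real"
  assumes a: "0 < a" and g [measurable]: "g \<in> borel_measurable borel"
  defines "X \<equiv> \<lambda>\<mu>. \<integral>y. g y \<partial>normalise \<mu>"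
  shows "distr (density G (\<lambda>\<mu>. ennreal (Gamma \<theta> / Gamma a * measure \<mu> UNIV powr (a - \<theta>)))) borel (\<lambda>\<mu>. \<integral>y. g y \<partial>\<mu>)
    = indep_times (gamma_law a) (distr G borel X)"
    (is "distr (density G ?d) borel ?I = _")
proof (rule measure_eqI)
  fix A assume "A \<in> sets (distr (density G ?d) borel ?I)"
  then have [measurable]: "A \<in> sets borel" by simp
  interpret L: prob_space "gamma_law \<theta>" by (rule prob_space_gamma_law[OF \<theta>_pos])
  interpret La: prob_space "gamma_law a" by (rule prob_space_gamma_law[OF a])
  have X [measurable]: "X \<in> borel_measurable G"
    unfolding X_def
    by (rule measurable_compose[OF measurable_normalise measurable_integral_finite_measure_algebra[OF g]])
  then interpret X: prob_space "distr G borel X" by (rule G.prob_space_distr)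
  let ?c = "\<lambda>t. ennreal (Gamma \<theta> / Gamma a * t powr (a - \<theta>))"
  let ?h = "\<lambda>t x. indicator A (t * x) :: ennreal"
  have pos: "0 < Gamma \<theta>" "0 < Gamma a" using a \<theta>_pos by (auto intro!: Gamma_real_pos)
  have dens: "ennreal (gamma_density \<theta> t) * ?c t = ennreal (gamma_density a t)" for t
  proof (cases "0 < t")
    case True
    then have "t powr (\<theta> - 1) * t powr (a - \<theta>) = t powr (a - 1)"
      by (simp add: powr_add[symmetric])
    then have "gamma_density \<theta> t * (Gamma \<theta> / Gamma a * t powr (a - \<theta>)) = gamma_density a t"
      using True pos by (simp add: gamma_density_def)
    then show ?thesis by (simp add: ennreal_mult'[symmetric] gamma_density_nonneg[OF \<theta>_pos])
  qed (simp add: gamma_density_def)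
  have "emeasure (distr (density G ?d) borel ?I) A = (\<integral>\<^sup>+\<mu>. ?d \<mu> * indicator A (?I \<mu>) \<partial>G)"
    by (simp add: nn_integral_indicator[symmetric] nn_integral_distr nn_integral_density del: nn_integral_indicator)
  also have "\<dots> = (\<integral>\<^sup>+\<mu>. ?c (measure \<mu> UNIV) * ?h (measure \<mu> UNIV) (X \<mu>) \<partial>G)"
    by (rule nn_integral_cong) (simp add: X_def integral_eq_mass_times_normalise[OF _ g])
  also have "\<dots> = (\<integral>\<^sup>+(t, x). ?c t * ?h t x \<partial>distr G (borel \<Otimes>\<^sub>M borel) (\<lambda>\<mu>. (measure \<mu> UNIV, X \<mu>)))"
    by (subst nn_integral_distr) auto
  also have "\<dots> = (\<integral>\<^sup>+(t, x). ?c t * ?h t x \<partial>(gamma_law \<theta> \<Otimes>\<^sub>M distr G borel X))"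
    using mass_normalise_law[OF g] by (simp add: X_def)
  also have "\<dots> = (\<integral>\<^sup>+t. \<integral>\<^sup>+x. ?c t * ?h t x \<partial>distr G borel X \<partial>gamma_law \<theta>)"
    by (subst X.nn_integral_fst[symmetric]) simp_all
  also have "\<dots> = (\<integral>\<^sup>+t. ?c t * (\<integral>\<^sup>+x. ?h t x \<partial>distr G borel X) \<partial>gamma_law \<theta>)"
    by (intro nn_integral_cong nn_integral_cmult) simp
  also have "\<dots> = (\<integral>\<^sup>+t. ennreal (gamma_density a t) * (\<integral>\<^sup>+x. ?h t x \<partial>distr G borel X) \<partial>lborel)"
    by (subst nn_integral_gamma_law) (measurable, simp only: mult.assoc[symmetric] dens)
  also have "\<dots> = (\<integral>\<^sup>+t. \<integral>\<^sup>+x. ?h t x \<partial>distr G borel X \<partial>gamma_law a)"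
    by (rule nn_integral_gamma_law[symmetric]) simp
  also have "\<dots> = emeasure (indep_times (gamma_law a) (distr G borel X)) A"
    by (simp add: nn_integral_indep_times[symmetric] La.finite_measure X.finite_measure)
  finally show "emeasure (distr (density G ?d) borel ?I) A = emeasure (indep_times (gamma_law a) (distr G borel X)) A" .
qed simp

text \<open>Letting \<open>s \<rightarrow> 0\<close> in \<open>E[exp(-s \<mu>(\<bar>g\<bar>))] = exp(-\<integral>ln(1 + s\<bar>g\<bar>) \<theta>dH)\<close>, where \<open>exp(-\<infinity>) = 0\<close>.\<close>

lemma AE_integrable:
  fixes g :: "'y \<Rightarrow> real"
  assumes g [measurable]: "g \<in> borel_measurable borel"
    and log: "integrable H (\<lambda>y. ln (1 + \<bar>g y\<bar>))"
  shows "AE \<mu> in G. integrable \<mu> g"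
proof -
  note [measurable_cong] = sets_H
  define F where "F = {\<mu> \<in> space G. (\<integral>\<^sup>+y. ennreal \<bar>g y\<bar> \<partial>\<mu>) < \<infinity>}"
  have F [measurable]: "F \<in> sets G" unfolding F_def by measurable
  have bound: "exp (- (\<theta> * (\<integral>y. ln (1 + s * \<bar>g y\<bar>) \<partial>H))) \<le> measure G F" if s: "0 < s" "s \<le> 1" for s
  proof -
    \<comment> \<open>Truncation at N, because the Laplace functional is given for bounded
      functions. The restriction s \<le> 1 makes \<open>ln (1 + |g|)\<close> a common dominating
      function.\<close>
    define f where "f N y = s * min \<bar>g y\<bar> (real N)" for N :: nat and y
    have [measurable]: "f N \<in> borel_measurable borel" for N unfolding f_def by measurable
    have f0: "0 \<le> f N y" for N y using s by (simp add: f_def)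
    have fb: "bounded (range (f N))" for N
    proof -
      have "\<bar>f N y\<bar> \<le> s * real N" for y using s by (auto simp: f_def abs_mult)
      then show ?thesis unfolding bounded_iff by auto
    qed
    have f_le: "f N y \<le> s * \<bar>g y\<bar>" for N y using s by (simp add: f_def)
    have f_lim: "(\<lambda>N. f N y) \<longlonglongrightarrow> s * \<bar>g y\<bar>" for y
    proof (rule tendsto_eventually)
      obtain N0 :: nat where "\<bar>g y\<bar> \<le> real N0" using real_arch_simple by blast
      then have "f N y = s * \<bar>g y\<bar>" if "N0 \<le> N" for N
        using that by (simp add: f_def min_def)
      then show "\<forall>\<^sub>F N in sequentially. f N y = s * \<bar>g y\<bar>" by (auto simp: eventually_sequentially)
    qed
    \<comment> \<open>The case distinction encodes exp(-\<infinity>) = 0. Without it the Bochner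
      integral would be 0 off \<open>F\<close>, and the exponential 1.\<close>
    define \<phi> where "\<phi> \<mu> = (if \<mu> \<in> F then exp (- (\<integral>y. s * \<bar>g y\<bar> \<partial>\<mu>)) else 0)" for \<mu>
    have [measurable]: "\<phi> \<in> borel_measurable G" unfolding \<phi>_def by measurable
    have "(\<lambda>N. \<integral>\<mu>. exp (- (\<integral>y. f N y \<partial>\<mu>)) \<partial>G) \<longlonglongrightarrow> (\<integral>\<mu>. \<phi> \<mu> \<partial>G)"
    proof (rule integral_dominated_convergence[where w="\<lambda>_. 1"])
      show "AE \<mu> in G. norm (exp (- (\<integral>y. f N y \<partial>\<mu>))) \<le> 1" for N
        by (rule AE_I2) (auto intro!: integral_nonneg_AE simp: f0)
      show "AE \<mu> in G. (\<lambda>N. exp (- (\<integral>y. f N y \<partial>\<mu>))) \<longlonglongrightarrow> \<phi> \<mu>"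
      proof (rule AE_I2)
        fix \<mu> assume \<mu>: "\<mu> \<in> space G"
        note [measurable] = measurable_point[OF \<mu>]
        show "(\<lambda>N. exp (- (\<integral>y. f N y \<partial>\<mu>))) \<longlonglongrightarrow> \<phi> \<mu>"
        proof (cases "\<mu> \<in> F")
          case True
          then have "integrable \<mu> (\<lambda>y. \<bar>g y\<bar>)"
            by (auto simp: F_def integrable_iff_bounded)
          then have "(\<lambda>N. \<integral>y. f N y \<partial>\<mu>) \<longlonglongrightarrow> (\<integral>y. s * \<bar>g y\<bar> \<partial>\<mu>)"
            by (intro integral_dominated_convergence[where w="\<lambda>y. s * \<bar>g y\<bar>"])
               (use f0 f_le f_lim in auto)
          then show ?thesis using True unfolding \<phi>_def by (auto intro!: tendsto_intros)
        next
          case False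
          have "(\<lambda>N. \<integral>\<^sup>+y. ennreal (f N y) \<partial>\<mu>) \<longlonglongrightarrow> (\<integral>\<^sup>+y. ennreal (s * \<bar>g y\<bar>) \<partial>\<mu>)"
          proof (rule nn_integral_LIMSEQ)
            show "incseq (\<lambda>N y. ennreal (f N y))"
              using s by (auto simp: incseq_def le_fun_def f_def min_def intro!: ennreal_leI mult_left_mono)
            show "(\<lambda>N. ennreal (f N y)) \<longlonglongrightarrow> ennreal (s * \<bar>g y\<bar>)" for y
              by (rule tendsto_ennrealI[OF f_lim])
          qed simp
          also have "(\<integral>\<^sup>+y. ennreal (s * \<bar>g y\<bar>) \<partial>\<mu>) = ennreal s * (\<integral>\<^sup>+y. ennreal \<bar>g y\<bar> \<partial>\<mu>)"
            using s by (subst nn_integral_cmult[symmetric]) (auto simp: ennreal_mult)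
          also have "(\<integral>\<^sup>+y. ennreal \<bar>g y\<bar> \<partial>\<mu>) = top"
            using False \<mu> by (simp add: F_def less_top[symmetric])
          also have "ennreal s * top = top" using s by (simp add: ennreal_mult_top)
          also have "(\<lambda>N. \<integral>\<^sup>+y. ennreal (f N y) \<partial>\<mu>) = (\<lambda>N. ennreal (\<integral>y. f N y \<partial>\<mu>))"
            by (intro ext nn_integral_eq_integral integrable_point[OF \<mu>]) (auto simp: f0 fb)
          finally have "filterlim (\<lambda>N. \<integral>y. f N y \<partial>\<mu>) at_top sequentially"
            by (simp add: ennreal_tendsto_top_eq_at_top)
          then have "(\<lambda>N. exp (- (\<integral>y. f N y \<partial>\<mu>))) \<longlonglongrightarrow> 0"
            by (intro filterlim_compose[OF exp_at_bot] filterlim_compose[OF filterlim_uminus_at_bot_at_top])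
          then show ?thesis using False by (simp add: \<phi>_def)
        qed
      qed
    qed auto
    moreover have "(\<lambda>N. \<integral>\<mu>. exp (- (\<integral>y. f N y \<partial>\<mu>)) \<partial>G) \<longlonglongrightarrow> exp (- (\<theta> * (\<integral>y. ln (1 + s * \<bar>g y\<bar>) \<partial>H)))"
      unfolding laplace[OF \<open>f _ \<in> borel_measurable borel\<close> f0 fb]
    proof (intro tendsto_intros integral_dominated_convergence[where w="\<lambda>y. ln (1 + \<bar>g y\<bar>)"])
      show "AE y in H. norm (ln (1 + f N y)) \<le> ln (1 + \<bar>g y\<bar>)" for N
      proof (rule AE_I2)
        fix y
        have "f N y \<le> \<bar>g y\<bar>" using f_le[of N y] mult_right_mono[OF s(2), of "\<bar>g y\<bar>"] by simp
        then show "norm (ln (1 + f N y)) \<le> ln (1 + \<bar>g y\<bar>)" using f0[of N y] by simp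
      qed
      show "AE y in H. (\<lambda>N. ln (1 + f N y)) \<longlonglongrightarrow> ln (1 + s * \<bar>g y\<bar>)"
      proof (rule AE_I2)
        fix y
        have "0 < 1 + s * \<bar>g y\<bar>" using s by (simp add: add_pos_nonneg)
        then show "(\<lambda>N. ln (1 + f N y)) \<longlonglongrightarrow> ln (1 + s * \<bar>g y\<bar>)"
          by (intro tendsto_intros f_lim) auto
      qed
    qed (use log in auto)
    ultimately have "exp (- (\<theta> * (\<integral>y. ln (1 + s * \<bar>g y\<bar>) \<partial>H))) = (\<integral>\<mu>. \<phi> \<mu> \<partial>G)"
      using LIMSEQ_unique by blast
    also have "\<dots> \<le> (\<integral>\<mu>. indicator F \<mu> \<partial>G)"
    proof (rule integral_mono')
      show "\<phi> \<mu> \<le> indicator F \<mu>" for \<mu>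
        using s by (auto simp: \<phi>_def indicator_def intro!: integral_nonneg_AE)
    qed (auto simp: G.integrable_const_bound[where B=1])
    finally show ?thesis by simp
  qed
  \<comment> \<open>Now s = 1/(k + 1) tends to 0, again dominated by \<open>ln (1 + |g|)\<close>; in
    the limit \<open>bound\<close> says that \<open>F\<close> has probability at least exp(0) =
    1.\<close>
  have "(\<lambda>k. exp (- (\<theta> * (\<integral>y. ln (1 + inverse (real (Suc k)) * \<bar>g y\<bar>) \<partial>H)))) \<longlonglongrightarrow> exp (- (\<theta> * (\<integral>y. 0 \<partial>H)))"
  proof (intro tendsto_intros integral_dominated_convergence[where w="\<lambda>y. ln (1 + \<bar>g y\<bar>)"])
    show "AE y in H. norm (ln (1 + inverse (real (Suc k)) * \<bar>g y\<bar>)) \<le> ln (1 + \<bar>g y\<bar>)" for k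
    proof (rule AE_I2)
      fix y
      define z where "z = inverse (real (Suc k)) * \<bar>g y\<bar>"
      have "z \<le> 1 * \<bar>g y\<bar>"
        unfolding z_def by (rule mult_right_mono) (simp_all add: field_simps)
      moreover have "0 \<le> z" by (simp add: z_def)
      ultimately show "norm (ln (1 + inverse (real (Suc k)) * \<bar>g y\<bar>)) \<le> ln (1 + \<bar>g y\<bar>)"
        unfolding z_def[symmetric] by simp
    qed
    show "AE y in H. (\<lambda>k. ln (1 + inverse (real (Suc k)) * \<bar>g y\<bar>)) \<longlonglongrightarrow> 0"
    proof (rule AE_I2)
      fix y
      have "(\<lambda>k. ln (1 + inverse (real (Suc k)) * \<bar>g y\<bar>)) \<longlonglongrightarrow> ln (1 + 0 * \<bar>g y\<bar>)"
        by (intro tendsto_intros LIMSEQ_inverse_real_of_nat) simp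
      then show "(\<lambda>k. ln (1 + inverse (real (Suc k)) * \<bar>g y\<bar>)) \<longlonglongrightarrow> 0" by simp
    qed
  qed (use log in auto)
  then have "exp (- (\<theta> * (\<integral>y. 0 \<partial>H))) \<le> measure G F"
  proof (rule tendsto_upperbound)
    have "inverse (real (Suc k)) \<le> 1" for k by (simp add: field_simps)
    then show "\<forall>\<^sub>F k in sequentially. exp (- (\<theta> * (\<integral>y. ln (1 + inverse (real (Suc k)) * \<bar>g y\<bar>) \<partial>H))) \<le> measure G F"
      by (intro always_eventually allI bound) auto
  qed simp
  then have "measure G F = 1" using G.prob_le_1[of F] by simp
  then have "AE \<mu> in G. \<mu> \<in> F" by (simp add: G.prob_eq_1)
  then show ?thesis
    by (rule AE_mp) (auto simp: F_def integrable_iff_bounded measurable_point[OF _ g])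
qed

end

lemma gamma_process_law_unique:
  assumes "is_gamma_process_law \<theta> H G1" "is_gamma_process_law \<theta> H G2"
  shows "G1 = G2"
  using assms unfolding is_gamma_process_law_def
  by (intro finite_measure_algebra_laplace_unique[where K=borel]) (auto intro: prob_space.finite_measure)

section \<open>The urn scheme and power tilting\<close>

definition sum_measure :: "'a measure \<Rightarrow> 'i set \<Rightarrow> ('i \<Rightarrow> 'a measure) \<Rightarrow> 'a measure" where
  "sum_measure K J \<mu> = measure_of (space K) (sets K) (\<lambda>A. \<Sum>j\<in>J. emeasure (\<mu> j) A)"

lemma sets_sum_measure [simp, measurable_cong]: "sets (sum_measure K J \<mu>) = sets K"
  by (simp add: sum_measure_def)

lemma space_sum_measure [simp]: "space (sum_measure K J \<mu>) = space K"
  by (simp add: sum_measure_def)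

lemma emeasure_sum_measure:
  assumes "\<And>j. j \<in> J \<Longrightarrow> sets (\<mu> j) = sets K" and A: "A \<in> sets K"
  shows "emeasure (sum_measure K J \<mu>) A = (\<Sum>j\<in>J. emeasure (\<mu> j) A)"
  unfolding sum_measure_def
proof (rule emeasure_measure_of_sigma)
  show "sigma_algebra (space K) (sets K)" ..
  show "positive (sets K) (\<lambda>A. \<Sum>j\<in>J. emeasure (\<mu> j) A)" by (simp add: positive_def)
  show "countably_additive (sets K) (\<lambda>A. \<Sum>j\<in>J. emeasure (\<mu> j) A)"
  proof (rule countably_additiveI)
    fix B :: "nat \<Rightarrow> _" assume B: "range B \<subseteq> sets K" "disjoint_family B"
    have "(\<Sum>i. \<Sum>j\<in>J. emeasure (\<mu> j) (B i)) = (\<Sum>j\<in>J. \<Sum>i. emeasure (\<mu> j) (B i))"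
      by (rule suminf_sum) simp
    also have "\<dots> = (\<Sum>j\<in>J. emeasure (\<mu> j) (\<Union>i. B i))"
      using B assms(1) by (intro sum.cong suminf_emeasure) auto
    finally show "(\<Sum>i. \<Sum>j\<in>J. emeasure (\<mu> j) (B i)) = (\<Sum>j\<in>J. emeasure (\<mu> j) (\<Union>i. B i))" .
  qed
qed fact

lemma nn_integral_sum_measure:
  assumes J: "finite J" and sets: "\<And>j. j \<in> J \<Longrightarrow> sets (\<mu> j) = sets K" and f: "f \<in> borel_measurable K"
  shows "(\<integral>\<^sup>+x. f x \<partial>sum_measure K J \<mu>) = (\<Sum>j\<in>J. \<integral>\<^sup>+x. f x \<partial>\<mu> j)"
  using f
proof induct
  case (cong f g)
  have "(\<integral>\<^sup>+x. f x \<partial>\<mu> j) = (\<integral>\<^sup>+x. g x \<partial>\<mu> j)" if "j \<in> J" for j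
    using cong(3) sets_eq_imp_space_eq[OF sets[OF that]] by (intro nn_integral_cong) simp
  moreover have "(\<integral>\<^sup>+x. f x \<partial>sum_measure K J \<mu>) = (\<integral>\<^sup>+x. g x \<partial>sum_measure K J \<mu>)"
    using cong(3) by (intro nn_integral_cong) simp
  ultimately show ?case using cong(4) by simp
next
  case (set A)
  then show ?case using sets by (simp add: emeasure_sum_measure)
next
  case (mult u c)
  then have "(\<integral>\<^sup>+x. c * u x \<partial>\<mu> j) = c * (\<integral>\<^sup>+x. u x \<partial>\<mu> j)" if "j \<in> J" for j
    using sets[OF that] by (intro nn_integral_cmult) (simp cong: measurable_cong_sets)
  moreover have "(\<integral>\<^sup>+x. c * u x \<partial>sum_measure K J \<mu>) = c * (\<integral>\<^sup>+x. u x \<partial>sum_measure K J \<mu>)"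
    using mult by (intro nn_integral_cmult) simp
  ultimately show ?case using mult by (simp add: sum_distrib_left)
next
  case (add u v)
  then have "(\<integral>\<^sup>+x. v x + u x \<partial>\<mu> j) = (\<integral>\<^sup>+x. v x \<partial>\<mu> j) + (\<integral>\<^sup>+x. u x \<partial>\<mu> j)" if "j \<in> J" for j
    using sets[OF that] by (intro nn_integral_add) (simp_all cong: measurable_cong_sets)
  moreover have "(\<integral>\<^sup>+x. v x + u x \<partial>sum_measure K J \<mu>)
      = (\<integral>\<^sup>+x. v x \<partial>sum_measure K J \<mu>) + (\<integral>\<^sup>+x. u x \<partial>sum_measure K J \<mu>)"
    using add by (intro nn_integral_add) simp_all
  ultimately show ?case using add by (simp add: sum.distrib)
next
  case (seq U)
  have "(\<integral>\<^sup>+x. (SUP i. U i) x \<partial>\<mu> j) = (SUP i. \<integral>\<^sup>+x. U i x \<partial>\<mu> j)" if "j \<in> J" for j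
    unfolding SUP_apply using sets[OF that] seq
    by (intro nn_integral_monotone_convergence_SUP) (simp_all cong: measurable_cong_sets)
  moreover have "(\<integral>\<^sup>+x. (SUP i. U i) x \<partial>sum_measure K J \<mu>) = (SUP i. \<integral>\<^sup>+x. U i x \<partial>sum_measure K J \<mu>)"
    unfolding SUP_apply using seq by (intro nn_integral_monotone_convergence_SUP) simp_all
  moreover have "(SUP i. \<Sum>j\<in>J. \<integral>\<^sup>+x. U i x \<partial>\<mu> j) = (\<Sum>j\<in>J. SUP i. \<integral>\<^sup>+x. U i x \<partial>\<mu> j)"
    using seq by (intro ennreal_SUP_sum) (auto simp: incseq_def le_fun_def intro!: nn_integral_mono)
  ultimately show ?case using seq by simp
qed

section \<open>The Blackwell-MacQueen urn as a measure\<close>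

abbreviation sample_space :: "nat \<Rightarrow> (nat \<Rightarrow> 'y::topological_space) measure" where
  "sample_space n \<equiv> \<Pi>\<^sub>M i\<in>{1..n}. borel"

text \<open>The measure behind \<open>urn_integral\<close>, which makes Bochner integrals and
  dominated convergence available. Index 0 stands for a fresh draw with weight \<theta>, index j for
  a repetition of the j-th value. It is not normalised: for \<theta> > 0 its total mass is
  Gamma(\<theta> + n) / Gamma(\<theta>).\<close>

primrec urn_measure :: "real \<Rightarrow> 'y::topological_space measure \<Rightarrow> nat \<Rightarrow> (nat \<Rightarrow> 'y) measure" where
  "urn_measure \<theta> H 0 = return (sample_space 0) (\<lambda>_. undefined)"
| "urn_measure \<theta> H (Suc n) = sum_measure (sample_space (Suc n)) {0..n} (\<lambda>j. if j = 0
     then scale_measure (ennreal \<theta>)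
       (distr (urn_measure \<theta> H n \<Otimes>\<^sub>M H) (sample_space (Suc n)) (\<lambda>(y, z). y(Suc n := z)))
     else distr (urn_measure \<theta> H n) (sample_space (Suc n)) (\<lambda>y. y(Suc n := y j)))"

lemma sets_urn_measure [simp, measurable_cong]: "sets (urn_measure \<theta> H n) = sets (sample_space n)"
  by (cases n) auto

lemma measurable_sample_add:
  "(\<lambda>(y, z). y(Suc n := z)) \<in> sample_space n \<Otimes>\<^sub>M borel \<rightarrow>\<^sub>M (sample_space (Suc n) :: (nat \<Rightarrow> 'y::topological_space) measure)"
  using measurable_add_dim[of "Suc n" "{1..n}" "\<lambda>_. borel :: 'y measure"]
  by (simp add: atLeastAtMostSuc_conv)

lemma measurable_sample_repeat:
  assumes "j \<in> {1..n}"
  shows "(\<lambda>y. y(Suc n := y j)) \<in> sample_space n \<rightarrow>\<^sub>M (sample_space (Suc n) :: (nat \<Rightarrow> 'y::topological_space) measure)"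
proof -
  have "(\<lambda>y. (y, y j)) \<in> sample_space n \<rightarrow>\<^sub>M sample_space n \<Otimes>\<^sub>M (borel :: 'y measure)"
    using assms by (intro measurable_Pair measurable_component_singleton) auto
  from measurable_compose[OF this measurable_sample_add] show ?thesis by simp
qed

context
  fixes \<theta> :: real and H :: "'y::topological_space measure"
  assumes H: "prob_space H" "sets H = sets borel"
begin

interpretation H: prob_space H by (rule H)

lemma measurable_urn_step:
  assumes F: "F \<in> borel_measurable (sample_space (Suc n))"
  shows "(\<lambda>y. \<integral>\<^sup>+z. F (y(Suc n := z)) \<partial>H) \<in> borel_measurable (sample_space n)"
    and "j \<in> {1..n} \<Longrightarrow> (\<lambda>y. F (y(Suc n := y j))) \<in> borel_measurable (sample_space n)"
proof -
  note [measurable_cong] = H(2)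
  have "(\<lambda>(y, z). F (y(Suc n := z))) \<in> borel_measurable (sample_space n \<Otimes>\<^sub>M borel)"
    using measurable_compose[OF measurable_sample_add F] by (simp add: split_beta)
  then have "(\<lambda>(y, z). F (y(Suc n := z))) \<in> borel_measurable (sample_space n \<Otimes>\<^sub>M H)" by measurable
  from H.borel_measurable_nn_integral[OF this]
  show "(\<lambda>y. \<integral>\<^sup>+z. F (y(Suc n := z)) \<partial>H) \<in> borel_measurable (sample_space n)" .
  show "j \<in> {1..n} \<Longrightarrow> (\<lambda>y. F (y(Suc n := y j))) \<in> borel_measurable (sample_space n)"
    using measurable_compose[OF measurable_sample_repeat F] .
qed

lemma nn_integral_urn_measure_Suc:
  assumes F: "F \<in> borel_measurable (sample_space (Suc n))"
  shows "(\<integral>\<^sup>+y. F y \<partial>urn_measure \<theta> H (Suc n)) = (\<integral>\<^sup>+y. ennreal \<theta> * (\<integral>\<^sup>+z. F (y(Suc n := z)) \<partial>H)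
    + (\<Sum>j\<in>{1..n}. F (y(Suc n := y j))) \<partial>urn_measure \<theta> H n)"
proof -
  note [measurable_cong] = H(2)
  let ?U = "urn_measure \<theta> H n"
  have add: "(\<lambda>(y, z). y(Suc n := z)) \<in> ?U \<Otimes>\<^sub>M H \<rightarrow>\<^sub>M sample_space (Suc n)"
    using measurable_sample_add by measurable
  have rep: "(\<lambda>y. y(Suc n := y j)) \<in> ?U \<rightarrow>\<^sub>M sample_space (Suc n)" if "j \<in> {1..n}" for j
    using measurable_sample_repeat[OF that] by (simp cong: measurable_cong_sets)
  have 0: "(\<integral>\<^sup>+y. F y \<partial>scale_measure (ennreal \<theta>) (distr (?U \<Otimes>\<^sub>M H) (sample_space (Suc n)) (\<lambda>(y, z). y(Suc n := z))))
      = (\<integral>\<^sup>+y. ennreal \<theta> * (\<integral>\<^sup>+z. F (y(Suc n := z)) \<partial>H) \<partial>?U)"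
  proof -
    have "(\<lambda>(y, z). F (y(Suc n := z))) \<in> borel_measurable (?U \<Otimes>\<^sub>M H)"
      using measurable_compose[OF add F] by (simp add: split_beta)
    then have "(\<integral>\<^sup>+p. F ((\<lambda>(y, z). y(Suc n := z)) p) \<partial>(?U \<Otimes>\<^sub>M H)) = (\<integral>\<^sup>+y. \<integral>\<^sup>+z. F (y(Suc n := z)) \<partial>H \<partial>?U)"
      by (subst H.nn_integral_fst[symmetric]) (auto simp: split_beta)
    moreover have "(\<integral>\<^sup>+y. ennreal \<theta> * (\<integral>\<^sup>+z. F (y(Suc n := z)) \<partial>H) \<partial>?U) = ennreal \<theta> * (\<integral>\<^sup>+y. \<integral>\<^sup>+z. F (y(Suc n := z)) \<partial>H \<partial>?U)"
      by (rule nn_integral_cmult) (use measurable_urn_step(1)[OF F] in \<open>simp cong: measurable_cong_sets\<close>)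
    ultimately show ?thesis
      using F by (simp add: nn_integral_scale_measure nn_integral_distr[OF add] del: One_nat_def)
  qed
  have j: "(\<integral>\<^sup>+y. F y \<partial>distr ?U (sample_space (Suc n)) (\<lambda>y. y(Suc n := y j))) = (\<integral>\<^sup>+y. F (y(Suc n := y j)) \<partial>?U)"
    if "j \<in> {1..n}" for j
    using F by (simp add: nn_integral_distr[OF rep[OF that]] del: One_nat_def)
  have split: "{0..n} = insert 0 {1..n}" by auto
  have "(\<integral>\<^sup>+y. F y \<partial>urn_measure \<theta> H (Suc n)) = (\<integral>\<^sup>+y. ennreal \<theta> * (\<integral>\<^sup>+z. F (y(Suc n := z)) \<partial>H) \<partial>?U)
      + (\<Sum>j\<in>{1..n}. \<integral>\<^sup>+y. F (y(Suc n := y j)) \<partial>?U)"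
    unfolding urn_measure.simps
    by (subst nn_integral_sum_measure) (auto simp: F split 0 j intro!: arg_cong2[where f=plus] sum.cong simp del: One_nat_def)
  also have "\<dots> = (\<integral>\<^sup>+y. ennreal \<theta> * (\<integral>\<^sup>+z. F (y(Suc n := z)) \<partial>H) + (\<Sum>j\<in>{1..n}. F (y(Suc n := y j))) \<partial>?U)"
  proof -
    have [measurable]: "(\<lambda>y. \<integral>\<^sup>+z. F (y(Suc n := z)) \<partial>H) \<in> borel_measurable ?U"
      "\<And>j. j \<in> {1..n} \<Longrightarrow> (\<lambda>y. F (y(Suc n := y j))) \<in> borel_measurable ?U"
      using measurable_urn_step[OF F] by (simp_all cong: measurable_cong_sets del: One_nat_def)
    show ?thesis
      by (subst nn_integral_add) (simp_all add: nn_integral_sum del: One_nat_def)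
  qed
  finally show ?thesis .
qed

lemma nn_integral_urn_measure:
  "F \<in> borel_measurable (sample_space n) \<Longrightarrow> (\<integral>\<^sup>+y. F y \<partial>urn_measure \<theta> H n) = urn_integral \<theta> H n F"
proof (induction n arbitrary: F)
  case 0
  then show ?case by (simp add: nn_integral_return space_PiM)
next
  case (Suc n)
  show ?case
    unfolding nn_integral_urn_measure_Suc[OF Suc.prems] urn_integral.simps
  proof (rule Suc.IH)
    have "(\<lambda>y. ennreal \<theta> * A y + (\<Sum>j\<in>{1..n}. B j y)) \<in> borel_measurable (sample_space n)"
      if [measurable]: "A \<in> borel_measurable (sample_space n)"
        "\<And>j. j \<in> {1..n} \<Longrightarrow> B j \<in> borel_measurable (sample_space n)"
      for A :: "(nat \<Rightarrow> 'y) \<Rightarrow> ennreal" and B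
      by measurable
    from this[OF measurable_urn_step[OF Suc.prems]]
    show "(\<lambda>y. ennreal \<theta> * (\<integral>\<^sup>+z. F (y(Suc n := z)) \<partial>H) + (\<Sum>j\<in>{1..n}. F (y(Suc n := y j))))
        \<in> borel_measurable (sample_space n)" .
  qed
qed

lemma finite_urn_measure: "finite_measure (urn_measure \<theta> H n)"
proof (induction n)
  case 0
  show ?case by (auto intro!: prob_space.finite_measure prob_space_return simp: space_PiM)
next
  case (Suc n)
  then interpret finite_measure "urn_measure \<theta> H n" .
  have "emeasure (urn_measure \<theta> H (Suc n)) (space (urn_measure \<theta> H (Suc n))) = (\<integral>\<^sup>+y. 1 \<partial>urn_measure \<theta> H (Suc n))"
    by (simp del: urn_measure.simps)
  also have "\<dots> = (\<integral>\<^sup>+y. ennreal \<theta> + of_nat n \<partial>urn_measure \<theta> H n)"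
    by (subst nn_integral_urn_measure_Suc) (simp_all add: H.emeasure_space_1)
  also have "\<dots> \<noteq> \<infinity>" by (simp add: ennreal_mult_eq_top_iff)
  finally show ?case by (rule finite_measureI)
qed

end

section \<open>Differentiating the Laplace functional\<close>

text \<open>Dominated convergence for difference quotients along sequences, with \<open>B\<close> as
  dominating function. The derivative is one-sided because the Laplace formula is applied to f + s
  with s \<ge> 0.\<close>

lemma has_right_derivative_integral:
  fixes k :: "real \<Rightarrow> 'a \<Rightarrow> real"
  assumes int: "\<And>s. 0 \<le> s \<Longrightarrow> integrable M (k s)"
    and deriv: "\<And>x. x \<in> space M \<Longrightarrow> ((\<lambda>s. k s x) has_real_derivative k' x) (at 0 within {0..})"
    and bound: "\<And>s x. x \<in> space M \<Longrightarrow> 0 \<le> s \<Longrightarrow> \<bar>k s x - k 0 x\<bar> \<le> s * B x"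
    and B: "integrable M B" and k': "k' \<in> borel_measurable M"
  shows "((\<lambda>s. \<integral>x. k s x \<partial>M) has_real_derivative (\<integral>x. k' x \<partial>M)) (at 0 within {0..})"
  unfolding has_field_derivative_iff tendsto_at_iff_sequentially
proof safe
  fix X :: "nat \<Rightarrow> real" assume X: "\<forall>i. X i \<in> {0..} - {0}" "X \<longlonglongrightarrow> 0"
  have Xpos: "0 < X i" for i using X(1)[rule_format, of i] by auto
  have eq: "((\<lambda>y. ((\<integral>x. k y x \<partial>M) - (\<integral>x. k 0 x \<partial>M)) / (y - 0)) \<circ> X) = (\<lambda>i. \<integral>x. (k (X i) x - k 0 x) / X i \<partial>M)"
    using int Xpos by (auto simp: fun_eq_iff less_imp_le)
  show "((\<lambda>y. ((\<integral>x. k y x \<partial>M) - (\<integral>x. k 0 x \<partial>M)) / (y - 0)) \<circ> X) \<longlonglongrightarrow> (\<integral>x. k' x \<partial>M)"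
    unfolding eq
  proof (rule integral_dominated_convergence[OF k' _ B])
    show "(\<lambda>x. (k (X i) x - k 0 x) / X i) \<in> borel_measurable M" for i
      using int[of "X i"] int[of 0] Xpos[of i] by (intro borel_measurable_divide borel_measurable_diff) auto
    show "AE x in M. (\<lambda>i. (k (X i) x - k 0 x) / X i) \<longlonglongrightarrow> k' x"
    proof (rule AE_I2)
      fix x assume "x \<in> space M"
      from deriv[OF this] X show "(\<lambda>i. (k (X i) x - k 0 x) / X i) \<longlonglongrightarrow> k' x"
        unfolding has_field_derivative_iff tendsto_at_iff_sequentially by (auto simp: comp_def)
    qed
    show "AE x in M. norm ((k (X i) x - k 0 x) / X i) \<le> B x" for i
      using bound[of _ "X i"] Xpos[of i] by (intro AE_I2) (simp add: abs_divide field_simps less_imp_le)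
  qed
qed

lemma right_derivative_unique:
  fixes f :: "real \<Rightarrow> real"
  assumes "(f has_real_derivative a) (at 0 within {0..})" "(f has_real_derivative b) (at 0 within {0..})"
  shows "a = b"
  using assms unfolding has_field_derivative_iff at_within_Ici_at_right
  by (rule tendsto_unique[OF trivial_limit_at_right_real])

context gamma_process_law
begin

lemma integrable_mass_power: "integrable G (\<lambda>\<mu>. measure \<mu> UNIV ^ n)"
proof (rule integrableI_nonneg)
  have "(\<integral>\<^sup>+\<mu>. ennreal (measure \<mu> UNIV ^ n) \<partial>G) = (\<integral>\<^sup>+t. ennreal (t ^ n) \<partial>gamma_law \<theta>)"
    unfolding total_mass_law[symmetric] by (subst nn_integral_distr) auto
  then show "(\<integral>\<^sup>+\<mu>. ennreal (measure \<mu> UNIV ^ n) \<partial>G) < \<infinity>"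
    by (simp add: nn_integral_power_gamma_law[OF \<theta>_pos])
qed auto

text \<open>Induction on \<open>n\<close>: both sides for \<open>n + 1\<close> are minus the right derivative at \<open>s = 0\<close> of the
  sides for \<open>n\<close> and \<open>f + s\<close>. On the right the product rule reproduces the urn recursion.\<close>

lemma laplace_mass_power:
  fixes f :: "'y \<Rightarrow> real"
  assumes "f \<in> borel_measurable borel" "\<And>y. 0 \<le> f y" "bounded (range f)"
  shows "(\<integral>\<mu>. measure \<mu> UNIV ^ n * exp (- (\<integral>y. f y \<partial>\<mu>)) \<partial>G)
    = exp (- (\<theta> * (\<integral>y. ln (1 + f y) \<partial>H))) * (\<integral>y. (\<Prod>i\<in>{1..n}. 1 / (1 + f (y i))) \<partial>urn_measure \<theta> H n)"
  using assms
proof (induction n arbitrary: f)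
  case 0
  have "prob_space (urn_measure \<theta> H 0)" by (auto intro!: prob_space_return simp: space_PiM)
  then have "(\<integral>y. (\<Prod>i\<in>{1..0}. 1 / (1 + f (y i))) \<partial>urn_measure \<theta> H 0) = 1"
    by (simp add: prob_space.prob_space del: urn_measure.simps)
  then show ?case using laplace[OF 0] by simp
next
  case (Suc n)
  note f [measurable] = Suc.prems(1) and f0 = Suc.prems(2) and fb = Suc.prems(3)
  note [measurable_cong] = sets_H
  define U where "U = urn_measure \<theta> H n"
  have sets_U [measurable_cong]: "sets U = sets (sample_space n)" by (simp add: U_def)
  interpret U: finite_measure U unfolding U_def by (rule finite_urn_measure[OF prob_H sets_H])
  define T where "T \<mu> = measure \<mu> UNIV" for \<mu> :: "'y measure"
  have T0: "0 \<le> T \<mu>" for \<mu> by (simp add: T_def)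
  have [measurable]: "T \<in> borel_measurable G" unfolding T_def by measurable
  define k where "k s y = 1 / (1 + (f y + s))" for s y
  have [measurable]: "k s \<in> borel_measurable borel" for s unfolding k_def by measurable
  have k01: "0 \<le> k s y" "k s y \<le> 1" if "0 \<le> s" for s y using f0[of y] that by (auto simp: k_def)
  have k_deriv: "((\<lambda>s. k s y) has_real_derivative - (k 0 y * k 0 y)) (at 0)" for y
    unfolding k_def using f0[of y]
    by (auto intro!: derivative_eq_intros simp: field_simps)
  have k_lip: "\<bar>k s y - k 0 y\<bar> \<le> s" if "0 \<le> s" for s y
  proof -
    have "k 0 y - k s y = s * (k 0 y * k s y)" using f0[of y] that by (simp add: k_def field_simps)
    moreover have "k 0 y * k s y \<le> 1" "0 \<le> k 0 y * k s y" using k01[of 0 y] k01[of s y] that by (auto intro: mult_le_one)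
    ultimately show ?thesis using that mult_left_mono[of "k 0 y * k s y" 1 s] by (simp add: abs_minus_commute)
  qed
  \<comment> \<open>\<open>W n s\<close> is the left side of the induction hypothesis for f + s;
    \<open>u s\<close> and \<open>exp (- (\<theta> * L s))\<close> are the two factors of its right
    side.\<close>
  define W where "W m s = (\<integral>\<mu>. T \<mu> ^ m * exp (- (\<integral>y. f y + s \<partial>\<mu>)) \<partial>G)" for m s
  define u where "u s = (\<integral>y. (\<Prod>i\<in>{1..n}. k s (y i)) \<partial>U)" for s
  define L where "L s = (\<integral>y. ln (1 + (f y + s)) \<partial>H)" for s
  have bs: "bounded (range (\<lambda>y. f y + s))" for s using bounded_plus_comp[OF fb, of "\<lambda>_. s"] by simp
  have IH: "W n s = exp (- (\<theta> * L s)) * u s" if "0 \<le> s" for s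
    unfolding W_def L_def u_def U_def k_def T_def
    by (rule Suc.IH) (use f0 that bs in \<open>auto intro: add_nonneg_nonneg\<close>)
  have exp_split: "exp (- (\<integral>y. f y + s \<partial>\<mu>)) = exp (- (s * T \<mu>)) * exp (- (\<integral>y. f y \<partial>\<mu>))"
    if "\<mu> \<in> space G" for \<mu> s
  proof -
    interpret \<mu>: finite_measure \<mu> using that by (simp add: space_G)
    show ?thesis
      using integrable_point[OF that f fb]
      by (simp add: T_def space_point[OF that] exp_add[symmetric] mult.commute)
  qed
  have exp_le: "exp (- (\<integral>y. f y \<partial>\<mu>)) \<le> 1" for \<mu>
    by (auto intro!: integral_nonneg_AE simp: f0)
  have W_int: "integrable G (\<lambda>\<mu>. T \<mu> ^ m * exp (- (\<integral>y. f y + s \<partial>\<mu>)))" if "0 \<le> s" for m s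
  proof (rule Bochner_Integration.integrable_bound)
    show "integrable G (\<lambda>\<mu>. T \<mu> ^ m)" unfolding T_def by (rule integrable_mass_power)
    have "exp (- (\<integral>y. f y + s \<partial>\<mu>)) \<le> 1" for \<mu>
      using that by (auto intro!: integral_nonneg_AE add_nonneg_nonneg simp: f0)
    then show "AE \<mu> in G. norm (T \<mu> ^ m * exp (- (\<integral>y. f y + s \<partial>\<mu>))) \<le> norm (T \<mu> ^ m)"
      by (auto simp: abs_mult T0 intro!: mult_left_le)
  qed measurable
  \<comment> \<open>Each derivative in s brings down a factor -T. The quotients are dominated by
    \<open>T \<mu> ^ Suc n\<close>, as |exp(-s T) - 1| \<le> s T, and all moments of the Gamma
    distributed mass are finite.\<close>
  have "((\<lambda>s. W n s) has_real_derivative (\<integral>\<mu>. - (T \<mu> ^ Suc n * exp (- (\<integral>y. f y \<partial>\<mu>))) \<partial>G)) (at 0 within {0..})"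
    unfolding W_def
  proof (rule has_right_derivative_integral[where B="\<lambda>\<mu>. T \<mu> ^ Suc n"])
    show "integrable G (\<lambda>\<mu>. T \<mu> ^ Suc n)" unfolding T_def by (rule integrable_mass_power)
    fix \<mu> assume \<mu>: "\<mu> \<in> space G"
    show "((\<lambda>s. T \<mu> ^ n * exp (- (\<integral>y. f y + s \<partial>\<mu>))) has_real_derivative - (T \<mu> ^ Suc n * exp (- (\<integral>y. f y \<partial>\<mu>)))) (at 0 within {0..})"
      unfolding exp_split[OF \<mu>] by (auto intro!: derivative_eq_intros)
    fix s :: real assume s: "0 \<le> s"
    have "\<bar>exp (- (s * T \<mu>)) - 1\<bar> \<le> s * T \<mu>"
      using exp_ge_add_one_self[of "- (s * T \<mu>)"] s T0[of \<mu>] by auto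
    then have "\<bar>exp (- (s * T \<mu>)) - 1\<bar> * exp (- (\<integral>y. f y \<partial>\<mu>)) \<le> (s * T \<mu>) * 1"
      using s T0 by (intro mult_mono exp_le) auto
    then have "T \<mu> ^ n * (\<bar>exp (- (s * T \<mu>)) - 1\<bar> * exp (- (\<integral>y. f y \<partial>\<mu>))) \<le> T \<mu> ^ n * (s * T \<mu>)"
      using T0 by (intro mult_left_mono) auto
    moreover have "T \<mu> ^ n * exp (- (\<integral>y. f y + s \<partial>\<mu>)) - T \<mu> ^ n * exp (- (\<integral>y. f y + 0 \<partial>\<mu>))
        = T \<mu> ^ n * ((exp (- (s * T \<mu>)) - 1) * exp (- (\<integral>y. f y \<partial>\<mu>)))"
      unfolding exp_split[OF \<mu>] by (simp add: algebra_simps)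
    ultimately show "\<bar>T \<mu> ^ n * exp (- (\<integral>y. f y + s \<partial>\<mu>)) - T \<mu> ^ n * exp (- (\<integral>y. f y + 0 \<partial>\<mu>))\<bar> \<le> s * T \<mu> ^ Suc n"
      using T0 by (simp add: abs_mult mult_ac)
  qed (use W_int in auto)
  then have dW: "(W n has_real_derivative - (\<integral>\<mu>. T \<mu> ^ Suc n * exp (- (\<integral>y. f y \<partial>\<mu>)) \<partial>G)) (at 0 within {0..})"
    by simp
  have dL: "(L has_real_derivative (\<integral>y. k 0 y \<partial>H)) (at 0 within {0..})"
    unfolding L_def
  proof (rule has_right_derivative_integral[where B="\<lambda>_. 1"])
    show "integrable H (\<lambda>y. ln (1 + (f y + s)))" if "0 \<le> s" for s
      by (rule integrable_ln_bounded) (use f0 that bs in auto)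
    fix y assume "y \<in> space H"
    show "((\<lambda>s. ln (1 + (f y + s))) has_real_derivative k 0 y) (at 0 within {0..})"
      using f0[of y] by (auto intro!: derivative_eq_intros simp: k_def)
    fix s :: real assume s: "0 \<le> s"
    have "ln (1 + (f y + s)) - ln (1 + f y) = ln ((1 + (f y + s)) / (1 + f y))"
      using f0[of y] s by (simp add: ln_div)
    also have "\<dots> \<le> (1 + (f y + s)) / (1 + f y) - 1"
      using f0[of y] s by (intro ln_le_minus_one) (auto simp: zero_less_divide_iff)
    also have "\<dots> \<le> s" using f0[of y] s by (simp add: field_simps)
    finally have "ln (1 + (f y + s)) - ln (1 + f y) \<le> s" .
    moreover have "ln (1 + f y) \<le> ln (1 + (f y + s))" using f0[of y] s by simp
    ultimately show "\<bar>ln (1 + (f y + s)) - ln (1 + (f y + 0))\<bar> \<le> s * 1" by simp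
  qed auto
  have prod_le: "\<bar>\<Prod>i\<in>{1..n}. k s (y i)\<bar> \<le> 1" if "0 \<le> s" for s y
    using k01[OF that] by (auto simp: abs_prod intro!: prod_le_1)
  have u_int: "integrable U (\<lambda>y. \<Prod>i\<in>{1..n}. k s (y i))" if "0 \<le> s" for s
    by (rule U.integrable_const_bound[where B=1]) (use prod_le[OF that] in auto)
  \<comment> \<open>Each factor satisfies k' = -k^2 at s = 0, so differentiating the j-th one
    amounts to multiplying the whole product by -k(y_j). Up to sign this is the contribution of a
    sample in which y_j is drawn once more.\<close>
  let ?u' = "\<lambda>y. - ((\<Sum>j\<in>{1..n}. k 0 (y j)) * (\<Prod>i\<in>{1..n}. k 0 (y i)))"
  have "(u has_real_derivative (\<integral>y. ?u' y \<partial>U)) (at 0 within {0..})"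
    unfolding u_def
  proof (rule has_right_derivative_integral[where B="\<lambda>_. real n"])
    fix y
    have "((\<lambda>s. \<Prod>i\<in>{1..n}. k s (y i)) has_real_derivative
        (\<Sum>j\<in>{1..n}. - (k 0 (y j) * k 0 (y j)) * (\<Prod>i\<in>{1..n} - {j}. k 0 (y i)))) (at 0 within {0..})"
      by (rule has_field_derivative_at_within, rule has_field_derivative_prod, rule k_deriv)
    also have "(\<Sum>j\<in>{1..n}. - (k 0 (y j) * k 0 (y j)) * (\<Prod>i\<in>{1..n} - {j}. k 0 (y i))) = ?u' y"
    proof -
      have "- (k 0 (y j) * k 0 (y j)) * (\<Prod>i\<in>{1..n} - {j}. k 0 (y i)) = - (k 0 (y j) * (\<Prod>i\<in>{1..n}. k 0 (y i)))"
        if "j \<in> {1..n}" for j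
        using prod.remove[OF _ that, of "\<lambda>i. k 0 (y i)"] by simp
      then have "(\<Sum>j\<in>{1..n}. - (k 0 (y j) * k 0 (y j)) * (\<Prod>i\<in>{1..n} - {j}. k 0 (y i)))
          = (\<Sum>j\<in>{1..n}. - (k 0 (y j) * (\<Prod>i\<in>{1..n}. k 0 (y i))))"
        by (rule sum.cong[OF refl])
      then show ?thesis by (simp only: sum_negf sum_distrib_right)
    qed
    finally show "((\<lambda>s. \<Prod>i\<in>{1..n}. k s (y i)) has_real_derivative ?u' y) (at 0 within {0..})" .
    fix s :: real assume s: "0 \<le> s"
    have "\<bar>(\<Prod>i\<in>{1..n}. k s (y i)) - (\<Prod>i\<in>{1..n}. k 0 (y i))\<bar> \<le> (\<Sum>i\<in>{1..n}. \<bar>k s (y i) - k 0 (y i)\<bar>)"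
      using norm_prod_diff[of "{1..n}" "\<lambda>i. k s (y i)" "\<lambda>i. k 0 (y i)"] k01 s by simp
    also have "\<dots> \<le> (\<Sum>i\<in>{1..n}. s)" by (intro sum_mono k_lip s)
    finally show "\<bar>(\<Prod>i\<in>{1..n}. k s (y i)) - (\<Prod>i\<in>{1..n}. k 0 (y i))\<bar> \<le> s * real n"
      by (simp add: mult.commute)
  qed (use u_int in auto)
  then have du: "(u has_real_derivative (\<integral>y. ?u' y \<partial>U)) (at 0 within {0..})" .
  \<comment> \<open>The exponential contributes -\<theta> times the H-integral of k, which up to
    sign is the contribution of a fresh draw.\<close>
  have prod_deriv: "((\<lambda>s. exp (- (\<theta> * L s)) * u s) has_real_derivative
      exp (- (\<theta> * L 0)) * (\<integral>y. ?u' y \<partial>U) + (exp (- (\<theta> * L 0)) * - (\<theta> * (\<integral>y. k 0 y \<partial>H))) * u 0) (at 0 within {0..})"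
    by (rule derivative_eq_intros dL du refl | simp)+
  have "(W n has_real_derivative
      exp (- (\<theta> * L 0)) * (\<integral>y. ?u' y \<partial>U) + (exp (- (\<theta> * L 0)) * - (\<theta> * (\<integral>y. k 0 y \<partial>H))) * u 0) (at 0 within {0..})"
    using has_field_derivative_transform_within[OF prod_deriv, of 1 "W n"] IH by auto
  from right_derivative_unique[OF dW this]
  have main: "(\<integral>\<mu>. T \<mu> ^ Suc n * exp (- (\<integral>y. f y \<partial>\<mu>)) \<partial>G)
      = exp (- (\<theta> * L 0)) * (\<theta> * (\<integral>y. k 0 y \<partial>H) * u 0 - (\<integral>y. ?u' y \<partial>U))"
    by (simp add: algebra_simps)
  \<comment> \<open>The same expression read off from the urn recursion: the last coordinate is
    integrated against \<theta>H plus the point masses at the earlier values.\<close>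
  have "(\<integral>y. (\<Prod>i\<in>{1..Suc n}. k 0 (y i)) \<partial>urn_measure \<theta> H (Suc n))
      = \<theta> * (\<integral>y. k 0 y \<partial>H) * u 0 - (\<integral>y. ?u' y \<partial>U)"
  proof -
    let ?a = "\<integral>y. k 0 y \<partial>H"
    let ?P = "\<lambda>y. \<Prod>i\<in>{1..n}. k 0 (y i)"
    have P0: "0 \<le> ?P y" for y using k01 by (intro prod_nonneg) auto
    have a0: "0 \<le> ?a" by (intro integral_nonneg_AE) (auto simp: k01)
    have k_int: "integrable H (k 0)"
      by (rule H.integrable_const_bound[where B=1]) (use k01 in auto)
    have upd: "(\<Prod>i\<in>{1..Suc n}. k 0 ((y(Suc n := z)) i)) = k 0 z * ?P y" for y z
    proof -
      have "(\<Prod>i\<in>{1..n}. k 0 ((y(Suc n := z)) i)) = ?P y" by (rule prod.cong) auto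
      then show ?thesis by (simp add: mult.commute)
    qed
    have "(\<integral>\<^sup>+y. ennreal (\<Prod>i\<in>{1..Suc n}. k 0 (y i)) \<partial>urn_measure \<theta> H (Suc n))
        = (\<integral>\<^sup>+y. ennreal ((\<theta> * ?a + (\<Sum>j\<in>{1..n}. k 0 (y j))) * ?P y) \<partial>U)"
    proof (subst nn_integral_urn_measure_Suc[OF prob_H sets_H], measurable, unfold U_def[symmetric], rule nn_integral_cong)
      fix y
      have "(\<integral>\<^sup>+z. ennreal (k 0 z * ?P y) \<partial>H) = ennreal (?a * ?P y)"
        using k_int k01 P0 by (subst nn_integral_eq_integral) auto
      moreover have "(\<Sum>j\<in>{1..n}. ennreal (k 0 (y j) * ?P y)) = ennreal ((\<Sum>j\<in>{1..n}. k 0 (y j)) * ?P y)"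
        using k01 P0 by (subst sum_ennreal) (auto simp: sum_distrib_right)
      ultimately show "ennreal \<theta> * (\<integral>\<^sup>+z. ennreal (\<Prod>i\<in>{1..Suc n}. k 0 ((y(Suc n := z)) i)) \<partial>H)
          + (\<Sum>j\<in>{1..n}. ennreal (\<Prod>i\<in>{1..Suc n}. k 0 ((y(Suc n := y j)) i)))
          = ennreal ((\<theta> * ?a + (\<Sum>j\<in>{1..n}. k 0 (y j))) * ?P y)"
        unfolding upd using \<theta>_pos a0 P0[of y] k01
        by (simp add: ennreal_mult'[symmetric] ennreal_plus[symmetric] sum_nonneg distrib_right mult.assoc del: ennreal_plus)
    qed
    then have "(\<integral>y. (\<Prod>i\<in>{1..Suc n}. k 0 (y i)) \<partial>urn_measure \<theta> H (Suc n))
        = (\<integral>y. (\<theta> * ?a + (\<Sum>j\<in>{1..n}. k 0 (y j))) * ?P y \<partial>U)"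
      using \<theta>_pos a0 P0 k01
      by (subst (1 2) integral_eq_nn_integral)
         (auto intro!: prod_nonneg AE_I2 mult_nonneg_nonneg add_nonneg_nonneg sum_nonneg
           simp del: urn_measure.simps prod.atLeast_Suc_atMost prod.cl_ivl_Suc)
    also have "\<dots> = (\<integral>y. (\<theta> * ?a) * ?P y - ?u' y \<partial>U)" by (simp add: algebra_simps)
    also have "\<dots> = \<theta> * ?a * u 0 - (\<integral>y. ?u' y \<partial>U)"
    proof -
      have "integrable U ?u'"
      proof (rule U.integrable_const_bound[where B="real n"])
        have "(\<Sum>j\<in>{1..n}. k 0 (y j)) * ?P y \<le> real n * 1" for y
          using k01 P0[of y] prod_le[of 0 y] sum_mono[of "{1..n}" "\<lambda>j. k 0 (y j)" "\<lambda>_. 1"]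
          by (intro mult_mono) auto
        moreover have "0 \<le> (\<Sum>j\<in>{1..n}. k 0 (y j)) * ?P y" for y
          using k01 P0[of y] by (intro mult_nonneg_nonneg sum_nonneg) auto
        ultimately show "AE y in U. norm (?u' y) \<le> real n" by auto
      qed measurable
      then show ?thesis using u_int[of 0] unfolding u_def by (subst Bochner_Integration.integral_diff) auto
    qed
    finally show ?thesis .
  qed
  with main show ?case unfolding T_def L_def k_def by simp
qed

end

lemma integral_sum_measure:
  fixes f :: "'a \<Rightarrow> real"
  assumes J: "finite J" and sets: "\<And>j. j \<in> J \<Longrightarrow> sets (\<mu> j) = sets K"
    and f: "f \<in> borel_measurable K" and int: "\<And>j. j \<in> J \<Longrightarrow> integrable (\<mu> j) f"
  shows "(\<integral>x. f x \<partial>sum_measure K J \<mu>) = (\<Sum>j\<in>J. \<integral>x. f x \<partial>\<mu> j)"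
proof -
  note [measurable] = f
  have nn: "(\<integral>\<^sup>+x. h x \<partial>sum_measure K J \<mu>) = (\<Sum>j\<in>J. \<integral>\<^sup>+x. h x \<partial>\<mu> j)"
    if "h \<in> borel_measurable K" for h
    by (rule nn_integral_sum_measure[OF J sets that])
  have "(\<integral>\<^sup>+x. ennreal (norm (f x)) \<partial>\<mu> j) < \<infinity>" if "j \<in> J" for j
    using int[OF that] by (simp add: integrable_iff_bounded)
  then have I: "integrable (sum_measure K J \<mu>) f"
    by (auto simp: integrable_iff_bounded nn J cong: measurable_cong_sets)
  have fin: "(\<integral>\<^sup>+x. ennreal (f x) \<partial>\<mu> j) < top" "(\<integral>\<^sup>+x. ennreal (- f x) \<partial>\<mu> j) < top" if "j \<in> J" for j
    using int[OF that] by (auto simp: real_integrable_def less_top)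
  have "(\<integral>x. f x \<partial>sum_measure K J \<mu>)
      = enn2real (\<Sum>j\<in>J. \<integral>\<^sup>+x. ennreal (f x) \<partial>\<mu> j) - enn2real (\<Sum>j\<in>J. \<integral>\<^sup>+x. ennreal (- f x) \<partial>\<mu> j)"
    by (simp add: real_lebesgue_integral_def[OF I] nn)
  also have "\<dots> = (\<Sum>j\<in>J. enn2real (\<integral>\<^sup>+x. ennreal (f x) \<partial>\<mu> j) - enn2real (\<integral>\<^sup>+x. ennreal (- f x) \<partial>\<mu> j))"
    using fin by (simp add: enn2real_sum sum_subtractf)
  also have "\<dots> = (\<Sum>j\<in>J. \<integral>x. f x \<partial>\<mu> j)"
    using int by (auto intro!: sum.cong simp: real_lebesgue_integral_def)
  finally show ?thesis .
qed

section \<open>The partition by ties\<close>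

lemma tie_partition_blocks:
  assumes "C \<in> tie_partition n Y w"
  shows "C \<subseteq> {1..n}" "C \<noteq> {}" "i \<in> C \<Longrightarrow> Y i w = block_value Y C w"
proof -
  obtain k where k: "k \<in> {1..n}" "C = {i\<in>{1..n}. Y i w = Y k w}"
    using assms by (auto simp: tie_partition_def)
  then show "C \<subseteq> {1..n}" "C \<noteq> {}" by auto
  have "finite C" using k by simp
  then have "Min C \<in> C" using \<open>C \<noteq> {}\<close> by (rule Min_in)
  then show "i \<in> C \<Longrightarrow> Y i w = block_value Y C w" using k by (simp add: block_value_def)
qed

text \<open>Blocks are the level sets of the sample, so a block C collects \<open>card C\<close>
  equal factors. Through this identity the partition disappears: the Laplace transforms of weights
  with shape \<open>card C\<close> recombine to a product over the sample indices.\<close>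

lemma prod_tie_partition:
  fixes h :: "'y \<Rightarrow> 'b::comm_monoid_mult"
  shows "(\<Prod>C\<in>tie_partition n Y w. h (block_value Y C w) ^ card C) = (\<Prod>i\<in>{1..n}. h (Y i w))"
proof -
  have "\<Union> (tie_partition n Y w) = {1..n}" by (auto simp: tie_partition_def)
  then have "(\<Prod>i\<in>{1..n}. h (Y i w)) = (\<Prod>i\<in>\<Union> (tie_partition n Y w). h (Y i w))" by simp
  also have "\<dots> = (\<Prod>C\<in>tie_partition n Y w. \<Prod>i\<in>C. h (Y i w))"
    by (subst prod.Union_disjoint)
       (auto simp: tie_partition_def intro: finite_subset[of _ "{1..n}"])
  also have "\<dots> = (\<Prod>C\<in>tie_partition n Y w. h (block_value Y C w) ^ card C)"
    using tie_partition_blocks(3)[of _ n Y w] by (auto intro!: prod.cong)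
  finally show ?thesis by simp
qed

lemma measurable_tie_partition:
  fixes Y :: "nat \<Rightarrow> 'w \<Rightarrow> 'y::{second_countable_topology, t2_space}"
  assumes Y: "\<And>i. i \<in> {1..n} \<Longrightarrow> Y i \<in> borel_measurable N"
  shows "tie_partition n Y \<in> N \<rightarrow>\<^sub>M count_space UNIV"
proof -
  let ?I = "{1..n} \<times> {1..n}"
  \<comment> \<open>The partition is a function of the relation of ties, which takes finitely many
    values, and each of these is described by finitely many equality events.\<close>
  define R where "R w = {p \<in> ?I. Y (fst p) w = Y (snd p) w}" for w
  have R: "R \<in> N \<rightarrow>\<^sub>M count_space (Pow ?I)"
  proof (subst measurable_count_space_eq2)
    have "R -` {\<rho>} \<inter> space N \<in> sets N" if "\<rho> \<in> Pow ?I" for \<rho>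
    proof -
      have "R -` {\<rho>} \<inter> space N = {w \<in> space N. \<forall>p\<in>?I. (Y (fst p) w = Y (snd p) w) = (p \<in> \<rho>)}"
        using that unfolding R_def by blast
      moreover have "{w \<in> space N. (Y (fst p) w = Y (snd p) w) = (p \<in> \<rho>)} \<in> sets N" if "p \<in> ?I" for p
      proof -
        have *: "{w \<in> space N. Y (fst p) w = Y (snd p) w} \<in> sets N"
          using that by (intro measurable_equality_set Y) auto
        show ?thesis
          using * sets.sets_Collect_neg[OF *] by (cases "p \<in> \<rho>") simp_all
      qed
      then have "{w \<in> space N. \<forall>p\<in>?I. (Y (fst p) w = Y (snd p) w) = (p \<in> \<rho>)} \<in> sets N"
        by (rule sets.sets_Collect_finite_All) auto
      ultimately show ?thesis by simp
    qed
    then show "R \<in> space N \<rightarrow> Pow ?I \<and> (\<forall>\<rho>\<in>Pow ?I. R -` {\<rho>} \<inter> space N \<in> sets N)"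
      by (auto simp: R_def)
  qed simp
  have "tie_partition n Y = (\<lambda>w. (\<lambda>\<rho>. (\<lambda>k. {i \<in> {1..n}. (i, k) \<in> \<rho>}) ` {1..n}) (R w))"
    unfolding tie_partition_def R_def by (intro ext image_cong) auto
  moreover have "(\<lambda>w. (\<lambda>\<rho>. (\<lambda>k. {i \<in> {1..n}. (i, k) \<in> \<rho>}) ` {1..n}) (R w)) \<in> N \<rightarrow>\<^sub>M count_space UNIV"
    by (rule measurable_compose[OF R]) simp
  ultimately show ?thesis by simp
qed

text \<open>A random index set is replaced by a fixed finite one, so that measurability of such sums
  follows from that of the summands and of the events that C is a block.\<close>

lemma sum_tie_partition:
  fixes h :: "nat set \<Rightarrow> 'b::comm_monoid_add"
  shows "(\<Sum>C\<in>tie_partition n Y w. h C) = (\<Sum>C\<in>Pow {1..n} - {{}}. if C \<in> tie_partition n Y w then h C else 0)"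
  using tie_partition_blocks(1,2)[of _ n Y w] by (subst sum.inter_restrict[symmetric]) (auto intro!: sum.cong)

section \<open>Samples with Gamma weighted blocks\<close>

locale urn_sample =
  fixes \<theta> :: real and H :: "'y::polish_space measure" and n :: nat and N :: "'w measure"
    and Y :: "nat \<Rightarrow> 'w \<Rightarrow> 'y" and R :: "nat set \<Rightarrow> 'w \<Rightarrow> real"
  assumes prob_H: "prob_space H" and sets_H: "sets H = sets borel" and \<theta>_pos: "0 < \<theta>"
    and blackwell: "blackwell_macqueen \<theta> H n N Y" and weights: "gamma_block_weights n N Y R"
begin

sublocale N: prob_space N using blackwell by (simp add: blackwell_macqueen_def)

lemma measurable_Y: "i \<in> {1..n} \<Longrightarrow> Y i \<in> borel_measurable N"
  using blackwell by (simp add: blackwell_macqueen_def)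

lemma measurable_R [measurable]: "R C \<in> borel_measurable N"
  using weights by (simp add: gamma_block_weights_def)

lemma measurable_tie: "tie_partition n Y \<in> N \<rightarrow>\<^sub>M count_space UNIV"
  by (rule measurable_tie_partition[OF measurable_Y])

lemma sets_tie [measurable]: "{w \<in> space N. tie_partition n Y w = \<pi>} \<in> sets N"
    "{w \<in> space N. C \<in> tie_partition n Y w} \<in> sets N"
  using measurable_sets[OF measurable_tie, of "{\<pi>}"] measurable_sets[OF measurable_tie, of "{\<pi>. C \<in> \<pi>}"]
  by (simp_all add: vimage_def Int_def conj_commute)

lemma measurable_block_value:
  assumes "C \<in> Pow {1..n} - {{}}"
  shows "block_value Y C \<in> borel_measurable N"
proof -
  have "finite C" "C \<noteq> {}" using assms finite_subset[of C "{1..n}"] by auto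
  then have "Min C \<in> {1..n}" using assms Min_in[of C] by blast
  from measurable_Y[OF this] show ?thesis by (simp add: block_value_def[abs_def])
qed

lemma measurable_sum_tie:
  fixes h :: "nat set \<Rightarrow> 'w \<Rightarrow> 'b::{second_countable_topology, topological_comm_monoid_add}"
  assumes h: "\<And>C. C \<in> Pow {1..n} - {{}} \<Longrightarrow> h C \<in> borel_measurable N"
  shows "(\<lambda>w. \<Sum>C\<in>tie_partition n Y w. h C w) \<in> borel_measurable N"
  unfolding sum_tie_partition[where h="\<lambda>C. h C _"]
  using sets_tie(2) by (intro borel_measurable_sum measurable_If h) auto

lemma measurable_weighted_block_sum:
  assumes "f \<in> borel_measurable borel"
  shows "weighted_block_sum n Y R f \<in> borel_measurable N"
  unfolding weighted_block_sum_def[abs_def]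
  by (rule measurable_sum_tie, rule borel_measurable_times[OF measurable_R],
      rule measurable_compose[OF measurable_block_value assms])

lemma sample_law:
  "distr N (sample_space n) (\<lambda>w. \<lambda>i\<in>{1..n}. Y i w)
    = scale_measure (ennreal (Gamma \<theta> / Gamma (\<theta> + real n))) (urn_measure \<theta> H n)"
  (is "?L = ?R")
proof (rule measure_eqI)
  fix A assume "A \<in> sets ?L"
  then have A: "A \<in> sets (sample_space n)" by simp
  then have "emeasure ?L A = ennreal (Gamma \<theta> / Gamma (\<theta> + real n)) * urn_integral \<theta> H n (indicator A)"
    using blackwell unfolding blackwell_macqueen_def by blast
  also have "urn_integral \<theta> H n (indicator A) = emeasure (urn_measure \<theta> H n) A"
    using A by (subst nn_integral_urn_measure[OF prob_H sets_H, symmetric]) auto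
  finally show "emeasure ?L A = emeasure ?R A" unfolding emeasure_scale_measure .
qed simp

text \<open>Under the law conditioned on \<pi> the weights have a product of Gamma laws and are
  independent of the block values. For fixed values a block of size m thus contributes (1 + f)^(-m),
  the Laplace transform of Gamma(m).\<close>

lemma conditional_weights:
  fixes \<pi>
  defines "E \<equiv> {w \<in> space N. tie_partition n Y w = \<pi>}"
  assumes E: "0 < measure N E"
  shows "finite \<pi>" "\<And>C. C \<in> \<pi> \<Longrightarrow> C \<in> Pow {1..n} - {{}}"
    and "\<And>C. C \<in> \<pi> \<Longrightarrow> AE w in N. w \<in> E \<longrightarrow> 0 < R C w"
    and "\<And>f. f \<in> borel_measurable borel \<Longrightarrow> (\<And>y. 0 \<le> f y) \<Longrightarrow>
      (\<integral>\<^sup>+w. ennreal (exp (- (\<Sum>C\<in>\<pi>. R C w * f (block_value Y C w)))) * indicator E w \<partial>N)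
      = (\<integral>\<^sup>+w. ennreal (\<Prod>C\<in>\<pi>. (1 / (1 + f (block_value Y C w))) ^ card C) * indicator E w \<partial>N)"
proof -
  have "E \<noteq> {}" using E by auto
  then obtain w0 where w0: "tie_partition n Y w0 = \<pi>" by (auto simp: E_def)
  show fin: "finite \<pi>" using w0 by (auto simp: tie_partition_def)
  show blocks: "C \<in> Pow {1..n} - {{}}" if "C \<in> \<pi>" for C
    using tie_partition_blocks(1,2)[of C n Y w0] that w0 by auto
  have [measurable]: "E \<in> sets N" unfolding E_def by (rule sets_tie)
  have E': "emeasure N E \<noteq> 0" "emeasure N E < \<infinity>" using E by (auto simp: N.emeasure_eq_measure)
  define P where "P = uniform_measure N E"
  have sets_P [measurable_cong]: "sets P = sets N" by (simp add: P_def)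
  interpret P: prob_space P unfolding P_def using E' by (intro prob_space_uniform_measure) auto
  define V where "V w = (\<lambda>C\<in>\<pi>. block_value Y C w)" for w
  have V [measurable]: "V \<in> P \<rightarrow>\<^sub>M (\<Pi>\<^sub>M C\<in>\<pi>. borel)"
    unfolding V_def using measurable_block_value[OF blocks]
    by (intro measurable_restrict) (simp cong: measurable_cong_sets)
  let ?B = "\<Pi>\<^sub>M C\<in>\<pi>. borel :: real measure"
  let ?g = "\<lambda>C :: nat set. gamma_law (real (card C))"
  have R [measurable]: "(\<lambda>w. \<lambda>C\<in>\<pi>. R C w) \<in> P \<rightarrow>\<^sub>M ?B" by measurable
  have law: "distr P (?B \<Otimes>\<^sub>M (\<Pi>\<^sub>M C\<in>\<pi>. borel)) (\<lambda>w. (\<lambda>C\<in>\<pi>. R C w, V w))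
      = (\<Pi>\<^sub>M C\<in>\<pi>. ?g C) \<Otimes>\<^sub>M distr P (\<Pi>\<^sub>M C\<in>\<pi>. borel) V"
    using weights E unfolding gamma_block_weights_def Let_def P_def V_def E_def by blast
  have pos: "0 < real (card C)" if "C \<in> \<pi>" for C
    using blocks[OF that] finite_subset[of C "{1..n}"] by (auto simp: card_gt_0_iff)
  \<comment> \<open>The product construction asks for sigma-finiteness at every index, including
    sets of cardinality 0. There \<open>Gamma 0 = 0\<close> and division by 0 gives 0, so
    \<open>gamma_law 0\<close> is the null measure.\<close>
  have sf: "sigma_finite_measure (?g C)" for C :: "nat set"
  proof (cases "card C = 0")
    case True
    have "gamma_density 0 x = 0" for x by (simp add: gamma_density_def Gamma_eq_zero_iff)
    then have "finite_measure (?g C)"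
      by (intro finite_measureI) (simp add: True gamma_law_eq emeasure_density)
    then show ?thesis by (rule finite_measure.sigma_finite_measure)
  next
    case False
    then show ?thesis
      by (intro finite_measure.sigma_finite_measure prob_space.finite_measure prob_space_gamma_law) simp
  qed
  interpret PG: product_sigma_finite ?g using sf by (simp add: product_sigma_finite_def)
  interpret PiG: prob_space "\<Pi>\<^sub>M C\<in>\<pi>. ?g C"
    by (rule prob_space_PiM) (use pos prob_space_gamma_law in auto)
  interpret DV: prob_space "distr P (\<Pi>\<^sub>M C\<in>\<pi>. borel) V" by (rule P.prob_space_distr) simp
  interpret PGV: pair_sigma_finite "\<Pi>\<^sub>M C\<in>\<pi>. ?g C" "distr P (\<Pi>\<^sub>M C\<in>\<pi>. borel) V" ..
  have sets_PiG [measurable_cong]: "sets (\<Pi>\<^sub>M C\<in>\<pi>. ?g C) = sets ?B" by (rule sets_PiM_cong) auto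
  show "AE w in N. w \<in> E \<longrightarrow> 0 < R C w" if C: "C \<in> \<pi>" for C
  proof -
    have "distr P ?B (\<lambda>w. \<lambda>C\<in>\<pi>. R C w)
        = distr (distr P (?B \<Otimes>\<^sub>M (\<Pi>\<^sub>M C\<in>\<pi>. borel)) (\<lambda>w. (\<lambda>C\<in>\<pi>. R C w, V w))) ?B fst"
      by (subst distr_distr) (auto simp: comp_def)
    also have "\<dots> = distr ((\<Pi>\<^sub>M C\<in>\<pi>. ?g C) \<Otimes>\<^sub>M distr P (\<Pi>\<^sub>M C\<in>\<pi>. borel) V) (\<Pi>\<^sub>M C\<in>\<pi>. ?g C) fst"
      unfolding law by (rule distr_cong) (simp_all add: sets_PiG)
    also have "\<dots> = (\<Pi>\<^sub>M C\<in>\<pi>. ?g C)" by (rule DV.distr_pair_fst)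
    finally have RL: "distr P ?B (\<lambda>w. \<lambda>C\<in>\<pi>. R C w) = (\<Pi>\<^sub>M C\<in>\<pi>. ?g C)" .
    have "AE r in (\<Pi>\<^sub>M C\<in>\<pi>. ?g C). 0 < r C"
      using pos by (intro AE_PiM_component C prob_space_gamma_law AE_gamma_law) auto
    then have "AE w in P. 0 < (\<lambda>C\<in>\<pi>. R C w) C"
      unfolding RL[symmetric] by (rule AE_distrD[OF R])
    then have "AE w in N. w \<in> E \<longrightarrow> 0 < (\<lambda>C\<in>\<pi>. R C w) C"
      unfolding P_def AE_uniform_measure[OF E'] .
    then show ?thesis using C by simp
  qed
  fix f :: "'y \<Rightarrow> real" assume f [measurable]: "f \<in> borel_measurable borel" and f0: "\<And>y. 0 \<le> f y"
  have int: "(\<integral>\<^sup>+r. ennreal (exp (- (r * f v))) \<partial>?g C) = ennreal ((1 / (1 + f v)) ^ card C)" if "C \<in> \<pi>" for C v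
  proof -
    have "(1 + f v) powr (- real (card C)) = (1 / (1 + f v)) ^ card C"
      using f0[of v] by (simp add: powr_minus powr_realpow power_divide divide_simps add_pos_nonneg)
    then show ?thesis
      using nn_integral_exp_gamma_law[OF pos[OF that] f0[of v]] by (simp add: mult.commute)
  qed
  have "(\<integral>\<^sup>+w. ennreal (exp (- (\<Sum>C\<in>\<pi>. R C w * f (block_value Y C w)))) \<partial>P)
      = (\<integral>\<^sup>+w. (case (\<lambda>C\<in>\<pi>. R C w, V w) of (r, v) \<Rightarrow> \<Prod>C\<in>\<pi>. ennreal (exp (- (r C * f (v C))))) \<partial>P)"
    using fin by (auto intro!: nn_integral_cong simp: V_def exp_sum sum_negf[symmetric] prod_ennreal)
  also have "\<dots> = (\<integral>\<^sup>+(r, v). (\<Prod>C\<in>\<pi>. ennreal (exp (- (r C * f (v C)))))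
      \<partial>distr P (?B \<Otimes>\<^sub>M (\<Pi>\<^sub>M C\<in>\<pi>. borel)) (\<lambda>w. (\<lambda>C\<in>\<pi>. R C w, V w)))"
    by (rule nn_integral_distr[symmetric]) measurable
  \<comment> \<open>The block values \<open>v\<close> are held fixed and the weights integrated
    first, so that the product law factorises the integral over the blocks.\<close>
  also have "\<dots> = (\<integral>\<^sup>+v. \<integral>\<^sup>+r. (\<Prod>C\<in>\<pi>. ennreal (exp (- (r C * f (v C))))) \<partial>(\<Pi>\<^sub>M C\<in>\<pi>. ?g C)
      \<partial>distr P (\<Pi>\<^sub>M C\<in>\<pi>. borel) V)"
    unfolding law by (subst PGV.nn_integral_snd[symmetric]) simp_all
  also have "\<dots> = (\<integral>\<^sup>+v. (\<Prod>C\<in>\<pi>. ennreal ((1 / (1 + f (v C))) ^ card C)) \<partial>distr P (\<Pi>\<^sub>M C\<in>\<pi>. borel) V)"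
    by (subst PG.product_nn_integral_prod[OF fin]) (simp_all add: int cong: prod.cong)
  also have "\<dots> = (\<integral>\<^sup>+w. ennreal (\<Prod>C\<in>\<pi>. (1 / (1 + f (block_value Y C w))) ^ card C) \<partial>P)"
    using f0 by (subst nn_integral_distr) (auto intro!: nn_integral_cong simp: V_def prod_ennreal)
  finally have P_eq: "(\<integral>\<^sup>+w. ennreal (exp (- (\<Sum>C\<in>\<pi>. R C w * f (block_value Y C w)))) \<partial>P)
      = (\<integral>\<^sup>+w. ennreal (\<Prod>C\<in>\<pi>. (1 / (1 + f (block_value Y C w))) ^ card C) \<partial>P)" .
  note [measurable] = measurable_block_value[OF blocks]
  \<comment> \<open>Both sides carry the normalisation of the conditional law; it cancels because
    the probability of \<open>E\<close> is neither 0 nor \<infinity>.\<close>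
  have "a = b" if "a / emeasure N E = b / emeasure N E" for a b
    using that E' by (metis ennreal_divide_times ennreal_mult_divide_eq infinity_ennreal_def less_irrefl mult.commute ennreal_times_divide)
  then show "(\<integral>\<^sup>+w. ennreal (exp (- (\<Sum>C\<in>\<pi>. R C w * f (block_value Y C w)))) * indicator E w \<partial>N)
      = (\<integral>\<^sup>+w. ennreal (\<Prod>C\<in>\<pi>. (1 / (1 + f (block_value Y C w))) ^ card C) * indicator E w \<partial>N)"
    using P_eq unfolding P_def by (subst (asm) (1 2) nn_integral_uniform_measure) auto
qed

text \<open>Where the partition has positive probability the weights are Gamma variables, and the
  remaining values of the partition are finitely many null events. Positivity is needed later
  because an atom of mass \<open>ennreal (R C w)\<close> has the intended weight only if
  \<open>R C w\<close> is not negative.\<close>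

lemma AE_weights_pos: "AE w in N. \<forall>C\<in>tie_partition n Y w. 0 < R C w"
proof -
  have "AE w in N. tie_partition n Y w = \<pi> \<longrightarrow> (\<forall>C\<in>\<pi>. 0 < R C w)" for \<pi>
  proof (cases "0 < measure N {w \<in> space N. tie_partition n Y w = \<pi>}")
    case True
    have "AE w in N. \<forall>C\<in>\<pi>. w \<in> {w \<in> space N. tie_partition n Y w = \<pi>} \<longrightarrow> 0 < R C w"
      by (rule AE_finite_allI[OF conditional_weights(1)[OF True] conditional_weights(3)[OF True]])
    then show ?thesis by (rule AE_mp) (auto intro!: AE_I2)
  next
    case False
    then have "AE w in N. w \<notin> {w \<in> space N. tie_partition n Y w = \<pi>}"
      by (intro AE_not_in) (auto simp: null_sets_def N.emeasure_eq_measure not_less measure_le_0_iff)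
    then show ?thesis by (rule AE_mp) (auto intro!: AE_I2)
  qed
  then have "AE w in N. \<forall>\<pi>\<in>Pow (Pow {1..n}). tie_partition n Y w = \<pi> \<longrightarrow> (\<forall>C\<in>\<pi>. 0 < R C w)"
    by (intro AE_finite_allI) auto
  then show ?thesis
  proof (rule AE_mp, intro AE_I2 impI)
    fix w
    assume *: "\<forall>\<pi>\<in>Pow (Pow {1..n}). tie_partition n Y w = \<pi> \<longrightarrow> (\<forall>C\<in>\<pi>. 0 < R C w)"
    have "tie_partition n Y w \<in> Pow (Pow {1..n})" by (auto simp: tie_partition_def)
    with * show "\<forall>C\<in>tie_partition n Y w. 0 < R C w" by blast
  qed
qed

text \<open>The integral is split according to the value of the partition. On each piece the weights
  integrate out to a product which, by \<open>prod_tie_partition\<close>, has the same form for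
  every partition, so the pieces reassemble to one integral over the sample law.\<close>

lemma laplace_block_sum:
  assumes f [measurable]: "f \<in> borel_measurable borel" and f0: "\<And>y. 0 \<le> f y"
  shows "(\<integral>\<^sup>+w. ennreal (exp (- weighted_block_sum n Y R f w)) \<partial>N)
    = ennreal (Gamma \<theta> / Gamma (\<theta> + real n)) * (\<integral>\<^sup>+y. ennreal (\<Prod>i\<in>{1..n}. 1 / (1 + f (y i))) \<partial>urn_measure \<theta> H n)"
proof -
  let ?\<Pi> = "Pow (Pow {1..n})"
  let ?E = "\<lambda>\<pi>. {w \<in> space N. tie_partition n Y w = \<pi>}"
  let ?h = "\<lambda>w. ennreal (exp (- weighted_block_sum n Y R f w))"
  let ?k = "\<lambda>w. ennreal (\<Prod>i\<in>{1..n}. 1 / (1 + f (Y i w)))"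
  note [measurable] = measurable_Y measurable_block_value
  have hm [measurable]: "?h \<in> borel_measurable N"
    using measurable_weighted_block_sum[OF f] by measurable
  have km [measurable]: "?k \<in> borel_measurable N" by measurable
  have decomp: "(\<integral>\<^sup>+w. u w \<partial>N) = (\<Sum>\<pi>\<in>?\<Pi>. \<integral>\<^sup>+w. u w * indicator (?E \<pi>) w \<partial>N)"
    if [measurable]: "u \<in> borel_measurable N" for u :: "'w \<Rightarrow> ennreal"
  proof -
    have "(\<Sum>\<pi>\<in>?\<Pi>. u w * indicator (?E \<pi>) w) = u w" if "w \<in> space N" for w
    proof -
      have "tie_partition n Y w \<in> ?\<Pi>" by (auto simp: tie_partition_def)
      moreover have "u w * indicator (?E \<pi>) w = (if tie_partition n Y w = \<pi> then u w else 0)" for \<pi>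
        using that by (simp add: indicator_def)
      ultimately show ?thesis by simp
    qed
    then have "(\<integral>\<^sup>+w. u w \<partial>N) = (\<integral>\<^sup>+w. (\<Sum>\<pi>\<in>?\<Pi>. u w * indicator (?E \<pi>) w) \<partial>N)"
      by (intro nn_integral_cong) simp
    then show ?thesis by (subst (asm) nn_integral_sum) auto
  qed
  have block: "(\<integral>\<^sup>+w. ?h w * indicator (?E \<pi>) w \<partial>N) = (\<integral>\<^sup>+w. ?k w * indicator (?E \<pi>) w \<partial>N)" for \<pi>
  proof (cases "0 < measure N (?E \<pi>)")
    case True
    have "(\<integral>\<^sup>+w. ?h w * indicator (?E \<pi>) w \<partial>N)
        = (\<integral>\<^sup>+w. ennreal (exp (- (\<Sum>C\<in>\<pi>. R C w * f (block_value Y C w)))) * indicator (?E \<pi>) w \<partial>N)"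
      by (rule nn_integral_cong) (auto simp: weighted_block_sum_def split: split_indicator)
    also have "\<dots> = (\<integral>\<^sup>+w. ennreal (\<Prod>C\<in>\<pi>. (1 / (1 + f (block_value Y C w))) ^ card C) * indicator (?E \<pi>) w \<partial>N)"
      by (rule conditional_weights(4)[OF True f f0])
    also have "\<dots> = (\<integral>\<^sup>+w. ?k w * indicator (?E \<pi>) w \<partial>N)"
      using prod_tie_partition[where h="\<lambda>y. 1 / (1 + f y)" and n=n and Y=Y]
      by (intro nn_integral_cong) (auto split: split_indicator)
    finally show ?thesis .
  next
    case False
    then have "AE w in N. w \<notin> ?E \<pi>"
      by (intro AE_not_in) (auto simp: null_sets_def N.emeasure_eq_measure not_less measure_le_0_iff)
    then show ?thesis by (intro nn_integral_cong_AE) (auto elim: AE_mp)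
  qed
  have "(\<integral>\<^sup>+w. ?h w \<partial>N) = (\<integral>\<^sup>+w. ?k w \<partial>N)"
    unfolding decomp[OF hm] decomp[OF km] block ..
  also have "\<dots> = (\<integral>\<^sup>+y. ennreal (\<Prod>i\<in>{1..n}. 1 / (1 + f (y i))) \<partial>distr N (sample_space n) (\<lambda>w. \<lambda>i\<in>{1..n}. Y i w))"
    by (subst nn_integral_distr) (auto intro!: nn_integral_cong simp: measurable_restrict)
  also have "\<dots> = ennreal (Gamma \<theta> / Gamma (\<theta> + real n)) * (\<integral>\<^sup>+y. ennreal (\<Prod>i\<in>{1..n}. 1 / (1 + f (y i))) \<partial>urn_measure \<theta> H n)"
    unfolding sample_law by (subst nn_integral_scale_measure) auto
  finally show ?thesis .
qed

end

section \<open>The proposition\<close>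

text \<open>The convolution is the law of \<open>\<mu>(g)\<close> for a Gamma process with the weighted sample atoms
  added. This random measure has the same Laplace functional as the tilted process.\<close>

theorem mass_power_tilt_law:
  fixes H :: "'y::polish_space measure" and N :: "'w measure"
  assumes G: "gamma_process_law \<theta> H G" and U: "urn_sample \<theta> H n N Y R"
    and g: "g \<in> borel_measurable borel" and log: "integrable H (\<lambda>y. ln (1 + \<bar>g y\<bar>))"
  shows "distr (density G (\<lambda>\<mu>. ennreal (Gamma \<theta> / Gamma (\<theta> + real n) * measure \<mu> UNIV ^ n))) borel (\<lambda>\<mu>. \<integral>y. g y \<partial>\<mu>)
    = convolution (distr G borel (\<lambda>\<mu>. \<integral>y. g y \<partial>\<mu>)) (distr N borel (weighted_block_sum n Y R g))"
proof -
  interpret G: gamma_process_law \<theta> H G by (rule G)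
  interpret U: urn_sample \<theta> H n N Y R by (rule U)
  interpret GN: pair_prob_space G N ..
  note [measurable_cong] = G.sets_G
  define c where "c = Gamma \<theta> / Gamma (\<theta> + real n)"
  let ?D = "density G (\<lambda>\<mu>. ennreal (c * measure \<mu> UNIV ^ n))"
  let ?K = "finite_measure_algebra (borel :: 'y measure)"
  have c0: "0 \<le> c" using G.\<theta>_pos by (simp add: c_def Gamma_real_pos less_imp_le)
  define tie where "tie w = tie_partition n Y w" for w
  have tie_fin: "finite (tie w)" for w by (simp add: tie_def tie_partition_def)
  define atom where "atom w C = scale_measure (ennreal (R C w)) (return borel (block_value Y C w))" for w C
  \<comment> \<open>The index \<open>None\<close> carries the Gamma process, the indices
    \<open>Some C\<close> carry the atoms of the sample.\<close>
  define \<Xi> where "\<Xi> = (\<lambda>(\<mu>, w). sum_measure borel (insert None (Some ` tie w)) (case_option \<mu> (atom w)))"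
  have sum_split: "(\<Sum>j\<in>insert None (Some ` tie w). h j) = h None + (\<Sum>C\<in>tie w. h (Some C))"
    for w and h :: "nat set option \<Rightarrow> 'c::comm_monoid_add"
    using tie_fin[of w] by (subst sum.insert) (auto simp: sum.reindex)
  have sets_case: "sets (case_option \<mu> (atom w) j) = sets borel" if "\<mu> \<in> space G" for \<mu> w j
    using that by (auto simp: G.space_G atom_def split: option.split)
  have em: "emeasure (\<Xi> (\<mu>, w)) A = emeasure \<mu> A + (\<Sum>C\<in>tie w. ennreal (R C w) * indicator A (block_value Y C w))"
    if "\<mu> \<in> space G" "A \<in> sets borel" for \<mu> w A
    using that by (simp add: \<Xi>_def emeasure_sum_measure sets_case sum_split atom_def)
  have \<Xi> [measurable]: "\<Xi> \<in> G \<Otimes>\<^sub>M N \<rightarrow>\<^sub>M ?K"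
  proof (rule measurable_finite_measure_algebra)
    fix p :: "'y measure \<times> 'w" assume p: "p \<in> space (G \<Otimes>\<^sub>M N)"
    then have \<mu>: "fst p \<in> space G" by (auto simp: space_pair_measure)
    show "sets (\<Xi> p) = sets borel" by (simp add: \<Xi>_def split_beta)
    show "finite_measure (\<Xi> p)"
    proof (rule finite_measureI)
      interpret \<mu>: finite_measure "fst p" using \<mu> by (simp add: G.space_G)
      have "emeasure (\<Xi> (fst p, snd p)) UNIV \<noteq> \<infinity>"
        using tie_fin[of "snd p"] by (subst em[OF \<mu>]) (auto simp: \<mu>.emeasure_eq_measure)
      then show "emeasure (\<Xi> p) (space (\<Xi> p)) \<noteq> \<infinity>" by (simp add: \<Xi>_def split_beta)
    qed
  next
    fix A :: "'y set" assume [measurable]: "A \<in> sets borel"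
    have 1: "(\<lambda>p. emeasure (fst p) A) \<in> borel_measurable (G \<Otimes>\<^sub>M N)"
      by (rule measurable_compose[OF measurable_fst G.measurable_emeasure]) simp
    have "(\<lambda>w. \<Sum>C\<in>tie w. ennreal (R C w) * indicator A (block_value Y C w)) \<in> borel_measurable N"
      unfolding tie_def
    proof (rule U.measurable_sum_tie)
      fix C :: "nat set" assume "C \<in> Pow {1..n} - {{}}"
      note [measurable] = U.measurable_block_value[OF this]
      show "(\<lambda>w. ennreal (R C w) * indicator A (block_value Y C w)) \<in> borel_measurable N" by measurable
    qed
    have 2: "(\<lambda>p. \<Sum>C\<in>tie (snd p). ennreal (R C (snd p)) * indicator A (block_value Y C (snd p))) \<in> borel_measurable (G \<Otimes>\<^sub>M N)"
      by (rule measurable_compose[OF measurable_snd \<open>_ \<in> borel_measurable N\<close>])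
    have "emeasure (\<Xi> p) A = emeasure (fst p) A + (\<Sum>C\<in>tie (snd p). ennreal (R C (snd p)) * indicator A (block_value Y C (snd p)))"
      if "p \<in> space (G \<Otimes>\<^sub>M N)" for p
      using em[of "fst p" A "snd p"] that by (auto simp: space_pair_measure)
    then show "(\<lambda>p. emeasure (\<Xi> p) A) \<in> borel_measurable (G \<Otimes>\<^sub>M N)"
      using borel_measurable_add[OF 1 2] by (simp cong: measurable_cong)
  qed
  \<comment> \<open>Integrability of \<open>f\<close> makes the Bochner integral additive over the
    summands, and positive weights make \<open>ennreal (R C w)\<close> integrate as the real number
    \<open>R C w\<close>.\<close>
  have int_\<Xi>: "(\<integral>y. f y \<partial>\<Xi> (\<mu>, w)) = (\<integral>y. f y \<partial>\<mu>) + weighted_block_sum n Y R f w"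
    if \<mu>: "\<mu> \<in> space G" and f [measurable]: "f \<in> borel_measurable borel" and i: "integrable \<mu> f"
      and pos: "\<forall>C\<in>tie w. 0 < R C w" for \<mu> w and f :: "'y \<Rightarrow> real"
  proof -
    have "(\<integral>\<^sup>+y. ennreal (norm (f y)) \<partial>atom w C) < \<infinity>" for C
      unfolding atom_def
      by (subst nn_integral_scale_measure) (auto simp: nn_integral_return ennreal_mult_less_top)
    then have "integrable (atom w C) f" for C
      using f by (simp add: integrable_iff_bounded atom_def cong: measurable_cong_sets)
    then have "(\<integral>y. f y \<partial>\<Xi> (\<mu>, w)) = (\<integral>y. f y \<partial>\<mu>) + (\<Sum>C\<in>tie w. \<integral>y. f y \<partial>atom w C)"
      using i tie_fin[of w] unfolding \<Xi>_def prod.case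
      by (subst integral_sum_measure) (auto simp: sets_case[OF \<mu>] sum_split split: option.split)
    also have "(\<Sum>C\<in>tie w. \<integral>y. f y \<partial>atom w C) = weighted_block_sum n Y R f w"
      unfolding weighted_block_sum_def tie_def[symmetric] atom_def
    proof (rule sum.cong[OF refl])
      fix C assume "C \<in> tie w"
      with pos have "0 \<le> R C w" by (auto intro: less_imp_le)
      then show "(\<integral>y. f y \<partial>scale_measure (ennreal (R C w)) (return borel (block_value Y C w))) = R C w * f (block_value Y C w)"
        by (subst integral_scale_measure) (auto simp: integral_return)
    qed
    finally show ?thesis .
  qed
  have AE_fst: "AE p in G \<Otimes>\<^sub>M N. P (fst p)" if "AE \<mu> in G. P \<mu>" for P
  proof -
    have "AE \<mu> in distr (G \<Otimes>\<^sub>M N) G fst. P \<mu>" unfolding U.N.distr_pair_fst by (rule that)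
    then show ?thesis by (rule AE_distrD[OF measurable_fst])
  qed
  have AE_snd: "AE p in G \<Otimes>\<^sub>M N. \<forall>C\<in>tie (snd p). 0 < R C (snd p)"
  proof -
    have "AE p in G \<Otimes>\<^sub>M N. (\<lambda>w. \<forall>C\<in>tie w. 0 < R C w) (snd p)"
    proof (rule GN.AE_pair_measure)
      have "{w \<in> space N. \<forall>C\<in>tie w. 0 < R C w} = {w \<in> space N. \<forall>C\<in>Pow {1..n} - {{}}. C \<in> tie_partition n Y w \<longrightarrow> 0 < R C w}"
        using tie_partition_blocks(1,2)[of _ n Y] by (fastforce simp: tie_def)
      also have "\<dots> \<in> sets N"
        using U.sets_tie(2) by (intro sets.sets_Collect_finite_All sets.sets_Collect_imp) auto
      finally have "Measurable.pred N (\<lambda>w. \<forall>C\<in>tie w. 0 < R C w)" by (simp add: pred_def)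
      from measurable_compose[OF measurable_snd this]
      show "{p \<in> space (G \<Otimes>\<^sub>M N). (\<lambda>w. \<forall>C\<in>tie w. 0 < R C w) (snd p)} \<in> sets (G \<Otimes>\<^sub>M N)"
        by (simp add: pred_def)
      show "AE \<mu> in G. AE w in N. (\<lambda>w. \<forall>C\<in>tie w. 0 < R C w) (snd (\<mu>, w))"
        using U.AE_weights_pos by (simp add: tie_def)
    qed
    then show ?thesis by simp
  qed
  have wm: "weighted_block_sum n Y R f \<in> borel_measurable N" if "f \<in> borel_measurable borel" for f
    by (rule U.measurable_weighted_block_sum[OF that])
  have law: "?D = distr (G \<Otimes>\<^sub>M N) ?K \<Xi>"
  proof (rule finite_measure_algebra_laplace_unique)
    show "finite_measure (distr (G \<Otimes>\<^sub>M N) ?K \<Xi>)"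
      by (rule GN.finite_measure_distr) simp
    show "finite_measure ?D"
    proof (rule finite_measureI)
      have "emeasure ?D (space ?D) = (\<integral>\<^sup>+\<mu>. ennreal (c * measure \<mu> UNIV ^ n) \<partial>G)"
        by (simp add: emeasure_density cong: nn_integral_cong)
      also have "\<dots> = ennreal (\<integral>\<mu>. c * measure \<mu> UNIV ^ n \<partial>G)"
        using c0 G.integrable_mass_power[of n] by (intro nn_integral_eq_integral) auto
      finally show "emeasure ?D (space ?D) \<noteq> \<infinity>" by simp
    qed
    fix f :: "'y \<Rightarrow> real"
    assume f [measurable]: "f \<in> borel_measurable borel" and f0: "\<And>y. 0 \<le> f y" and fb: "bounded (range f)"
    let ?S = "weighted_block_sum n Y R f"
    let ?P = "\<lambda>y. \<Prod>i\<in>{1..n}. 1 / (1 + f (y i))"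
    note [measurable] = wm[OF f] measurable_integral_finite_measure_algebra[OF f]
    have S_exp: "(\<integral>w. exp (- ?S w) \<partial>N) = c * (\<integral>y. ?P y \<partial>urn_measure \<theta> H n)"
    proof -
      have P0: "0 \<le> ?P y" for y using f0 by (intro prod_nonneg) auto
      have "(\<integral>w. exp (- ?S w) \<partial>N) = enn2real (\<integral>\<^sup>+w. ennreal (exp (- ?S w)) \<partial>N)"
        by (rule integral_eq_nn_integral) auto
      also have "\<dots> = c * enn2real (\<integral>\<^sup>+y. ennreal (?P y) \<partial>urn_measure \<theta> H n)"
        using c0 by (simp add: U.laplace_block_sum[OF f f0, folded c_def] enn2real_mult)
      also have "enn2real (\<integral>\<^sup>+y. ennreal (?P y) \<partial>urn_measure \<theta> H n) = (\<integral>y. ?P y \<partial>urn_measure \<theta> H n)"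
        by (rule integral_eq_nn_integral[symmetric]) (use P0 in auto)
      finally show ?thesis .
    qed
    have "(\<integral>\<mu>. exp (- (\<integral>y. f y \<partial>\<mu>)) \<partial>distr (G \<Otimes>\<^sub>M N) ?K \<Xi>) = (\<integral>p. exp (- (\<integral>y. f y \<partial>\<Xi> p)) \<partial>(G \<Otimes>\<^sub>M N))"
      by (rule integral_distr) measurable
    also have "\<dots> = (\<integral>p. (case p of (\<mu>, w) \<Rightarrow> exp (- (\<integral>y. f y \<partial>\<mu>)) * exp (- ?S w)) \<partial>(G \<Otimes>\<^sub>M N))"
    proof (rule integral_cong_AE)
      show "AE p in G \<Otimes>\<^sub>M N. exp (- (\<integral>y. f y \<partial>\<Xi> p)) = (case p of (\<mu>, w) \<Rightarrow> exp (- (\<integral>y. f y \<partial>\<mu>)) * exp (- ?S w))"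
        using AE_snd AE_space
      proof eventually_elim
        fix p :: "'y measure \<times> 'w" assume p: "\<forall>C\<in>tie (snd p). 0 < R C (snd p)" "p \<in> space (G \<Otimes>\<^sub>M N)"
        then have "fst p \<in> space G" by (auto simp: space_pair_measure)
        with int_\<Xi>[of "fst p" f "snd p"] p G.integrable_point[OF _ f fb]
        show "exp (- (\<integral>y. f y \<partial>\<Xi> p)) = (case p of (\<mu>, w) \<Rightarrow> exp (- (\<integral>y. f y \<partial>\<mu>)) * exp (- ?S w))"
          by (simp add: split_beta exp_add[symmetric])
      qed
    qed measurable
    also have "\<dots> = (\<integral>\<mu>. \<integral>w. (case (\<mu>, w) of (\<mu>, w) \<Rightarrow> exp (- (\<integral>y. f y \<partial>\<mu>)) * exp (- ?S w)) \<partial>N \<partial>G)"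
    proof (rule GN.integral_fst'[symmetric])
      have "AE p in G \<Otimes>\<^sub>M N. norm (case p of (\<mu>, w) \<Rightarrow> exp (- (\<integral>y. f y \<partial>\<mu>)) * exp (- ?S w)) \<le> 1"
        using AE_snd
      proof eventually_elim
        fix p :: "'y measure \<times> 'w" assume p: "\<forall>C\<in>tie (snd p). 0 < R C (snd p)"
        have "0 \<le> ?S (snd p)"
          unfolding weighted_block_sum_def tie_def[symmetric] using p f0 by (intro sum_nonneg mult_nonneg_nonneg) (auto intro: less_imp_le)
        moreover have "0 \<le> (\<integral>y. f y \<partial>fst p)" by (auto intro!: integral_nonneg_AE simp: f0)
        ultimately show "norm (case p of (\<mu>, w) \<Rightarrow> exp (- (\<integral>y. f y \<partial>\<mu>)) * exp (- ?S w)) \<le> 1"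
          by (simp add: split_beta exp_add[symmetric])
      qed
      then show "integrable (G \<Otimes>\<^sub>M N) (\<lambda>p. case p of (\<mu>, w) \<Rightarrow> exp (- (\<integral>y. f y \<partial>\<mu>)) * exp (- ?S w))"
        by (intro GN.P.integrable_const_bound[where B=1]) measurable
    qed
    also have "\<dots> = (\<integral>\<mu>. exp (- (\<integral>y. f y \<partial>\<mu>)) \<partial>G) * (\<integral>w. exp (- ?S w) \<partial>N)" by simp
    \<comment> \<open>The exponential factor in \<open>laplace_mass_power\<close> is the Laplace
      functional of the Gamma process, and the urn integral next to it, multiplied by c, is the
      Laplace transform of the block sum.\<close>
    also have "\<dots> = c * (\<integral>\<mu>. measure \<mu> UNIV ^ n * exp (- (\<integral>y. f y \<partial>\<mu>)) \<partial>G)"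
      using G.laplace_mass_power[OF f f0 fb] G.laplace[OF f f0 fb] S_exp by simp
    also have "\<dots> = (\<integral>\<mu>. exp (- (\<integral>y. f y \<partial>\<mu>)) \<partial>?D)"
      using c0 by (subst integral_density) (auto simp: mult.assoc)
    finally show "(\<integral>\<mu>. exp (- (\<integral>y. f y \<partial>\<mu>)) \<partial>?D) = (\<integral>\<mu>. exp (- (\<integral>y. f y \<partial>\<mu>)) \<partial>distr (G \<Otimes>\<^sub>M N) ?K \<Xi>)" by simp
  qed (auto simp: G.sets_G)
  let ?I = "\<lambda>\<mu>. \<integral>y. g y \<partial>\<mu>" and ?S = "weighted_block_sum n Y R g"
  note [measurable] = wm[OF g] measurable_integral_finite_measure_algebra[OF g]
  have "distr ?D borel ?I = distr (G \<Otimes>\<^sub>M N) borel (\<lambda>p. ?I (\<Xi> p))"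
    unfolding law by (subst distr_distr) (auto simp: comp_def)
  \<comment> \<open>The log condition enters here: \<open>g\<close> is almost surely integrable for
    the Gamma process, so the integral over the enlarged measure splits into the two
    summands.\<close>
  also have "\<dots> = distr (G \<Otimes>\<^sub>M N) borel (\<lambda>(\<mu>, w). ?I \<mu> + ?S w)"
  proof (rule distr_cong_AE)
    show "AE p in G \<Otimes>\<^sub>M N. ?I (\<Xi> p) = (case p of (\<mu>, w) \<Rightarrow> ?I \<mu> + ?S w)"
      using AE_snd AE_space AE_fst[OF G.AE_integrable[OF g log]]
    proof eventually_elim
      fix p :: "'y measure \<times> 'w" assume p: "\<forall>C\<in>tie (snd p). 0 < R C (snd p)" "p \<in> space (G \<Otimes>\<^sub>M N)" "integrable (fst p) g"
      then have "fst p \<in> space G" by (auto simp: space_pair_measure)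
      with int_\<Xi>[of "fst p" g "snd p"] p g show "?I (\<Xi> p) = (case p of (\<mu>, w) \<Rightarrow> ?I \<mu> + ?S w)"
        by (simp add: split_beta)
    qed
  qed auto
  also have "\<dots> = convolution (distr G borel ?I) (distr N borel ?S)"
  proof -
    interpret S: prob_space "distr N borel ?S" by (rule U.N.prob_space_distr) simp
    have "distr G borel ?I \<Otimes>\<^sub>M distr N borel ?S = distr (G \<Otimes>\<^sub>M N) (borel \<Otimes>\<^sub>M borel) (\<lambda>(\<mu>, w). (?I \<mu>, ?S w))"
      by (rule pair_measure_distr) (auto intro: S.sigma_finite_measure_axioms)
    then show ?thesis unfolding convolution_def by (simp add: distr_distr comp_def case_prod_unfold)
  qed
  finally show ?thesis unfolding c_def .
qed

text \<open>A single observation has only the partition {{1}}, so conditioning on it changes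
  nothing: the weight is Gamma(1) and independent of the value. The value has law \<open>H\<close>,
  as Gamma(\<theta>) / Gamma(\<theta> + 1) = 1/\<theta> cancels the urn mass \<theta>.\<close>

lemma (in urn_sample) single_sample_law:
  assumes n: "n = 1" and g [measurable]: "g \<in> borel_measurable borel"
  shows "distr N borel (weighted_block_sum n Y R g) = indep_times (gamma_law 1) (distr H borel g)"
proof -
  interpret H: prob_space H by (rule prob_H)
  note [measurable_cong] = sets_H
  note [measurable] = measurable_Y
  let ?\<pi> = "{{1::nat}}"
  have tie: "tie_partition n Y w = ?\<pi>" for w by (auto simp: tie_partition_def n)
  have block: "block_value Y {1} = Y 1" by (simp add: block_value_def fun_eq_iff)
  have Y1 [measurable]: "Y 1 \<in> borel_measurable N" by (rule measurable_Y) (simp add: n)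
  \<comment> \<open>The event has probability one, so the conditional law in
    \<open>gamma_block_weights\<close> is \<open>N\<close> itself.\<close>
  have UN: "uniform_measure N {w \<in> space N. tie_partition n Y w = ?\<pi>} = N"
    by (rule measure_eqI) (auto simp: tie N.emeasure_space_1 divide_ennreal_def)
  have Y_law: "distr N borel (Y 1) = H"
  proof (rule measure_eqI)
    fix A assume "A \<in> sets (distr N borel (Y 1))"
    then have A [measurable]: "A \<in> sets borel" by simp
    let ?A = "{y \<in> space (sample_space 1). y 1 \<in> A}"
    have A': "?A \<in> sets (sample_space n)" unfolding n by measurable
    have gam: "Gamma \<theta> / Gamma (\<theta> + 1) * \<theta> = 1"
    proof -
      have "Gamma (\<theta> + 1) = \<theta> * Gamma \<theta>"
        by (rule Gamma_plus1) (use \<theta>_pos in \<open>auto elim!: nonpos_Ints_cases\<close>)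
      moreover have "Gamma \<theta> \<noteq> 0" using Gamma_real_pos[OF \<theta>_pos] by linarith
      ultimately show ?thesis using \<theta>_pos by simp
    qed
    have "emeasure (distr N borel (Y 1)) A = emeasure (distr N (sample_space n) (\<lambda>w. \<lambda>i\<in>{1..n}. Y i w)) ?A"
      using A' by (simp add: emeasure_distr measurable_restrict n) (auto intro!: arg_cong2[where f=emeasure] simp: space_PiM)
    also have "\<dots> = ennreal (Gamma \<theta> / Gamma (\<theta> + 1)) * urn_integral \<theta> H 1 (indicator ?A)"
      using blackwell A' unfolding blackwell_macqueen_def n by simp
    also have "urn_integral \<theta> H 1 (indicator ?A) = ennreal \<theta> * (\<integral>\<^sup>+z. indicator A z \<partial>H)"
    proof -
      \<comment> \<open>The empty sample is the function that is \<open>undefined\<close>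
        everywhere; its update at 1 is extensional on {1..1} and hence a point of the sample
        space.\<close>
      have "indicator ?A ((\<lambda>_. undefined)(1 := z)) = (indicator A z :: ennreal)" for z
        by (auto simp: indicator_def space_PiM PiE_def extensional_def)
      then show ?thesis by simp
    qed
    also have "ennreal (Gamma \<theta> / Gamma (\<theta> + 1)) * (ennreal \<theta> * (\<integral>\<^sup>+z. indicator A z \<partial>H))
        = ennreal (Gamma \<theta> / Gamma (\<theta> + 1) * \<theta>) * (\<integral>\<^sup>+z. indicator A z \<partial>H)"
      by (simp only: ennreal_mult''[OF less_imp_le[OF \<theta>_pos]] mult.assoc)
    also have "\<dots> = emeasure H A" unfolding gam by (simp add: sets_H)
    finally show "emeasure (distr N borel (Y 1)) A = emeasure H A" .
  qed (simp add: sets_H)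
  let ?B = "\<Pi>\<^sub>M C\<in>?\<pi>. borel :: real measure" and ?V = "\<lambda>w. \<lambda>C\<in>?\<pi>. block_value Y C w"
  let ?PG = "\<Pi>\<^sub>M C\<in>?\<pi>. gamma_law (real (card C))"
  have V [measurable]: "?V \<in> N \<rightarrow>\<^sub>M (\<Pi>\<^sub>M C\<in>?\<pi>. borel)"
    by (rule measurable_restrict) (auto simp: block Y1 simp del: One_nat_def)
  have law: "distr N (?B \<Otimes>\<^sub>M (\<Pi>\<^sub>M C\<in>?\<pi>. borel)) (\<lambda>w. (\<lambda>C\<in>?\<pi>. R C w, ?V w)) = ?PG \<Otimes>\<^sub>M distr N (\<Pi>\<^sub>M C\<in>?\<pi>. borel) ?V"
  proof -
    have "0 < measure N {w \<in> space N. tie_partition n Y w = ?\<pi>}" by (simp add: tie N.prob_space)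
    from weights[unfolded gamma_block_weights_def Let_def, THEN conjunct2, rule_format, OF this]
    show ?thesis unfolding UN .
  qed
  have sets_PG [measurable_cong]: "sets ?PG = sets ?B" by (rule sets_PiM_cong) auto
  interpret DV: prob_space "distr N borel (\<lambda>w. g (Y 1 w))" by (rule N.prob_space_distr, rule measurable_compose[OF Y1 g])
  have "distr N borel (weighted_block_sum n Y R g) = distr N borel (\<lambda>w. R {1} w * g (Y 1 w))"
    by (rule distr_cong) (simp_all add: weighted_block_sum_def tie block del: One_nat_def)
  also have "\<dots> = distr (distr N (?B \<Otimes>\<^sub>M (\<Pi>\<^sub>M C\<in>?\<pi>. borel)) (\<lambda>w. (\<lambda>C\<in>?\<pi>. R C w, ?V w))) borel (\<lambda>(r, v). r {1} * g (v {1}))"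
    by (subst distr_distr) (auto simp: comp_def block simp del: One_nat_def)
  also have "\<dots> = distr (distr (?PG \<Otimes>\<^sub>M distr N (\<Pi>\<^sub>M C\<in>?\<pi>. borel) ?V) (borel \<Otimes>\<^sub>M borel) (\<lambda>(r, v). (r {1}, g (v {1})))) borel (\<lambda>(x, y). x * y)"
    unfolding law by (subst distr_distr) (auto simp: comp_def case_prod_unfold simp del: One_nat_def)
  also have "distr (?PG \<Otimes>\<^sub>M distr N (\<Pi>\<^sub>M C\<in>?\<pi>. borel) ?V) (borel \<Otimes>\<^sub>M borel) (\<lambda>(r, v). (r {1}, g (v {1})))
      = distr ?PG borel (\<lambda>r. r {1}) \<Otimes>\<^sub>M distr (distr N (\<Pi>\<^sub>M C\<in>?\<pi>. borel) ?V) borel (\<lambda>v. g (v {1}))"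
  proof (rule pair_measure_distr[symmetric])
    show "sigma_finite_measure (distr (distr N (\<Pi>\<^sub>M C\<in>?\<pi>. borel) ?V) borel (\<lambda>v. g (v {1})))"
      using DV.sigma_finite_measure_axioms by (subst distr_distr) (auto simp: comp_def block simp del: One_nat_def)
  qed auto
  also have "distr ?PG borel (\<lambda>r. r {1}) = gamma_law 1"
  proof -
    have "distr ?PG borel (\<lambda>r. r {1}) = distr ?PG (gamma_law (real (card {1::nat}))) (\<lambda>r. r {1})"
      by (rule distr_cong) auto
    also have "\<dots> = gamma_law (real (card {1::nat}))"
      by (rule distr_PiM_component) (auto intro: prob_space_gamma_law)
    finally show ?thesis by simp
  qed
  also have "distr (distr N (\<Pi>\<^sub>M C\<in>?\<pi>. borel) ?V) borel (\<lambda>v. g (v {1})) = distr H borel g"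
    unfolding Y_law[symmetric] by (subst (1 2) distr_distr) (auto simp: comp_def block simp del: One_nat_def)
  finally show ?thesis by (simp add: indep_times_def)
qed

lemma linear_functional_law_eq_distr:
  assumes "random_measure M \<mu>" and g: "g \<in> borel_measurable borel"
  shows "linear_functional_law M \<mu> g = distr (random_measure_law M \<mu>) borel (\<lambda>\<mu>. \<integral>y. g y \<partial>\<mu>)"
  using assms(1) unfolding linear_functional_law_def random_measure_def
  by (subst distr_distr[OF measurable_integral_finite_measure_algebra[OF g]]) (auto simp: comp_def)

theorem proposition2p3:
  fixes H :: "'y::polish_space measure" and \<theta> q \<alpha> :: real and g :: "'y \<Rightarrow> real"
    and M1 :: "'a measure" and \<mu>BG :: "'a \<Rightarrow> 'y measure"
    and M2 :: "'b measure" and P :: "'b \<Rightarrow> 'y measure"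
    and M3 :: "'c measure" and \<mu>G :: "'c \<Rightarrow> 'y measure"
  assumes "prob_space H" and "sets H = sets borel"
    and "0 < \<theta>" and "0 < q" and "0 < \<alpha>"
    and "g \<in> borel_measurable borel"
    and "(\<integral>\<^sup>+y. ennreal (\<theta> * ln (1 + \<bar>g y\<bar>)) \<partial>H) < \<infinity>"
    and "beta_gamma_process \<theta> H (\<theta> - q) M1 \<mu>BG"
    and "dirichlet_process \<theta> H M2 P"
    and "gamma_process \<theta> H M3 \<mu>G"
    and "\<alpha> < q"
  shows
    "(linear_functional_law M1 \<mu>BG g = gamma_law \<alpha> \<longrightarrow>
        linear_functional_law M2 P g = beta_law \<alpha> (q - \<alpha>) \<and>
        linear_functional_law M3 \<mu>G g = indep_times (gamma_law \<theta>) (beta_law \<alpha> (q - \<alpha>)))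
     \<and>
     (\<forall>(n::nat) (N::'d measure) Y G.
        1 \<le> n \<and> blackwell_macqueen \<theta> H n N Y \<and> gamma_block_weights n N Y G \<and>
        convolution (indep_times (gamma_law \<theta>) (beta_law \<alpha> (q - \<alpha>)))
            (distr N borel (weighted_block_sum n Y G g))
          = indep_times (gamma_law (\<theta> + real n)) (beta_law \<alpha> (q - \<alpha>)) \<longrightarrow>
        linear_functional_law M1 \<mu>BG g = gamma_law \<alpha> \<and>
        linear_functional_law M2 P g = beta_law \<alpha> (q - \<alpha>) \<and>
        linear_functional_law M3 \<mu>G g = indep_times (gamma_law \<theta>) (beta_law \<alpha> (q - \<alpha>)))
     \<and>
     (\<forall>(N::'d measure) Y G.
        blackwell_macqueen \<theta> H 1 N Y \<and> gamma_block_weights 1 N Y G \<longrightarrow>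
        (convolution (indep_times (gamma_law \<theta>) (beta_law \<alpha> (q - \<alpha>)))
            (distr N borel (weighted_block_sum 1 Y G g))
           = indep_times (gamma_law (\<theta> + 1)) (beta_law \<alpha> (q - \<alpha>))
         \<longleftrightarrow>
         convolution (indep_times (gamma_law \<theta>) (beta_law \<alpha> (q - \<alpha>)))
            (indep_times (gamma_law 1) (distr H borel g))
           = indep_times (gamma_law (\<theta> + 1)) (beta_law \<alpha> (q - \<alpha>))))"
proof -
  define G where "G = random_measure_law M3 \<mu>G"
  have G_law: "is_gamma_process_law \<theta> H G"
    using assms(10) by (simp add: gamma_process_def G_def)
  interpret G: gamma_process_law \<theta> H G
    by (rule gamma_process_law.intro) (fact assms(1-3) G_law)+
  note g [measurable] = \<open>g \<in> borel_measurable borel\<close>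
  let ?K = "finite_measure_algebra (borel :: 'y measure)"
  let ?I = "\<lambda>\<mu>. \<integral>y. g y \<partial>\<mu>"
  note I [measurable] = measurable_integral_finite_measure_algebra[OF g]
  define \<nu> where "\<nu> = distr G borel (\<lambda>\<mu>. ?I (G.normalise \<mu>))"
  let ?\<beta> = "beta_law \<alpha> (q - \<alpha>)"
  have \<beta>: "0 < \<alpha>" "0 < q - \<alpha>" using assms(5,11) by auto
  note functional_law = linear_functional_law_eq_distr[OF _ g]
  have nu_meas: "(\<lambda>\<mu>. ?I (G.normalise \<mu>)) \<in> borel_measurable G"
    by (rule measurable_compose[OF G.measurable_normalise I])
  have \<nu>: "prob_space \<nu>" "sets \<nu> = sets borel"
    unfolding \<nu>_def by (auto intro: G.G.prob_space_distr nu_meas)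
  interpret \<beta>: prob_space ?\<beta> by (rule prob_space_beta_law[OF \<beta>])
  have L2: "linear_functional_law M2 P g = \<nu>"
  proof -
    obtain G' where G': "is_gamma_process_law \<theta> H G'"
      "random_measure_law M2 P = random_measure_law G' (\<lambda>\<mu>. scale_measure (inverse (emeasure \<mu> UNIV)) \<mu>)"
      and P: "random_measure M2 P"
      using assms(9) by (auto simp: dirichlet_process_def)
    have "G' = G" by (rule gamma_process_law_unique[OF G'(1) G_law])
    then have "random_measure_law M2 P = distr G ?K G.normalise"
      using G'(2) by (simp add: G.normalise_def[abs_def])
    then show ?thesis
      unfolding functional_law[OF P] \<nu>_def using distr_distr[OF I G.measurable_normalise] by (simp add: comp_def)
  qed
  have L3': "linear_functional_law M3 \<mu>G g = distr G borel ?I"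
    using assms(10) functional_law[of M3 \<mu>G] by (simp add: gamma_process_def G_def)
  have L3: "distr G borel ?I = indep_times (gamma_law \<theta>) \<nu>"
  proof -
    have "AE t in distr G borel (\<lambda>\<mu>. measure \<mu> UNIV). 0 < t"
      unfolding G.total_mass_law by (rule AE_gamma_law)
    then have "AE \<mu> in G. 0 < measure \<mu> UNIV" by (subst (asm) AE_distr_iff) auto
    \<comment> \<open>The tilt with exponent 0 is trivial only where the mass is positive, because
      \<open>0 powr 0 = 0\<close>; mass 0 is a null event.\<close>
    then have "AE \<mu> in G. ennreal (Gamma \<theta> / Gamma \<theta> * measure \<mu> UNIV powr (\<theta> - \<theta>)) = 1"
      by eventually_elim (use Gamma_real_pos[OF G.\<theta>_pos] in simp)
    then have "density G (\<lambda>\<mu>. ennreal (Gamma \<theta> / Gamma \<theta> * measure \<mu> UNIV powr (\<theta> - \<theta>))) = density G (\<lambda>_. 1)"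
      by (intro density_cong) auto
    then show ?thesis using G.power_tilt_law[OF G.\<theta>_pos g] by (simp add: density_1 \<nu>_def)
  qed
  \<comment> \<open>For d = \<theta> - q the density T^(-d) with its constant is the power tilt with
    a = q.\<close>
  have L1: "linear_functional_law M1 \<mu>BG g = indep_times (gamma_law q) \<nu>"
  proof -
    obtain G' where G': "is_gamma_process_law \<theta> H G'"
      "random_measure_law M1 \<mu>BG = density G' (\<lambda>\<mu>. ennreal (Gamma \<theta> / Gamma (\<theta> - (\<theta> - q)) * measure \<mu> UNIV powr (- (\<theta> - q))))"
      and BG: "random_measure M1 \<mu>BG"
      using assms(8) by (auto simp: beta_gamma_process_def)
    have "G' = G" by (rule gamma_process_law_unique[OF G'(1) G_law])
    then show ?thesis
      unfolding functional_law[OF BG] G'(2) using G.power_tilt_law[OF \<open>0 < q\<close> g] by (simp add: \<nu>_def)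
  qed
  \<comment> \<open>This identity rewrites the hypothesis of (a) as an equation between two products
    with the common factor T_q, which then cancels. In (b) it is read in the other
    direction.\<close>
  have gq: "indep_times (gamma_law q) ?\<beta> = gamma_law \<alpha>"
    using indep_times_gamma_beta[OF \<beta>] by simp
  have log: "integrable H (\<lambda>y. ln (1 + \<bar>g y\<bar>))"
  proof -
    have [measurable]: "g \<in> borel_measurable H" using assms(2) by (simp cong: measurable_cong_sets)
    have "(\<integral>\<^sup>+y. ennreal (\<theta> * ln (1 + \<bar>g y\<bar>)) \<partial>H) = ennreal \<theta> * (\<integral>\<^sup>+y. ennreal (ln (1 + \<bar>g y\<bar>)) \<partial>H)"
      using G.\<theta>_pos by (subst nn_integral_cmult[symmetric]) (auto simp: ennreal_mult')
    then show ?thesis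
      using assms(7) G.\<theta>_pos by (auto simp: integrable_iff_bounded ennreal_mult_less_top)
  qed
  have main: "\<nu> = ?\<beta>"
    if n: "1 \<le> n" and N: "blackwell_macqueen \<theta> H n N Y" "gamma_block_weights n N Y R"
      and eq: "convolution (indep_times (gamma_law \<theta>) ?\<beta>) (distr N borel (weighted_block_sum n Y R g))
          = indep_times (gamma_law (\<theta> + real n)) ?\<beta>"
    for n :: nat and N :: "'d measure" and Y R
  proof -
    have U: "urn_sample \<theta> H n N Y R" by (rule urn_sample.intro) (fact assms(1-3) N)+
    interpret U: urn_sample \<theta> H n N Y R by (rule U)
    let ?K = "distr N borel (weighted_block_sum n Y R g)"
    let ?B = "beta_law \<theta> (real n)"
    have n0: "0 < real n" and an: "0 < \<theta> + real n" using n G.\<theta>_pos by auto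
    have rd: "real_distribution (indep_times (gamma_law \<theta>) L)" if "prob_space L" "sets L = sets borel" for L
      using prob_space_indep_times[OF prob_space_gamma_law[OF G.\<theta>_pos] that(1) _ that(2)]
      by (simp add: real_distribution_def real_distribution_axioms_def)
    have tilt: "convolution (indep_times (gamma_law \<theta>) \<nu>) ?K = indep_times (gamma_law (\<theta> + real n)) \<nu>"
    proof -
      \<comment> \<open>At mass 0 both sides vanish, because n \<ge> 1.\<close>
      have "measure \<mu> UNIV powr (\<theta> + real n - \<theta>) = measure \<mu> UNIV ^ n" for \<mu> :: "'y measure"
        using n by (cases "measure \<mu> UNIV = 0") (simp_all add: powr_realpow less_le)
      then show ?thesis
        using mass_power_tilt_law[OF G.gamma_process_law_axioms U g log] G.power_tilt_law[OF an g] L3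
        by (simp add: \<nu>_def)
    qed
    have "indep_times (gamma_law \<theta>) \<nu> = indep_times (gamma_law \<theta>) ?\<beta>"
    proof (rule scaled_convolution_fixed_point_unique[where B="?B" and K="?K"])
      show "real_distribution ?K"
        by (rule U.N.real_distribution_distr[OF U.measurable_weighted_block_sum[OF g]])
      show "indep_times ?B (convolution (indep_times (gamma_law \<theta>) \<nu>) ?K) = indep_times (gamma_law \<theta>) \<nu>"
        unfolding tilt by (rule indep_times_gamma_split[OF G.\<theta>_pos n0 \<nu>])
      show "indep_times ?B (convolution (indep_times (gamma_law \<theta>) ?\<beta>) ?K) = indep_times (gamma_law \<theta>) ?\<beta>"
        unfolding eq by (rule indep_times_gamma_split[OF G.\<theta>_pos n0 \<beta>.prob_space_axioms]) simp
    qed (use rd \<nu> \<beta>.prob_space_axioms prob_space_beta_law[OF G.\<theta>_pos n0] AE_beta_law in auto)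
    then show ?thesis by (rule indep_times_gamma_cancel[OF G.\<theta>_pos \<beta> \<nu>])
  qed
  have single: "distr N borel (weighted_block_sum 1 Y R g) = indep_times (gamma_law 1) (distr H borel g)"
    if "blackwell_macqueen \<theta> H 1 N Y" "gamma_block_weights 1 N Y R" for N :: "'d measure" and Y R
  proof -
    interpret urn_sample \<theta> H 1 N Y R by (rule urn_sample.intro) (fact assms(1-3) that)+
    show ?thesis by (rule single_sample_law[OF refl g])
  qed
  show ?thesis
  proof (intro conjI allI impI; (elim conjE)?)
    assume "linear_functional_law M1 \<mu>BG g = gamma_law \<alpha>"
    then have "\<nu> = ?\<beta>"
      using indep_times_gamma_cancel[OF \<open>0 < q\<close> \<beta> \<nu>] L1 gq by simp
    then show "linear_functional_law M2 P g = ?\<beta>"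
      "linear_functional_law M3 \<mu>G g = indep_times (gamma_law \<theta>) ?\<beta>"
      using L2 L3 L3' by simp_all
  next
    fix n :: nat and N :: "'d measure" and Y R
    assume "1 \<le> n" "blackwell_macqueen \<theta> H n N Y" "gamma_block_weights n N Y R"
      "convolution (indep_times (gamma_law \<theta>) ?\<beta>) (distr N borel (weighted_block_sum n Y R g))
          = indep_times (gamma_law (\<theta> + real n)) ?\<beta>"
    from main[OF this] show "linear_functional_law M1 \<mu>BG g = gamma_law \<alpha>"
      "linear_functional_law M2 P g = ?\<beta>"
      "linear_functional_law M3 \<mu>G g = indep_times (gamma_law \<theta>) ?\<beta>"
      using L1 L2 L3 L3' gq by simp_all
  next
    fix N :: "'d measure" and Y R
    assume "blackwell_macqueen \<theta> H 1 N Y" "gamma_block_weights 1 N Y R"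
    then show "(convolution (indep_times (gamma_law \<theta>) ?\<beta>) (distr N borel (weighted_block_sum 1 Y R g))
          = indep_times (gamma_law (\<theta> + 1)) ?\<beta>)
        = (convolution (indep_times (gamma_law \<theta>) ?\<beta>) (indep_times (gamma_law 1) (distr H borel g))
          = indep_times (gamma_law (\<theta> + 1)) ?\<beta>)"
      by (simp only: single)
  qed
qed

end
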